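(* Let $F$ be a field, let $z_1,\dots,z_m$ be non-zero $F$-linear combinations of the variables $x_1,\dots,x_n$, and let $\psi:\Xi\to T$, $K=\operatorname{Ker}(\psi)$, $T_{\mathcal{A},\mathbb{A}_F^n}=\operatorname{Im}(\psi)$ and $P_{L,S}\in\Xi$ be as defined in the context. Let $\mathcal{Y}$ be the set of all pairs $(L,S)$ where $L$ is a non-zero linear relation among $z_1,\dots,z_m$ and $S\subseteq |L|$. Then $$K=(P_{L,S}\mid (L,S)\in\mathcal{Y})$$ as ideals of $\Xi$. In other words, $$T_{\mathcal{A},\mathbb{A}_F^n}=\Xi/(P_{L,S}\mid (L,S)\in\mathcal{Y}).$$
   Context: Let $\Omega=F[x_1,\dots,x_n]\otimes_F\Lambda_F[dx_1,\dots,dx_n]$, where $\Lambda$ denotes the exterior algebra. If $z_i=\sum_j c_{ij}x_j$, put $dz_i=\sum_j c_{ij}\,dx_j$. Let $T=z_1^{-1}\cdots z_m^{-1}\Omega$ be the localization of $\Omega$ obtained by inverting the central elements $z_1,\dots,z_m$. Let $\Xi=F[t_1,\dots,t_m]\otimes_F\Lambda_F[u_1,\dots,u_m]$, and let $\psi:\Xi\to T$ be the ring homomorphism with $\psi(t_i)=z_i^{-1}$ and $\psi(u_i)=z_i^{-1}dz_i$. Write $\mathcal{A}=\{z_1,\dots,z_m\}$. $T_{\mathcal{A},\mathbb{A}_F^n}$ is the subring of $T$ generated over $F$ by all $z_i^{-1}$ and $z_i^{-1}dz_i$, i.e. the image of $\psi$. A (non-zero) linear relation $L$ among the $z_i$ is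 a formal expression $L=\sum_{i\in|L|}a_iz_i$ with $|L|=\{i_1<\dots<i_k\}\subseteq\{1,\dots,m\}$ non-empty and all $a_i\in F\setminus\{0\}$ ($i\in |L|$), such that $\sum_{i\in|L|}a_iz_i=0$ in $F[x_1,\dots,x_n]$. Put $$P_L=\sum_{i\in|L|}a_i\prod_{q\in|L|\setminus\{i\}}t_q\in F[t_1,\dots,t_m].$$ For $S=\{j_1<\dots<j_l\}\subseteq|L|$, define, computing in the localization $t_1^{-1}\cdots t_m^{-1}\Xi$ with the notation $dz_i:=t_i^{-1}u_i$ and $dL:=\sum_{i\in|L|}a_i\,dz_i$, $$P_{L,S}=P_L\,dz_{j_1}\cdots dz_{j_l}-\sum_{s=1}^{l}\Big(\prod_{q\in|L|\setminus\{j_s\}}t_q\Big)\,dz_{j_1}\cdots dz_{j_{s-1}}\,dL\,dz_{j_{s+1}}\cdots dz_{j_l}$$ (in the $s$-th summand $dz_{j_s}$ is replaced by $dL$). This element lies in $\Xi\subseteq t_1^{-1}\cdots t_m^{-1}\Xi$, and $P_{L,\emptyset}=P_L$. *)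

theory Defs
  imports
    "HOL-Library.Poly_Mapping"
    "HOL-Computational_Algebra.Fraction_Field"
    "HOL-Algebra.QuotRing"
    "HOL-Algebra.Generated_Rings"
begin

section \<open>Exterior algebras\<close>

text \<open>
  The exterior algebra over a commutative ring on generators \<open>e\<^sub>i\<close>, \<open>i\<close> a natural number, as a
  free module on the basis of the ordered products \<open>e\<^bsub>i\<^sub>1\<^esub> \<cdots> e\<^bsub>i\<^sub>k\<^esub>\<close>, \<open>i\<^sub>1 < \<dots> < i\<^sub>k\<close>, which are
  indexed by finite sets of indices. The sign below is the one of the permutation that sorts
  the concatenation of the increasing enumerations of two disjoint sets.
\<close>

definition shuffle_sign :: "nat set \<Rightarrow> nat set \<Rightarrow> 'r::comm_ring_1" where
  "shuffle_sign A B = (- 1) ^ card {(a, b). a \<in> A \<and> b \<in> B \<and> b < a}"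

typedef (overloaded) 'r extalg =
  "{f :: nat set \<Rightarrow> 'r::comm_ring_1. finite {A. f A \<noteq> 0} \<and> (\<forall>A. f A \<noteq> 0 \<longrightarrow> finite A)}"
  morphisms coef Abs_extalg
  by (rule exI[of _ "\<lambda>_. 0"]) simp

setup_lifting type_definition_extalg

lemma extalg_eqI: "(\<And>A. coef w A = coef v A) \<Longrightarrow> w = v"
  by (metis coef_inject ext)

lemma finite_coef [simp]: "finite {A. coef w A \<noteq> 0}"
  using coef[of w] by simp

lemma coef_infinite: "infinite A \<Longrightarrow> coef w A = 0"
  using coef[of w] by auto

lemma shuffle_sign_empty [simp]: "shuffle_sign {} B = 1" "shuffle_sign A {} = 1"
  by (simp_all add: shuffle_sign_def)

lemma finite_inversions:
  "finite A \<Longrightarrow> finite B \<Longrightarrow> finite {(a, b). a \<in> A \<and> b \<in> B \<and> (b::nat) < a}"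
  by (rule finite_subset[of _ "A \<times> B"]) auto

lemma shuffle_sign_Un_left:
  assumes "finite A" "finite B" "finite C" "A \<inter> B = {}"
  shows "shuffle_sign (A \<union> B) C = shuffle_sign A C * shuffle_sign B C"
proof -
  have "{(a, b). a \<in> A \<union> B \<and> b \<in> C \<and> b < a} =
    {(a, b). a \<in> A \<and> b \<in> C \<and> b < a} \<union> {(a, b). a \<in> B \<and> b \<in> C \<and> b < a}" by auto
  moreover have "card \<dots> = card {(a, b). a \<in> A \<and> b \<in> C \<and> b < a} + card {(a, b). a \<in> B \<and> b \<in> C \<and> b < a}"
    using assms by (intro card_Un_disjoint finite_inversions) auto
  ultimately show ?thesis by (simp add: shuffle_sign_def power_add)
qed

lemma shuffle_sign_Un_right:
  assumes "finite A" "finite B" "finite C" "B \<inter> C = {}"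
  shows "shuffle_sign A (B \<union> C) = shuffle_sign A B * shuffle_sign A C"
proof -
  have "{(a, b). a \<in> A \<and> b \<in> B \<union> C \<and> b < a} =
    {(a, b). a \<in> A \<and> b \<in> B \<and> b < a} \<union> {(a, b). a \<in> A \<and> b \<in> C \<and> b < a}" by auto
  moreover have "card \<dots> = card {(a, b). a \<in> A \<and> b \<in> B \<and> b < a} + card {(a, b). a \<in> A \<and> b \<in> C \<and> b < a}"
    using assms by (intro card_Un_disjoint finite_inversions) auto
  ultimately show ?thesis by (simp add: shuffle_sign_def power_add)
qed

instantiation extalg :: (comm_ring_1) ring_1
begin

lift_definition zero_extalg :: "'a extalg" is "\<lambda>_. 0" by simp

lift_definition one_extalg :: "'a extalg" is "\<lambda>A. if A = {} then 1 else 0" by auto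

lift_definition plus_extalg :: "'a extalg \<Rightarrow> 'a extalg \<Rightarrow> 'a extalg"
  is "\<lambda>f g A. f A + g A"
proof (safe, goal_cases)
  case (1 f g)
  then show ?case by - (rule finite_subset[of _ "{A. f A \<noteq> 0} \<union> {A. g A \<noteq> 0}"], auto)
next
  case (2 f g A)
  then show ?case by (metis add_0)
qed

lift_definition uminus_extalg :: "'a extalg \<Rightarrow> 'a extalg"
  is "\<lambda>f A. - f A" by simp

lift_definition minus_extalg :: "'a extalg \<Rightarrow> 'a extalg \<Rightarrow> 'a extalg"
  is "\<lambda>f g A. f A - g A"
proof (safe, goal_cases)
  case (1 f g)
  then show ?case by - (rule finite_subset[of _ "{A. f A \<noteq> 0} \<union> {A. g A \<noteq> 0}"], auto)
next
  case (2 f g A)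
  then show ?case by (metis diff_0_right)
qed

lift_definition times_extalg :: "'a extalg \<Rightarrow> 'a extalg \<Rightarrow> 'a extalg"
  is "\<lambda>f g C. if finite C then \<Sum>A\<in>Pow C. shuffle_sign A (C - A) * f A * g (C - A) else 0"
proof (safe, goal_cases)
  case (1 f g)
  have "{C. (if finite C then \<Sum>A\<in>Pow C. shuffle_sign A (C - A) * f A * g (C - A) else 0) \<noteq> 0}
    \<subseteq> (\<lambda>(A, B). A \<union> B) ` ({A. f A \<noteq> 0} \<times> {B. g B \<noteq> 0})"
  proof
    fix C assume "C \<in> {C. (if finite C then \<Sum>A\<in>Pow C. shuffle_sign A (C - A) * f A * g (C - A) else 0) \<noteq> 0}"
    then have "(\<Sum>A\<in>Pow C. shuffle_sign A (C - A) * f A * g (C - A)) \<noteq> 0" by (metis (mono_tags, lifting) mem_Collect_eq)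
    then obtain A where "A \<subseteq> C" "shuffle_sign A (C - A) * f A * g (C - A) \<noteq> 0"
      by (metis (no_types, lifting) PowD sum.not_neutral_contains_not_neutral)
    then have "(A, C - A) \<in> {A. f A \<noteq> 0} \<times> {B. g B \<noteq> 0}" "C = (case (A, C - A) of (A, B) \<Rightarrow> A \<union> B)" by auto
    then show "C \<in> (\<lambda>(A, B). A \<union> B) ` ({A. f A \<noteq> 0} \<times> {B. g B \<noteq> 0})" by blast
  qed
  then show ?case by (rule finite_subset) (use 1 in simp)
next
  case (2 f g C)
  then show ?case by presburger
qed

instance
proof
  fix a b c :: "'a extalg"
  show "a + b + c = a + (b + c)" by transfer (simp add: ac_simps)
  show "a + b = b + a" by transfer (simp add: ac_simps)
  show "0 + a = a" by transfer simp
  show "- a + a = 0" by transfer simp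
  show "a - b = a + - b" by transfer simp
  show "(0::'a extalg) \<noteq> 1" by transfer (auto simp: fun_eq_iff)
  show "(a + b) * c = a * c + b * c"
    by transfer (simp add: fun_eq_iff algebra_simps sum.distrib)
  show "a * (b + c) = a * b + a * c"
    by transfer (simp add: fun_eq_iff algebra_simps sum.distrib)
  show "1 * a = a"
  proof (rule extalg_eqI)
    fix C
    show "coef (1 * a) C = coef a C"
    proof (cases "finite C")
      case True
      then have "coef (1 * a) C = (\<Sum>A\<in>Pow C. shuffle_sign A (C - A) * coef 1 A * coef a (C - A))"
        by (simp add: times_extalg.rep_eq)
      also have "\<dots> = (\<Sum>A\<in>Pow C. if A = {} then coef a C else 0)"
        by (rule sum.cong) (auto simp: one_extalg.rep_eq)
      finally show ?thesis using True by simp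
    qed (simp add: coef_infinite)
  qed
  show "a * 1 = a"
  proof (rule extalg_eqI)
    fix C
    show "coef (a * 1) C = coef a C"
    proof (cases "finite C")
      case True
      then have "coef (a * 1) C = (\<Sum>A\<in>Pow C. shuffle_sign A (C - A) * coef a A * coef 1 (C - A))"
        by (simp add: times_extalg.rep_eq)
      also have "\<dots> = (\<Sum>A\<in>Pow C. if A = C then coef a C else 0)"
        by (rule sum.cong) (auto simp: one_extalg.rep_eq)
      finally show ?thesis using True by simp
    qed (simp add: coef_infinite)
  qed
  show "a * b * c = a * (b * c)"
  proof (rule extalg_eqI)
    fix D
    show "coef (a * b * c) D = coef (a * (b * c)) D"
    proof (cases "finite D")
      case True
      have fin: "finite E" if "E \<in> Pow D" for E using that True finite_subset by auto
      have "coef (a * b * c) D = (\<Sum>E\<in>Pow D. \<Sum>A\<in>Pow E. shuffle_sign E (D - E) *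
          (shuffle_sign A (E - A) * coef a A * coef b (E - A)) * coef c (D - E))"
        unfolding times_extalg.rep_eq[of _ c] times_extalg.rep_eq[of a b]
        using True fin by (simp add: sum_distrib_left sum_distrib_right)
      also have "\<dots> = (\<Sum>(E, A)\<in>Sigma (Pow D) Pow. shuffle_sign E (D - E) *
          (shuffle_sign A (E - A) * coef a A * coef b (E - A)) * coef c (D - E))"
        using True fin by (intro sum.Sigma) auto
      also have "\<dots> = (\<Sum>(A, B)\<in>Sigma (Pow D) (\<lambda>A. Pow (D - A)). shuffle_sign A (D - A) * coef a A *
          (shuffle_sign B (D - A - B) * coef b B * coef c (D - A - B)))"
      proof (rule sum.reindex_bij_witness[of _ "\<lambda>(A, B). (A \<union> B, A)" "\<lambda>(E, A). (A, E - A)"], goal_cases)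
        case (5 p)
        then obtain E A where p: "p = (E, A)" "A \<subseteq> E" "E \<subseteq> D" by auto
        have f: "finite A" "finite (E - A)" "finite (D - E)" using p by (auto intro!: finite_subset[OF _ True])
        have eq: "D - A - (E - A) = D - E" "D - A = (E - A) \<union> (D - E)"
          using p by auto
        have "(shuffle_sign E (D - E) :: 'a) = shuffle_sign A (D - E) * shuffle_sign (E - A) (D - E)"
          using shuffle_sign_Un_left[OF f] p(2) by (simp add: Un_absorb1)
        moreover have "(shuffle_sign A (D - A) :: 'a) = shuffle_sign A (E - A) * shuffle_sign A (D - E)"
          unfolding eq(2) using f by (intro shuffle_sign_Un_right) auto
        ultimately show ?case unfolding p(1) prod.case eq(1) by (simp only: ac_simps)
      qed auto
      also have "\<dots> = coef (a * (b * c)) D"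
        using True
        by (subst sum.Sigma[symmetric])
           (simp_all add: times_extalg.rep_eq sum_distrib_left sum_distrib_right cong: sum.cong)
      finally show ?thesis .
    qed (simp add: coef_infinite)
  qed
qed

end

lift_definition scal :: "'r::comm_ring_1 \<Rightarrow> 'r extalg"
  is "\<lambda>r A. if A = {} then r else 0"
proof (rule conjI)
  fix r :: 'r
  show "finite {A::nat set. (if A = {} then r else 0) \<noteq> 0}"
    by (rule finite_subset[of _ "{{}}"]) auto
qed simp

lift_definition gen :: "nat \<Rightarrow> 'r::comm_ring_1 extalg"
  is "\<lambda>i A. if A = {i} then 1 else 0"
  by auto

definition oprod :: "(nat \<Rightarrow> 'b::monoid_mult) \<Rightarrow> nat set \<Rightarrow> 'b" where
  "oprod \<theta> A = prod_list (map \<theta> (sorted_list_of_set A))"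

lemmas coef_simps [simp] = zero_extalg.rep_eq plus_extalg.rep_eq
  uminus_extalg.rep_eq minus_extalg.rep_eq

lemma coef_sum: "coef (sum f I) A = (\<Sum>i\<in>I. coef (f i) A)"
  by (induction I rule: infinite_finite_induct) auto

lemma coef_mult:
  "finite C \<Longrightarrow> coef (w * v) C = (\<Sum>A\<in>Pow C. shuffle_sign A (C - A) * coef w A * coef v (C - A))"
  by (simp add: times_extalg.rep_eq)

lemma coef_scal_mult [simp]: "coef (scal r * w) C = r * coef w C"
proof (cases "finite C")
  case True
  have "coef (scal r * w) C = (\<Sum>A\<in>Pow C. if A = {} then r * coef w C else 0)"
    unfolding coef_mult[OF True] by (rule sum.cong) (auto simp: scal.rep_eq)
  then show ?thesis using True by simp
qed (simp add: coef_infinite)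

lemma coef_mult_scal [simp]: "coef (w * scal r) C = r * coef w C"
proof (cases "finite C")
  case True
  have "coef (w * scal r) C = (\<Sum>A\<in>Pow C. if A = C then r * coef w C else 0)"
    unfolding coef_mult[OF True] by (rule sum.cong) (auto simp: scal.rep_eq)
  then show ?thesis using True by simp
qed (simp add: coef_infinite)

lemma scal_commute: "w * scal r = scal r * w"
  by (rule extalg_eqI) simp

lemma scal_left_commute: "w * (scal r * v) = scal r * (w * v)"
  by (metis mult.assoc scal_commute)

lemma scal_0 [simp]: "scal 0 = 0" and scal_1 [simp]: "scal 1 = 1"
  by (transfer, auto)+

lemma scal_add: "scal (r + s) = scal r + scal s"
  and scal_diff: "scal (r - s) = scal r - scal s"
  and scal_uminus: "scal (- r) = - scal r"
  by (transfer, auto)+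

lemma scal_mult: "scal (r * s) = scal r * scal s"
  by (rule extalg_eqI) (simp add: scal.rep_eq)

lemma scal_sum: "scal (sum f I) = (\<Sum>i\<in>I. scal (f i))"
  by (induction I rule: infinite_finite_induct) (auto simp: scal_add)

lemma scal_mult_scal: "(scal r * w) * (scal s * v) = scal (r * s) * (w * v)"
  by (simp only: mult.assoc scal_left_commute[of w] scal_mult)

lemma scal_mult_assoc: "scal r * (scal s * w) = scal (r * s) * w"
  by (simp add: scal_mult mult.assoc)

lemma coef_gen_mult:
  "coef (gen i * w) C =
    (if finite C \<and> i \<in> C then shuffle_sign {i} (C - {i}) * coef w (C - {i}) else 0)"
proof (cases "finite C")
  case True
  have "coef (gen i * w) C = (\<Sum>A\<in>Pow C. if A = {i} then shuffle_sign {i} (C - {i}) * coef w (C - {i}) else 0)"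
    unfolding coef_mult[OF True] by (rule sum.cong) (auto simp: gen.rep_eq)
  then show ?thesis using True by (auto simp: coef_infinite)
qed (simp add: coef_infinite)

lemma gen_square: "gen i * gen i = (0 :: 'r::comm_ring_1 extalg)"
  by (rule extalg_eqI) (auto simp: coef_gen_mult gen.rep_eq)

lemma shuffle_sign_singletons: "shuffle_sign {i} {j} = (if j < i then - 1 else 1)"
proof -
  have "{(a, b). a \<in> {i} \<and> b \<in> {j} \<and> b < a} = (if j < i then {(i, j)} else {})" by auto
  then show ?thesis by (simp add: shuffle_sign_def)
qed

lemma gen_anticommute: "gen i * gen j = - (gen j * gen i :: 'r::comm_ring_1 extalg)"
proof (cases "i = j")
  case False
  have *: "finite C \<and> i \<in> C \<and> C - {i} = {j} \<longleftrightarrow> C = {i, j}"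
    "finite C \<and> j \<in> C \<and> C - {j} = {i} \<longleftrightarrow> C = {i, j}" for C
    using False by auto
  show ?thesis
  proof (rule extalg_eqI)
    fix C
    have "coef (gen i * gen j :: 'r extalg) C = (if C = {i, j} then shuffle_sign {i} {j} else 0)"
      using *[of C] by (auto simp: coef_gen_mult gen.rep_eq)
    moreover have "coef (gen j * gen i :: 'r extalg) C = (if C = {i, j} then shuffle_sign {j} {i} else 0)"
      using *[of C] by (auto simp: coef_gen_mult gen.rep_eq)
    ultimately show "coef (gen i * gen j :: 'r extalg) C = coef (- (gen j * gen i)) C"
      using False by (simp add: shuffle_sign_singletons)
  qed
qed (simp add: gen_square)

lemma one_form_anticommute:
  fixes r s :: "nat \<Rightarrow> 'r::comm_ring_1"
  shows "(\<Sum>j\<in>J. scal (r j) * gen j) * (\<Sum>k\<in>K. scal (s k) * gen k) =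
    - ((\<Sum>k\<in>K. scal (s k) * gen k) * (\<Sum>j\<in>J. scal (r j) * gen j))"
proof -
  have *: "scal a * gen j * (scal b * gen k) = - (scal b * gen k * (scal a * gen j))"
    for a b :: 'r and j k
    unfolding scal_mult_scal by (subst gen_anticommute) (simp add: mult.commute[of a b])
  show ?thesis
    unfolding sum_product sum_negf[symmetric] by (subst sum.swap) (intro sum.cong refl *)
qed

lemma one_form_square:
  fixes r :: "nat \<Rightarrow> 'r::comm_ring_1"
  shows "(\<Sum>j\<in>J. scal (r j) * gen j) * (\<Sum>j\<in>J. scal (r j) * gen j) = 0"
proof (induction J rule: infinite_finite_induct)
  case (insert j J)
  let ?x = "\<Sum>j\<in>J. scal (r j) * gen j" and ?y = "scal (r j) * gen j"
  have "?x * ?y = - (?y * ?x)"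
    using one_form_anticommute[where J = J and K = "{j}" and r = r and s = r] by simp
  moreover have "?y * ?y = 0"
    by (simp only: scal_mult_scal gen_square mult_zero_right)
  ultimately show ?case using insert by (simp add: algebra_simps)
qed auto

lemma oprod_empty [simp]: "oprod \<theta> {} = 1"
  by (simp add: oprod_def)

lemma oprod_singleton [simp]: "oprod \<theta> {i} = \<theta> i"
  by (simp add: oprod_def)

lemma oprod_insert_min:
  assumes "finite A" "\<And>a. a \<in> A \<Longrightarrow> b < a"
  shows "oprod \<theta> (insert b A) = \<theta> b * oprod \<theta> A"
proof -
  have "b \<notin> A" using assms(2) by blast
  then have "sorted_list_of_set (insert b A) = insort b (sorted_list_of_set A)"
    using assms(1) by simp
  also have "\<dots> = b # sorted_list_of_set A"
    using assms by (intro insort_is_Cons) (auto simp: less_imp_le)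
  finally show ?thesis by (simp add: oprod_def)
qed

lemma shuffle_sign_less:
  assumes "\<And>a b. a \<in> A \<Longrightarrow> b \<in> B \<Longrightarrow> a < b"
  shows "shuffle_sign A B = 1"
proof -
  have "{(a, b). a \<in> A \<and> b \<in> B \<and> b < a} = {}" using assms by fastforce
  then show ?thesis unfolding shuffle_sign_def by (simp only: card.empty power_0)
qed

lemma odd_mult_oprod:
  fixes \<theta> :: "nat \<Rightarrow> 'r::comm_ring_1 extalg"
  assumes anti: "\<And>i j. \<theta> i * \<theta> j = - (\<theta> j * \<theta> i)" and sq: "\<And>i. \<theta> i * \<theta> i = 0"
    and "finite B"
  shows "\<theta> i * oprod \<theta> B =
    (if i \<in> B then 0 else scal (shuffle_sign {i} B) * oprod \<theta> (insert i B))"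
  using \<open>finite B\<close>
proof (induction B rule: finite_linorder_min_induct)
  case (insert b B)
  note ob = oprod_insert_min[OF insert(1), of b \<theta>]
  have ob: "oprod \<theta> (insert b B) = \<theta> b * oprod \<theta> B" using ob insert(2) by auto
  consider "i = b" | "i < b" | "b < i" by linarith
  then show ?case
  proof cases
    case 1
    then show ?thesis by (simp add: ob mult.assoc[symmetric] sq)
  next
    case 2
    then have less: "\<And>a. a \<in> insert b B \<Longrightarrow> i < a" using insert(2) by auto
    then have "i \<notin> insert b B" by blast
    moreover have "oprod \<theta> (insert i (insert b B)) = \<theta> i * oprod \<theta> (insert b B)"
      using less insert(1) by (intro oprod_insert_min) auto
    moreover have "shuffle_sign {i} (insert b B) = (1::'r)"
      using less by (intro shuffle_sign_less) blast
    ultimately show ?thesis by simp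
  next
    case 3
    have "b \<notin> B" using insert(2) by blast
    then have s: "shuffle_sign {i} (insert b B) = - (shuffle_sign {i} B :: 'r)"
      using shuffle_sign_Un_right[of "{i}" "{b}" B] insert(1) 3 by (simp add: shuffle_sign_singletons)
    have o: "oprod \<theta> (insert i (insert b B)) = \<theta> b * oprod \<theta> (insert i B)"
      unfolding insert_commute[of i b] using insert 3 by (intro oprod_insert_min) auto
    have "\<theta> i * oprod \<theta> (insert b B) = - (\<theta> b * (\<theta> i * oprod \<theta> B))"
      unfolding ob mult.assoc[symmetric] anti[of i b] by simp
    then show ?thesis using 3 by (simp add: insert.IH s o scal_left_commute[of "\<theta> b"] scal_uminus)
  qed
qed simp

lemma oprod_mult_oprod:
  fixes \<theta> :: "nat \<Rightarrow> 'r::comm_ring_1 extalg"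
  assumes anti: "\<And>i j. \<theta> i * \<theta> j = - (\<theta> j * \<theta> i)" and sq: "\<And>i. \<theta> i * \<theta> i = 0"
    and "finite A" and B: "finite B"
  shows "oprod \<theta> A * oprod \<theta> B =
    (if A \<inter> B = {} then scal (shuffle_sign A B) * oprod \<theta> (A \<union> B) else 0)"
  using \<open>finite A\<close>
proof (induction A rule: finite_linorder_min_induct)
  case (insert a A)
  have a: "a \<notin> A" using insert(2) by blast
  have odd: "\<theta> a * oprod \<theta> (A \<union> B) = (if a \<in> A \<union> B then 0
      else scal (shuffle_sign {a} (A \<union> B)) * oprod \<theta> (insert a (A \<union> B)))"
    using insert(1) B by (intro odd_mult_oprod anti sq) auto
  have "oprod \<theta> (insert a A) * oprod \<theta> B = \<theta> a * (oprod \<theta> A * oprod \<theta> B)"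
    using oprod_insert_min[OF insert(1), of a \<theta>] insert(2) by (auto simp: mult.assoc)
  also have "\<dots> = (if A \<inter> B = {} then scal (shuffle_sign A B) * (\<theta> a * oprod \<theta> (A \<union> B)) else 0)"
    by (simp add: insert.IH scal_left_commute[of "\<theta> a"])
  also have "\<dots> = (if insert a A \<inter> B = {} then
      scal (shuffle_sign (insert a A) B) * oprod \<theta> (insert a A \<union> B) else 0)"
  proof (cases "insert a A \<inter> B = {}")
    case True
    then have d: "a \<notin> A \<union> B" "A \<inter> B = {}" using a by auto
    have "shuffle_sign {a} (A \<union> B) = (shuffle_sign {a} A * shuffle_sign {a} B :: 'r)"
      using d insert(1) B by (intro shuffle_sign_Un_right) auto
    moreover have "shuffle_sign {a} A = (1::'r)"
      using insert(2) by (intro shuffle_sign_less) blast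
    moreover have "shuffle_sign ({a} \<union> A) B = (shuffle_sign {a} B * shuffle_sign A B :: 'r)"
      using a insert(1) B by (intro shuffle_sign_Un_left) auto
    ultimately show ?thesis using d True odd
      by (simp add: scal_mult_assoc mult.commute)
  next
    case False
    then show ?thesis using odd by auto
  qed
  finally show ?case .
qed simp

lemma coef_oprod_gen:
  assumes "finite A"
  shows "coef (oprod gen A :: 'r::comm_ring_1 extalg) C = (if C = A then 1 else 0)"
  using assms
proof (induction A arbitrary: C rule: finite_linorder_min_induct)
  case empty
  then show ?case by (simp add: one_extalg.rep_eq)
next
  case (insert b A)
  have b: "b \<notin> A" using insert(2) by blast
  have "coef (oprod gen (insert b A) :: 'r extalg) C = coef (gen b * oprod gen A) C"
    using oprod_insert_min[OF insert(1), of b "gen :: nat \<Rightarrow> 'r extalg"] insert(2) by simp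
  also have "\<dots> = (if finite C \<and> b \<in> C then shuffle_sign {b} (C - {b}) * (if C - {b} = A then 1 else 0) else 0)"
    by (simp add: coef_gen_mult insert.IH)
  also have "\<dots> = (if C = insert b A then 1 else 0)"
  proof (cases "C = insert b A")
    case True
    then have "C - {b} = A" using b by auto
    moreover have "shuffle_sign {b} A = (1::'r)" using insert(2) by (intro shuffle_sign_less) blast
    ultimately show ?thesis using True insert(1) by simp
  qed (use b in auto)
  finally show ?case .
qed

lemma extalg_expand:
  assumes "finite U" "\<And>A. coef w A \<noteq> 0 \<Longrightarrow> A \<in> U"
  shows "w = (\<Sum>A\<in>U. scal (coef w A) * oprod gen A)"
proof (rule extalg_eqI)
  fix C
  have "coef (\<Sum>A\<in>U. scal (coef w A) * oprod gen A) C = (\<Sum>A\<in>U. if A = C then coef w C else 0)"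
    unfolding coef_sum
  proof (rule sum.cong)
    fix A assume "A \<in> U"
    show "coef (scal (coef w A) * oprod gen A) C = (if A = C then coef w C else 0)"
      by (cases "finite A") (auto simp: coef_oprod_gen coef_infinite)
  qed simp
  also have "\<dots> = coef w C" using assms by auto
  finally show "coef w C = coef (\<Sum>A\<in>U. scal (coef w A) * oprod gen A) C" ..
qed

definition extalg_eval ::
  "('r::comm_ring_1 \<Rightarrow> 's::comm_ring_1) \<Rightarrow> (nat \<Rightarrow> 's extalg) \<Rightarrow> 'r extalg \<Rightarrow> 's extalg" where
  "extalg_eval \<phi> \<theta> w = (\<Sum>A | coef w A \<noteq> 0. scal (\<phi> (coef w A)) * oprod \<theta> A)"

lemma extalg_eval_superset:
  assumes "\<phi> 0 = 0" "finite U" "\<And>A. coef w A \<noteq> 0 \<Longrightarrow> A \<in> U"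
  shows "extalg_eval \<phi> \<theta> w = (\<Sum>A\<in>U. scal (\<phi> (coef w A)) * oprod \<theta> A)"
  unfolding extalg_eval_def using assms by (intro sum.mono_neutral_left) auto

lemma extalg_support_bound:
  "\<exists>V. finite V \<and> (\<forall>A. coef w A \<noteq> 0 \<longrightarrow> A \<in> Pow V)"
proof (intro exI conjI)
  show "finite (\<Union> {A. coef w A \<noteq> 0})"
    by (rule finite_Union) (auto intro: ccontr simp: coef_infinite)
qed auto

lemma extalg_eval_scal: "\<phi> 0 = 0 \<Longrightarrow> extalg_eval \<phi> \<theta> (scal r) = scal (\<phi> r)"
  by (subst extalg_eval_superset[of _ "{{}}"]) (auto simp: scal.rep_eq split: if_splits)

lemma extalg_eval_gen: "\<phi> 0 = 0 \<Longrightarrow> \<phi> 1 = 1 \<Longrightarrow> extalg_eval \<phi> \<theta> (gen i) = \<theta> i"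
  by (subst extalg_eval_superset[of _ "{{i}}"]) (auto simp: gen.rep_eq split: if_splits)

lemma extalg_eval_add:
  assumes "\<phi> 0 = 0" "\<And>r s. \<phi> (r + s) = \<phi> r + \<phi> s"
  shows "extalg_eval \<phi> \<theta> (w + v) = extalg_eval \<phi> \<theta> w + extalg_eval \<phi> \<theta> v"
proof -
  obtain V W where V: "finite V" "\<And>A. coef w A \<noteq> 0 \<Longrightarrow> A \<subseteq> V"
    and W: "finite W" "\<And>A. coef v A \<noteq> 0 \<Longrightarrow> A \<subseteq> W"
    using extalg_support_bound[of w] extalg_support_bound[of v] by auto
  have *: "extalg_eval \<phi> \<theta> u = (\<Sum>A\<in>Pow (V \<union> W). scal (\<phi> (coef u A)) * oprod \<theta> A)"
    if "\<And>A. coef u A \<noteq> 0 \<Longrightarrow> A \<subseteq> V \<union> W" for u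
    using assms(1) V(1) W(1) that by (intro extalg_eval_superset) auto
  have "A \<subseteq> V \<union> W" if "coef (w + v) A \<noteq> 0" for A
  proof -
    from that have "coef w A \<noteq> 0 \<or> coef v A \<noteq> 0" by auto
    then show ?thesis using V W by blast
  qed
  then show ?thesis
    using V W by (subst (1 2 3) *) (auto simp: assms scal_add algebra_simps sum.distrib)
qed

lemma extalg_eval_mult:
  fixes \<theta> :: "nat \<Rightarrow> 's::comm_ring_1 extalg"
  assumes anti: "\<And>i j. \<theta> i * \<theta> j = - (\<theta> j * \<theta> i)" and sq: "\<And>i. \<theta> i * \<theta> i = 0"
    and \<phi>: "\<phi> 0 = 0" "\<phi> 1 = 1" "\<And>r s. \<phi> (r + s) = \<phi> r + \<phi> s" "\<And>r s. \<phi> (r * s) = \<phi> r * \<phi> s"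
  shows "extalg_eval \<phi> \<theta> (w * v) = extalg_eval \<phi> \<theta> w * extalg_eval \<phi> \<theta> v"
proof -
  obtain V W where V: "finite V" "\<And>A. coef w A \<noteq> 0 \<Longrightarrow> A \<subseteq> V"
    and W: "finite W" "\<And>A. coef v A \<noteq> 0 \<Longrightarrow> A \<subseteq> W"
    using extalg_support_bound[of w] extalg_support_bound[of v] by auto
  define U where "U = V \<union> W"
  have U: "finite U" "\<And>A. coef w A \<noteq> 0 \<Longrightarrow> A \<subseteq> U" "\<And>A. coef v A \<noteq> 0 \<Longrightarrow> A \<subseteq> U"
    using V W by (auto simp: U_def)
  have fin: "finite A" if "A \<subseteq> U" for A using that U(1) finite_subset by blast
  have \<phi>_minus: "\<phi> (- r) = - \<phi> r" for r
    using \<phi>(3)[of "- r" r] \<phi>(1) by (simp add: eq_neg_iff_add_eq_0)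
  have \<phi>_sign: "\<phi> (shuffle_sign A B) = shuffle_sign A B" for A B
  proof -
    have "\<phi> ((- 1) ^ k) = (- 1) ^ k" for k by (induction k) (simp_all add: \<phi> \<phi>_minus)
    then show ?thesis by (simp add: shuffle_sign_def)
  qed
  have \<phi>_sum: "\<phi> (sum f I) = (\<Sum>i\<in>I. \<phi> (f i))" for f :: "nat set \<Rightarrow> _" and I
    by (induction I rule: infinite_finite_induct) (auto simp: \<phi>)
  have supp: "C \<subseteq> U" if "coef (w * v) C \<noteq> 0" for C
  proof -
    have "finite C" using that coef_infinite by blast
    then obtain A where A: "A \<in> Pow C" "shuffle_sign A (C - A) * coef w A * coef v (C - A) \<noteq> 0"
      using \<open>coef (w * v) C \<noteq> 0\<close> unfolding coef_mult[OF \<open>finite C\<close>]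
      by (elim sum.not_neutral_contains_not_neutral)
    from A(2) have "coef w A \<noteq> 0" "coef v (C - A) \<noteq> 0" by auto
    with A(1) show ?thesis using U by blast
  qed
  have "extalg_eval \<phi> \<theta> (w * v) = (\<Sum>C\<in>Pow U. scal (\<phi> (coef (w * v) C)) * oprod \<theta> C)"
    using \<phi>(1) U(1) supp by (intro extalg_eval_superset) auto
  also have "\<dots> = (\<Sum>C\<in>Pow U. \<Sum>A\<in>Pow C. scal (shuffle_sign A (C - A) * \<phi> (coef w A) * \<phi> (coef v (C - A))) * oprod \<theta> C)"
    by (rule sum.cong) (simp_all add: coef_mult fin \<phi>_sum \<phi>_sign \<phi>(4) scal_sum sum_distrib_right)
  also have "\<dots> = (\<Sum>(C, A)\<in>Sigma (Pow U) Pow. scal (shuffle_sign A (C - A) * \<phi> (coef w A) * \<phi> (coef v (C - A))) * oprod \<theta> C)"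
    using U(1) fin by (intro sum.Sigma) auto
  also have "\<dots> = (\<Sum>(A, B)\<in>{(A, B). A \<subseteq> U \<and> B \<subseteq> U \<and> A \<inter> B = {}}.
      scal (shuffle_sign A B * \<phi> (coef w A) * \<phi> (coef v B)) * oprod \<theta> (A \<union> B))"
  proof (rule sum.reindex_bij_witness[of _ "\<lambda>(A, B). (A \<union> B, A)" "\<lambda>(C, A). (A, C - A)"], goal_cases)
    case (5 p)
    then obtain C A where "p = (C, A)" "A \<subseteq> C" by auto
    then show ?case by (simp add: Un_absorb1)
  qed auto
  also have "\<dots> = (\<Sum>(A, B)\<in>{(A, B). A \<subseteq> U \<and> B \<subseteq> U \<and> A \<inter> B = {}}.
      scal (\<phi> (coef w A)) * oprod \<theta> A * (scal (\<phi> (coef v B)) * oprod \<theta> B))"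
  proof (rule sum.cong, safe)
    fix A B assume "A \<subseteq> U" "B \<subseteq> U" "A \<inter> B = {}"
    then have *: "oprod \<theta> A * oprod \<theta> B = scal (shuffle_sign A B) * oprod \<theta> (A \<union> B)"
      by (simp add: oprod_mult_oprod[OF anti sq] fin)
    show "scal (shuffle_sign A B * \<phi> (coef w A) * \<phi> (coef v B)) * oprod \<theta> (A \<union> B) =
        scal (\<phi> (coef w A)) * oprod \<theta> A * (scal (\<phi> (coef v B)) * oprod \<theta> B)"
      unfolding scal_mult_scal * by (simp add: scal_mult_assoc ac_simps)
  qed
  also have "\<dots> = (\<Sum>(A, B)\<in>Pow U \<times> Pow U.
      scal (\<phi> (coef w A)) * oprod \<theta> A * (scal (\<phi> (coef v B)) * oprod \<theta> B))"
  proof (rule sum.mono_neutral_left)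
    show "\<forall>p\<in>Pow U \<times> Pow U - {(A, B). A \<subseteq> U \<and> B \<subseteq> U \<and> A \<inter> B = {}}.
      (case p of (A, B) \<Rightarrow> scal (\<phi> (coef w A)) * oprod \<theta> A * (scal (\<phi> (coef v B)) * oprod \<theta> B)) = 0"
    proof
      fix p assume "p \<in> Pow U \<times> Pow U - {(A, B). A \<subseteq> U \<and> B \<subseteq> U \<and> A \<inter> B = {}}"
      then obtain A B where p: "p = (A, B)" "A \<subseteq> U" "B \<subseteq> U" "A \<inter> B \<noteq> {}" by auto
      then have *: "oprod \<theta> A * oprod \<theta> B = 0"
        by (auto simp add: oprod_mult_oprod[OF anti sq] fin)
      show "(case p of (A, B) \<Rightarrow> scal (\<phi> (coef w A)) * oprod \<theta> A * (scal (\<phi> (coef v B)) * oprod \<theta> B)) = 0"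
        unfolding p(1) prod.case scal_mult_scal * by simp
    qed
  qed (use U(1) in auto)
  also have "\<dots> = extalg_eval \<phi> \<theta> w * extalg_eval \<phi> \<theta> v"
    using U \<phi>(1)
    by (simp add: extalg_eval_superset[of \<phi> "Pow U"] sum_product sum.cartesian_product)
  finally show ?thesis .
qed

section \<open>Polynomial differential forms\<close>

type_synonym 'a mpoly = "(nat \<Rightarrow>\<^sub>0 nat) \<Rightarrow>\<^sub>0 'a"

definition mconst :: "'a::comm_ring_1 \<Rightarrow> 'a mpoly" where
  "mconst a = Poly_Mapping.single 0 a"

definition mvar :: "nat \<Rightarrow> 'a::comm_ring_1 mpoly" where
  "mvar i = Poly_Mapping.single (Poly_Mapping.single i 1) 1"

definition mon_eval :: "(nat \<Rightarrow> 'k::comm_ring_1) \<Rightarrow> (nat \<Rightarrow>\<^sub>0 nat) \<Rightarrow> 'k" where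
  "mon_eval g k = (\<Prod>i\<in>Poly_Mapping.keys k. g i ^ Poly_Mapping.lookup k i)"

definition mpoly_eval ::
  "('a::comm_ring_1 \<Rightarrow> 'k::comm_ring_1) \<Rightarrow> (nat \<Rightarrow> 'k) \<Rightarrow> 'a mpoly \<Rightarrow> 'k" where
  "mpoly_eval h g p = (\<Sum>k\<in>Poly_Mapping.keys p. h (Poly_Mapping.lookup p k) * mon_eval g k)"

definition mpolys :: "nat set \<Rightarrow> 'a::comm_ring_1 mpoly set" where
  "mpolys V = {p. \<forall>k\<in>Poly_Mapping.keys p. Poly_Mapping.keys k \<subseteq> V}"

definition forms :: "nat set \<Rightarrow> 'a::comm_ring_1 mpoly extalg set" where
  "forms V = {w. \<forall>A. coef w A \<in> mpolys V \<and> (coef w A \<noteq> 0 \<longrightarrow> A \<subseteq> V)}"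

definition ring_on :: "'b::ring_1 set \<Rightarrow> 'b ring" where
  "ring_on A = \<lparr>carrier = A, mult = (*), one = 1, zero = 0, add = (+)\<rparr>"

definition to_fract :: "'r::idom \<Rightarrow> 'r fract" where
  "to_fract r = Fraction_Field.Fract r 1"

lemma to_fract_simps [simp]:
  "to_fract 0 = 0" "to_fract 1 = 1" "to_fract (r + s) = to_fract r + to_fract s"
  "to_fract (- r) = - to_fract r" "to_fract (r - s) = to_fract r - to_fract s"
  "to_fract (r * s) = to_fract r * to_fract s" "to_fract r = to_fract s \<longleftrightarrow> r = s"
  by (simp_all add: to_fract_def Zero_fract_def One_fract_def eq_fract)

lemma to_fract_eq_0_iff [simp]: "to_fract r = 0 \<longleftrightarrow> r = 0"
  using to_fract_simps(7)[of r 0] by simp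

lemma to_fract_power [simp]: "to_fract (r ^ k) = to_fract r ^ k"
  by (induction k) auto

lemma to_fract_sum [simp]: "to_fract (sum f I) = (\<Sum>i\<in>I. to_fract (f i))"
  by (induction I rule: infinite_finite_induct) auto

lemma to_fract_prod [simp]: "to_fract (prod f I) = (\<Prod>i\<in>I. to_fract (f i))"
  by (induction I rule: infinite_finite_induct) auto

lift_definition emb :: "'r::idom extalg \<Rightarrow> 'r fract extalg"
  is "\<lambda>f A. to_fract (f A)"
  by simp

lemma inj_emb: "inj emb"
  by (rule injI, rule extalg_eqI) (metis emb.rep_eq to_fract_simps(7))

lemma emb_simps [simp]:
  "emb 0 = 0" "emb 1 = 1" "emb (w + v) = emb w + emb v" "emb (- w) = - emb w"
  "emb (w - v) = emb w - emb v" "emb (scal r) = scal (to_fract r)" "emb (gen i) = gen i"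
  by (rule extalg_eqI; simp add: emb.rep_eq one_extalg.rep_eq scal.rep_eq gen.rep_eq)+

lemma emb_mult [simp]:
  fixes w v :: "'r::idom extalg"
  shows "emb (w * v) = emb w * emb v"
proof (rule extalg_eqI)
  fix C
  have "to_fract (shuffle_sign A B :: 'r) = shuffle_sign A B" for A B
    by (simp add: shuffle_sign_def)
  then show "coef (emb (w * v)) C = coef (emb w * emb v) C"
    by (cases "finite C") (simp_all add: emb.rep_eq coef_mult coef_infinite)
qed

lemma emb_sum [simp]: "emb (sum f I) = (\<Sum>i\<in>I. emb (f i))"
  by (induction I rule: infinite_finite_induct) auto

lemma mon_eval_superset:
  "finite U \<Longrightarrow> Poly_Mapping.keys k \<subseteq> U \<Longrightarrow> mon_eval g k = (\<Prod>i\<in>U. g i ^ Poly_Mapping.lookup k i)"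
  unfolding mon_eval_def by (intro prod.mono_neutral_left) (auto simp: in_keys_iff)

lemma mon_eval_add: "mon_eval g (k + l) = mon_eval g k * mon_eval g l"
proof -
  let ?U = "Poly_Mapping.keys k \<union> Poly_Mapping.keys l"
  have "mon_eval g (k + l) = (\<Prod>i\<in>?U. g i ^ Poly_Mapping.lookup (k + l) i)"
    by (rule mon_eval_superset) (use keys_add[of k l] in auto)
  moreover have "mon_eval g k = (\<Prod>i\<in>?U. g i ^ Poly_Mapping.lookup k i)"
    by (rule mon_eval_superset) auto
  moreover have "mon_eval g l = (\<Prod>i\<in>?U. g i ^ Poly_Mapping.lookup l i)"
    by (rule mon_eval_superset) auto
  ultimately show ?thesis by (simp add: lookup_add power_add prod.distrib)
qed

lemma mpoly_expand:
  "p = (\<Sum>k\<in>Poly_Mapping.keys p. Poly_Mapping.single k (Poly_Mapping.lookup p k))"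
proof (rule poly_mapping_eqI)
  fix l
  have "Poly_Mapping.lookup (\<Sum>k\<in>Poly_Mapping.keys p. Poly_Mapping.single k (Poly_Mapping.lookup p k)) l =
      (\<Sum>k\<in>Poly_Mapping.keys p. if k = l then Poly_Mapping.lookup p l else 0)"
    unfolding lookup_sum by (rule sum.cong) (auto simp: lookup_single when_def)
  also have "\<dots> = Poly_Mapping.lookup p l" by (auto simp: in_keys_iff)
  finally show "Poly_Mapping.lookup p l = Poly_Mapping.lookup (\<Sum>k\<in>Poly_Mapping.keys p. Poly_Mapping.single k (Poly_Mapping.lookup p k)) l" ..
qed

context
  fixes h :: "'a::comm_ring_1 \<Rightarrow> 'k::comm_ring_1" and g :: "nat \<Rightarrow> 'k"
  assumes h: "h 0 = 0" "h 1 = 1" "\<And>a b. h (a + b) = h a + h b" "\<And>a b. h (a * b) = h a * h b"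
begin

lemma mpoly_eval_0: "mpoly_eval h g 0 = 0"
  by (simp add: mpoly_eval_def)

lemma mpoly_eval_add: "mpoly_eval h g (p + q) = mpoly_eval h g p + mpoly_eval h g q"
  unfolding mpoly_eval_def by (rule setsum_keys_plus_distrib) (simp_all add: h algebra_simps)

lemma mpoly_eval_sum: "mpoly_eval h g (sum f I) = (\<Sum>i\<in>I. mpoly_eval h g (f i))"
  by (induction I rule: infinite_finite_induct) (auto simp: mpoly_eval_0 mpoly_eval_add)

lemma mpoly_eval_single: "mpoly_eval h g (Poly_Mapping.single k a) = h a * mon_eval g k"
  by (cases "a = 0") (auto simp: mpoly_eval_def h)

lemma mpoly_eval_mult: "mpoly_eval h g (p * q) = mpoly_eval h g p * mpoly_eval h g q"
proof -
  have "mpoly_eval h g (p * q) = mpoly_eval h g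
      ((\<Sum>k\<in>Poly_Mapping.keys p. Poly_Mapping.single k (Poly_Mapping.lookup p k)) *
       (\<Sum>k\<in>Poly_Mapping.keys q. Poly_Mapping.single k (Poly_Mapping.lookup q k)))"
    using mpoly_expand[of p] mpoly_expand[of q] by simp
  also have "\<dots> = mpoly_eval h g p * mpoly_eval h g q"
    unfolding sum_product mpoly_eval_sum mult_single mpoly_eval_single
    by (simp add: mpoly_eval_def sum_product h mon_eval_add ac_simps)
  finally show ?thesis .
qed

lemma mpoly_eval_mconst: "mpoly_eval h g (mconst a) = h a"
  by (simp add: mconst_def mpoly_eval_single mon_eval_def)

lemma mpoly_eval_1: "mpoly_eval h g 1 = 1"
  using mpoly_eval_mconst[of 1] by (simp add: mconst_def h)

lemma mpoly_eval_mvar: "mpoly_eval h g (mvar i) = g i"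
  by (simp add: mvar_def mpoly_eval_single mon_eval_def h)

end

lemma mconst_simps [simp]:
  "mconst 0 = 0" "mconst 1 = 1" "mconst (a + b) = mconst a + mconst b"
  "mconst (a * b) = mconst a * mconst b"
  by (simp_all add: mconst_def single_add mult_single)

lemma mvar_nonzero [simp]: "mvar i \<noteq> (0 :: 'a::comm_ring_1 mpoly)"
  by (metis lookup_single_eq lookup_zero mvar_def zero_neq_one)

lemma mpolys_closed:
  "0 \<in> mpolys V" "1 \<in> mpolys V" "mconst a \<in> mpolys V"
  "p \<in> mpolys V \<Longrightarrow> q \<in> mpolys V \<Longrightarrow> p + q \<in> mpolys V"
  "p \<in> mpolys V \<Longrightarrow> q \<in> mpolys V \<Longrightarrow> p * q \<in> mpolys V"
  "p \<in> mpolys V \<Longrightarrow> - p \<in> mpolys V"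
  "i \<in> V \<Longrightarrow> mvar i \<in> mpolys V"
proof -
  show "p + q \<in> mpolys V" if "p \<in> mpolys V" "q \<in> mpolys V"
    using that keys_add[of p q] unfolding mpolys_def by blast
  show "p * q \<in> mpolys V" if "p \<in> mpolys V" "q \<in> mpolys V"
  proof -
    have "Poly_Mapping.keys (a + b) \<subseteq> V"
      if "a \<in> Poly_Mapping.keys p" "b \<in> Poly_Mapping.keys q" for a b
      using that \<open>p \<in> mpolys V\<close> \<open>q \<in> mpolys V\<close> keys_add[of a b] unfolding mpolys_def by blast
    then show ?thesis using keys_mult[of p q] unfolding mpolys_def by blast
  qed
  show "- p \<in> mpolys V" if "p \<in> mpolys V"
    using that by (auto simp: mpolys_def in_keys_iff)
qed (auto simp: mpolys_def mconst_def mvar_def)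

lemma mpolys_sum: "(\<And>i. i \<in> I \<Longrightarrow> f i \<in> mpolys V) \<Longrightarrow> sum f I \<in> mpolys V"
  by (induction I rule: infinite_finite_induct) (auto intro: mpolys_closed)

lemma mpolys_prod: "(\<And>i. i \<in> I \<Longrightarrow> f i \<in> mpolys V) \<Longrightarrow> prod f I \<in> mpolys V"
  by (induction I rule: infinite_finite_induct) (auto intro: mpolys_closed)

lemma mpolys_power: "p \<in> mpolys V \<Longrightarrow> p ^ k \<in> mpolys V"
  by (induction k) (auto intro: mpolys_closed)

lemma shuffle_sign_cases: "shuffle_sign A B = 1 \<or> shuffle_sign A B = - 1"
  by (simp add: shuffle_sign_def minus_one_power_iff)

lemma forms_scal [simp]: "scal p \<in> forms V \<longleftrightarrow> p \<in> mpolys V"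
  by (auto simp: forms_def scal.rep_eq mpolys_closed)

lemma forms_gen: "i \<in> V \<Longrightarrow> gen i \<in> forms V"
  by (auto simp: forms_def gen.rep_eq mpolys_closed)

lemma forms_closed:
  "0 \<in> forms V" "1 \<in> forms V"
  "w \<in> forms V \<Longrightarrow> v \<in> forms V \<Longrightarrow> w + v \<in> forms V"
  "w \<in> forms V \<Longrightarrow> v \<in> forms V \<Longrightarrow> w * v \<in> forms V"
  "w \<in> forms V \<Longrightarrow> - w \<in> forms V"
proof -
  show "0 \<in> forms V" by (simp add: forms_def mpolys_closed)
  show "1 \<in> forms V" using forms_scal[of 1 V] by (simp add: mpolys_closed)
  show "- w \<in> forms V" if "w \<in> forms V"
    using that by (auto simp: forms_def mpolys_closed)
  show "w + v \<in> forms V" if "w \<in> forms V" "v \<in> forms V"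
  proof -
    have "A \<subseteq> V" if "coef w A + coef v A \<noteq> 0" for A
    proof -
      from that have "coef w A \<noteq> 0 \<or> coef v A \<noteq> 0" by auto
      then show ?thesis using \<open>w \<in> forms V\<close> \<open>v \<in> forms V\<close> by (auto simp: forms_def)
    qed
    then show ?thesis using that by (auto simp: forms_def mpolys_closed)
  qed
  show "w * v \<in> forms V" if wv: "w \<in> forms V" "v \<in> forms V"
    unfolding forms_def
  proof (intro CollectI allI)
    fix C
    show "coef (w * v) C \<in> mpolys V \<and> (coef (w * v) C \<noteq> 0 \<longrightarrow> C \<subseteq> V)"
    proof (cases "finite C")
      case True
      have "shuffle_sign A B \<in> mpolys V" for A B
        using shuffle_sign_cases[of A B] by (metis mpolys_closed(2,6))
      then have "coef (w * v) C \<in> mpolys V"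
        using wv unfolding coef_mult[OF True]
        by (intro mpolys_sum mpolys_closed) (auto simp: forms_def)
      moreover have "C \<subseteq> V" if nz: "coef (w * v) C \<noteq> 0"
      proof -
        obtain A where A: "A \<in> Pow C" "shuffle_sign A (C - A) * coef w A * coef v (C - A) \<noteq> 0"
          using nz unfolding coef_mult[OF True] by (elim sum.not_neutral_contains_not_neutral)
        from A(2) have "coef w A \<noteq> 0" "coef v (C - A) \<noteq> 0" by auto
        then have "A \<subseteq> V" "C - A \<subseteq> V" using wv by (auto simp: forms_def)
        then show ?thesis by blast
      qed
      ultimately show ?thesis by blast
    qed (simp add: coef_infinite mpolys_closed)
  qed
qed

lemma forms_sum: "(\<And>i. i \<in> I \<Longrightarrow> f i \<in> forms V) \<Longrightarrow> sum f I \<in> forms V"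
  by (induction I rule: infinite_finite_induct) (auto intro: forms_closed)

lemma ring_on_simps [simp]:
  "carrier (ring_on A) = A" "x \<otimes>\<^bsub>ring_on A\<^esub> y = x * y" "x \<oplus>\<^bsub>ring_on A\<^esub> y = x + y"
  "\<one>\<^bsub>ring_on A\<^esub> = 1" "\<zero>\<^bsub>ring_on A\<^esub> = 0"
  by (simp_all add: ring_on_def)

lemma ring_ring_on:
  assumes "1 \<in> A" "\<And>x y. x \<in> A \<Longrightarrow> y \<in> A \<Longrightarrow> x + y \<in> A"
    "\<And>x y. x \<in> A \<Longrightarrow> y \<in> A \<Longrightarrow> x * y \<in> A" "\<And>x. x \<in> A \<Longrightarrow> - x \<in> A"
  shows "ring (ring_on A)"
proof (rule ringI)
  have "0 \<in> A" using assms(1,2,4) by (metis add.right_inverse)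
  then show "abelian_group (ring_on A)"
    using assms by (intro abelian_groupI) (auto simp: algebra_simps intro!: bexI[of _ "- _"])
  show "Group.monoid (ring_on A)"
    using assms by (intro monoidI) (auto simp: mult.assoc)
qed (simp_all add: algebra_simps)

lemma ring_on_a_inv:
  assumes "ring (ring_on A)" "x \<in> A" "- x \<in> A"
  shows "\<ominus>\<^bsub>ring_on A\<^esub> x = - x"
proof -
  interpret ring "ring_on A" by (rule assms)
  show ?thesis using minus_equality[of "- x" x] assms by simp
qed

text \<open>
  \<open>F[x\<^sub>1, \<dots>, x\<^sub>n] \<otimes> \<Lambda>[dx\<^sub>1, \<dots>, dx\<^sub>n]\<close> is the exterior algebra over \<open>F[x\<^sub>1, \<dots>, x\<^sub>n]\<close> on generators
  \<open>dx\<^sub>1, \<dots>, dx\<^sub>n\<close>. Here \<open>x\<^sub>i\<close> is \<^term>\<open>scal (mvar i)\<close> and \<open>dx\<^sub>i\<close> is \<^term>\<open>gen i\<close>, and the same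
  terms are \<open>t\<^sub>i\<close> and \<open>u\<^sub>i\<close> in \<open>Xi m\<close>.
\<close>

definition Omega :: "nat \<Rightarrow> 'a::comm_ring_1 mpoly extalg ring" where
  "Omega n = ring_on (forms {1..n})"

definition Xi :: "nat \<Rightarrow> 'a::comm_ring_1 mpoly extalg ring" where
  "Xi m = ring_on (forms {1..m})"

lemma ring_Omega: "ring (Omega n)" and ring_Xi: "ring (Xi m)"
  unfolding Omega_def Xi_def by (intro ring_ring_on forms_closed; assumption)+

section \<open>The localization and the map \<open>\<psi>\<close>\<close>

definition zform :: "(nat \<Rightarrow> nat \<Rightarrow> 'a::comm_ring_1) \<Rightarrow> nat \<Rightarrow> nat \<Rightarrow> 'a mpoly" where
  "zform c n i = (\<Sum>j=1..n. mconst (c i j) * mvar j)"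

definition dzform :: "(nat \<Rightarrow> nat \<Rightarrow> 'a::comm_ring_1) \<Rightarrow> nat \<Rightarrow> nat \<Rightarrow> 'a mpoly extalg" where
  "dzform c n i = (\<Sum>j=1..n. scal (mconst (c i j)) * gen j)"

definition zinv :: "(nat \<Rightarrow> nat \<Rightarrow> 'a::field) \<Rightarrow> nat \<Rightarrow> nat \<Rightarrow> 'a mpoly fract extalg" where
  "zinv c n i = scal (inverse (to_fract (zform c n i)))"

definition dlog :: "(nat \<Rightarrow> nat \<Rightarrow> 'a::field) \<Rightarrow> nat \<Rightarrow> nat \<Rightarrow> 'a mpoly fract extalg" where
  "dlog c n i = zinv c n i * emb (dzform c n i)"

text \<open>
  The base ring \<open>F[x\<^sub>1, \<dots>, x\<^sub>n]\<close> is a domain and \<^term>\<open>Omega n\<close> is free over it, so the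
  localization at non-zero polynomials \<open>z\<^sub>1, \<dots>, z\<^sub>m\<close> embeds into the exterior algebra over the
  fraction field, where it consists of the fractions \<open>\<omega> / (z\<^sub>1\<^bsup>k\<^sub>1\<^esup> \<cdots> z\<^sub>m\<^bsup>k\<^sub>m\<^esup>)\<close>.
\<close>

definition T_loc :: "(nat \<Rightarrow> nat \<Rightarrow> 'a::field) \<Rightarrow> nat \<Rightarrow> nat \<Rightarrow> 'a mpoly fract extalg ring" where
  "T_loc c n m = ring_on {scal (inverse (\<Prod>i=1..m. to_fract (zform c n i) ^ k i)) * emb w | k w.
    w \<in> carrier (Omega n)}"

text \<open>
  On the basis element \<open>t\<^bsup>\<alpha>\<^esup> u\<^bsub>i\<^sub>1\<^esub> \<cdots> u\<^bsub>i\<^sub>k\<^esub>\<close> the map \<open>\<psi>\<close> substitutes \<open>z\<^sub>i\<^sup>-\<^sup>1\<close> for \<open>t\<^sub>i\<close> and \<open>z\<^sub>i\<^sup>-\<^sup>1 dz\<^sub>i\<close> for \<open>u\<^sub>i\<close>;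
  it is a ring homomorphism by \<open>psi_ring_hom\<close> below, and \<open>psi_image\<close> identifies its image.
\<close>

definition psi ::
  "(nat \<Rightarrow> nat \<Rightarrow> 'a::field) \<Rightarrow> nat \<Rightarrow> 'a mpoly extalg \<Rightarrow> 'a mpoly fract extalg" where
  "psi c n = extalg_eval
    (mpoly_eval (\<lambda>a. to_fract (mconst a)) (\<lambda>i. inverse (to_fract (zform c n i)))) (dlog c n)"

definition T_sub :: "(nat \<Rightarrow> nat \<Rightarrow> 'a::field) \<Rightarrow> nat \<Rightarrow> nat \<Rightarrow> 'a mpoly fract extalg ring" where
  "T_sub c n m = (T_loc c n m)\<lparr>carrier := generate_ring (T_loc c n m)
    (range (\<lambda>a. scal (to_fract (mconst a))) \<union> zinv c n ` {1..m} \<union> dlog c n ` {1..m})\<rparr>"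

lemma zform_in_mpolys: "zform c n i \<in> mpolys {1..n}"
  unfolding zform_def by (intro mpolys_sum mpolys_closed) auto

lemma dzform_in_forms: "dzform c n i \<in> forms {1..n}"
  unfolding dzform_def by (intro forms_sum forms_closed forms_gen) (auto simp: mpolys_closed)

lemma psi_scal_mconst: "psi c n (scal (mconst a)) = scal (to_fract (mconst a))"
  and psi_t: "psi c n (scal (mvar i)) = zinv c n i"
  and psi_u: "psi c n (gen i) = dlog c n i"
  and psi_0: "psi c n 0 = 0"
  and psi_1: "psi c n 1 = 1"
  and psi_add: "psi c n (w + v) = psi c n w + psi c n v"
  by (simp_all add: psi_def extalg_eval_scal extalg_eval_gen extalg_eval_add mpoly_eval_0
    mpoly_eval_1 mpoly_eval_add mpoly_eval_mconst mpoly_eval_mvar zinv_def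
    extalg_eval_scal[where r = 0, simplified] extalg_eval_scal[where r = 1, simplified])

lemma dlog_one_form:
  "dlog c n i = (\<Sum>j=1..n. scal (inverse (to_fract (zform c n i)) * to_fract (mconst (c i j))) * gen j)"
  by (simp add: dlog_def dzform_def zinv_def sum_distrib_left scal_mult_assoc)

lemma dlog_anticommute: "dlog c n i * dlog c n j = - (dlog c n j * dlog c n i)"
  unfolding dlog_one_form by (rule one_form_anticommute)

lemma dlog_square: "dlog c n i * dlog c n i = 0"
  unfolding dlog_one_form by (rule one_form_square)

lemma psi_mult: "psi c n (w * v) = psi c n w * psi c n v"
  unfolding psi_def
  by (rule extalg_eval_mult)
    (simp_all add: dlog_anticommute[symmetric] dlog_square mpoly_eval_0 mpoly_eval_1
      mpoly_eval_add mpoly_eval_mult)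

lemma psi_uminus: "psi c n (- w) = - psi c n w"
  using psi_add[of c n "- w" w] by (simp add: psi_0 eq_neg_iff_add_eq_0)

context
  fixes c :: "nat \<Rightarrow> nat \<Rightarrow> 'a::field" and n m :: nat
  assumes z_nonzero: "\<And>i. i \<in> {1..m} \<Longrightarrow> zform c n i \<noteq> 0"
begin

private definition den :: "(nat \<Rightarrow> nat) \<Rightarrow> 'a mpoly" where
  "den k = (\<Prod>i=1..m. zform c n i ^ k i)"

private lemma carrier_T:
  "carrier (T_loc c n m) = {scal (inverse (to_fract (den k))) * emb w | k w. w \<in> forms {1..n}}"
  by (simp add: T_loc_def Omega_def den_def)

private lemma T_eq: "T_loc c n m = ring_on (carrier (T_loc c n m))"
  by (simp add: T_loc_def)

private lemma den_add: "den (\<lambda>i. k i + l i) = den k * den l"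
  by (simp add: den_def power_add prod.distrib)

private lemma den_nonzero: "den k \<noteq> 0"
  using z_nonzero by (simp add: den_def)

private lemma den_in_mpolys: "den k \<in> mpolys {1..n}"
  unfolding den_def by (intro mpolys_prod mpolys_power zform_in_mpolys)

private lemma scal_inverse_mult: "p \<noteq> 0 \<Longrightarrow> scal (inverse (to_fract p)) * (scal (to_fract p) * w) = w"
  by (simp add: scal_mult_assoc)

lemma T_closed:
  "w \<in> forms {1..n} \<Longrightarrow> emb w \<in> carrier (T_loc c n m)"
  "x \<in> carrier (T_loc c n m) \<Longrightarrow> y \<in> carrier (T_loc c n m) \<Longrightarrow> x + y \<in> carrier (T_loc c n m)"
  "x \<in> carrier (T_loc c n m) \<Longrightarrow> y \<in> carrier (T_loc c n m) \<Longrightarrow> x * y \<in> carrier (T_loc c n m)"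
  "x \<in> carrier (T_loc c n m) \<Longrightarrow> - x \<in> carrier (T_loc c n m)"
proof -
  show "emb w \<in> carrier (T_loc c n m)" if "w \<in> forms {1..n}"
    unfolding carrier_T using that by (intro CollectI exI[of _ "\<lambda>_. 0"] exI[of _ w]) (simp add: den_def)
  show "- x \<in> carrier (T_loc c n m)" if "x \<in> carrier (T_loc c n m)"
  proof -
    from that obtain k w where "x = scal (inverse (to_fract (den k))) * emb w" "w \<in> forms {1..n}"
      unfolding carrier_T by blast
    then show ?thesis
      unfolding carrier_T by (intro CollectI exI[of _ k] exI[of _ "- w"]) (simp add: forms_closed)
  qed
  show "x + y \<in> carrier (T_loc c n m)" "x * y \<in> carrier (T_loc c n m)"
    if xy: "x \<in> carrier (T_loc c n m)" "y \<in> carrier (T_loc c n m)" for x y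
  proof -
    from xy obtain k w where x: "x = scal (inverse (to_fract (den k))) * emb w" "w \<in> forms {1..n}"
      unfolding carrier_T by blast
    from xy obtain l v where y: "y = scal (inverse (to_fract (den l))) * emb v" "v \<in> forms {1..n}"
      unfolding carrier_T by blast
    have "x + y = scal (inverse (to_fract (den (\<lambda>i. k i + l i)))) *
        emb (scal (den l) * w + scal (den k) * v)"
    proof -
      have "inverse (to_fract (den k * den l)) * to_fract (den l) = inverse (to_fract (den k))"
        "inverse (to_fract (den k * den l)) * to_fract (den k) = inverse (to_fract (den l))"
        using den_nonzero[of k] den_nonzero[of l] by (simp_all add: field_simps)
      then show ?thesis
        by (simp only: x y den_add scal_mult_assoc distrib_left emb_simps emb_mult)
    qed
    then show "x + y \<in> carrier (T_loc c n m)"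
      unfolding carrier_T using x y den_in_mpolys by (blast intro: forms_closed forms_scal[THEN iffD2])
    have "x * y = scal (inverse (to_fract (den (\<lambda>i. k i + l i)))) * emb (w * v)"
      by (simp add: x y den_add scal_mult_scal)
    then show "x * y \<in> carrier (T_loc c n m)"
      unfolding carrier_T using x y by (blast intro: forms_closed)
  qed
qed

lemma ring_T: "ring (T_loc c n m)"
  using T_closed(1)[OF forms_closed(2)]
  by (subst T_eq, intro ring_ring_on T_closed) simp_all

lemma zinv_in_T:
  assumes "i \<in> {1..m}"
  shows "zinv c n i \<in> carrier (T_loc c n m)"
proof -
  have "den (\<lambda>j. if j = i then 1 else 0) = (\<Prod>j=1..m. if j = i then zform c n i else 1)"
    unfolding den_def by (rule prod.cong) auto
  also have "\<dots> = zform c n i" using assms by simp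
  finally show ?thesis
    unfolding carrier_T
    by (intro CollectI exI[of _ "\<lambda>j. if j = i then 1 else 0"] exI[of _ 1])
      (simp add: zinv_def forms_closed)
qed

lemma zinv_inverse: "i \<in> {1..m} \<Longrightarrow> zinv c n i * emb (scal (zform c n i)) = 1"
  using z_nonzero[of i] by (simp add: zinv_def flip: scal_mult)

lemma TA_generators_in_T:
  "range (\<lambda>a. scal (to_fract (mconst a))) \<union> zinv c n ` {1..m} \<union> dlog c n ` {1..m} \<subseteq> carrier (T_loc c n m)"
proof -
  have "scal (to_fract (mconst a)) \<in> carrier (T_loc c n m)" for a
    using T_closed(1)[of "scal (mconst a)"] by (simp add: mpolys_closed)
  moreover have "dlog c n i \<in> carrier (T_loc c n m)" if "i \<in> {1..m}" for i
    unfolding dlog_def by (intro T_closed zinv_in_T that dzform_in_forms)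
  ultimately show ?thesis using zinv_in_T by auto
qed

lemma carrier_TA_subset_T: "carrier (T_sub c n m) \<subseteq> carrier (T_loc c n m)"
  using ring.generate_ring_incl[OF ring_T TA_generators_in_T] by (simp add: T_sub_def)

lemma ring_TA: "ring (T_sub c n m)"
  unfolding T_sub_def by (rule ring.generate_ring_is_ring[OF ring_T TA_generators_in_T])

private lemma T_ops: "x \<oplus>\<^bsub>T_loc c n m\<^esub> y = x + y" "x \<otimes>\<^bsub>T_loc c n m\<^esub> y = x * y"
  "\<one>\<^bsub>T_loc c n m\<^esub> = 1" "\<zero>\<^bsub>T_loc c n m\<^esub> = 0"
  by (subst T_eq, simp)+

private lemma T_a_inv: "x \<in> carrier (T_loc c n m) \<Longrightarrow> \<ominus>\<^bsub>T_loc c n m\<^esub> x = - x"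
  using ring_on_a_inv[of "carrier (T_loc c n m)" x] ring_T T_closed(4) T_eq by simp

private lemma TA_closed:
  "1 \<in> carrier (T_sub c n m)"
  "x \<in> carrier (T_sub c n m) \<Longrightarrow> y \<in> carrier (T_sub c n m) \<Longrightarrow> x + y \<in> carrier (T_sub c n m)"
  "x \<in> carrier (T_sub c n m) \<Longrightarrow> y \<in> carrier (T_sub c n m) \<Longrightarrow> x * y \<in> carrier (T_sub c n m)"
  "scal (to_fract (mconst a)) \<in> carrier (T_sub c n m)"
  "i \<in> {1..m} \<Longrightarrow> zinv c n i \<in> carrier (T_sub c n m)"
  "i \<in> {1..m} \<Longrightarrow> dlog c n i \<in> carrier (T_sub c n m)"
  using generate_ring.one[of "T_loc c n m"] generate_ring.eng_add[of x "T_loc c n m" _ y]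
    generate_ring.eng_mult[of x "T_loc c n m" _ y]
  by (auto simp: T_sub_def T_ops intro: generate_ring.incl)

private lemma TA_scal_mult:
  "scal r \<in> carrier (T_sub c n m) \<Longrightarrow> scal s \<in> carrier (T_sub c n m) \<Longrightarrow> scal (r * s) \<in> carrier (T_sub c n m)"
  by (simp add: scal_mult TA_closed)

private lemma TA_scal_prod:
  "(\<And>i. i \<in> I \<Longrightarrow> scal (f i) \<in> carrier (T_sub c n m)) \<Longrightarrow> scal (prod f I) \<in> carrier (T_sub c n m)"
  by (induction I rule: infinite_finite_induct) (auto intro: TA_scal_mult simp: TA_closed(1))

private lemma TA_scal_power:
  "scal r \<in> carrier (T_sub c n m) \<Longrightarrow> scal (r ^ k) \<in> carrier (T_sub c n m)"
  by (induction k) (auto intro: TA_scal_mult simp: TA_closed(1))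

private lemma TA_0: "0 \<in> carrier (T_sub c n m)"
  using TA_closed(4)[of 0] by simp

private lemma TA_sum:
  "(\<And>i. i \<in> I \<Longrightarrow> f i \<in> carrier (T_sub c n m)) \<Longrightarrow> sum f I \<in> carrier (T_sub c n m)"
  by (induction I rule: infinite_finite_induct) (auto intro: TA_closed simp: TA_0)

private lemma TA_oprod:
  assumes "A \<subseteq> {1..m}"
  shows "oprod (dlog c n) A \<in> carrier (T_sub c n m)"
proof -
  have "prod_list (map (dlog c n) xs) \<in> carrier (T_sub c n m)" if "set xs \<subseteq> {1..m}" for xs
    using that by (induction xs) (simp_all add: TA_closed(1,3,6))
  moreover have "finite A" using assms finite_subset by blast
  ultimately show ?thesis using assms by (simp add: oprod_def)
qed

lemma psi_image: "psi c n ` carrier (Xi m) = carrier (T_sub c n m)"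
proof
  show "psi c n ` carrier (Xi m) \<subseteq> carrier (T_sub c n m)"
  proof
    fix x assume "x \<in> psi c n ` carrier (Xi m)"
    then obtain w where x: "x = psi c n w" and w: "w \<in> forms {1..m}" by (auto simp: Xi_def)
    have "scal (mpoly_eval (\<lambda>a. to_fract (mconst a)) (\<lambda>i. inverse (to_fract (zform c n i))) p)
        \<in> carrier (T_sub c n m)" if "p \<in> mpolys {1..m}" for p
      unfolding mpoly_eval_def scal_sum mon_eval_def
    proof (rule TA_sum, rule TA_scal_mult, rule TA_closed(4), rule TA_scal_prod, rule TA_scal_power)
      fix k i assume "k \<in> Poly_Mapping.keys p" "i \<in> Poly_Mapping.keys k"
      then have "i \<in> {1..m}" using that unfolding mpolys_def by blast
      then show "scal (inverse (to_fract (zform c n i))) \<in> carrier (T_sub c n m)"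
        using TA_closed(5) by (simp add: zinv_def)
    qed
    then show "x \<in> carrier (T_sub c n m)"
      unfolding x psi_def extalg_eval_def
      using w by (intro TA_sum TA_closed(3) TA_oprod) (auto simp: forms_def)
  qed
  show "carrier (T_sub c n m) \<subseteq> psi c n ` carrier (Xi m)"
  proof
    fix x assume "x \<in> carrier (T_sub c n m)"
    then have "x \<in> generate_ring (T_loc c n m) (range (\<lambda>a. scal (to_fract (mconst a))) \<union>
        zinv c n ` {1..m} \<union> dlog c n ` {1..m})" by (simp add: T_sub_def)
    then show "x \<in> psi c n ` carrier (Xi m)"
    proof (induction rule: generate_ring.induct)
      case one
      have "psi c n 1 = 1" by (rule psi_1)
      then show ?case unfolding T_ops Xi_def ring_on_simps by (metis forms_closed(2) imageI)
    next
      case (incl h)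
      then consider a where "h = psi c n (scal (mconst a))"
        | i where "i \<in> {1..m}" "h = psi c n (scal (mvar i))"
        | i where "i \<in> {1..m}" "h = psi c n (gen i)"
        unfolding psi_scal_mconst psi_t psi_u by auto
      then show ?case
        by cases (auto simp: Xi_def intro!: imageI mpolys_closed forms_gen)
    next
      case (a_inv h)
      then obtain w where w: "h = psi c n w" "w \<in> forms {1..m}" by (auto simp: Xi_def)
      have "h \<in> carrier (T_loc c n m)"
        using a_inv(1) carrier_TA_subset_T by (auto simp: T_sub_def)
      then have "\<ominus>\<^bsub>T_loc c n m\<^esub> h = psi c n (- w)" by (simp add: T_a_inv w psi_uminus)
      then show ?case using w forms_closed(5) by (auto simp: Xi_def)
    next
      case (eng_add h1 h2)
      then obtain w v where "h1 = psi c n w" "w \<in> forms {1..m}" "h2 = psi c n v" "v \<in> forms {1..m}"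
        by (auto simp: Xi_def)
      then show ?case by (auto simp: Xi_def T_ops psi_add[symmetric] intro!: imageI forms_closed)
    next
      case (eng_mult h1 h2)
      then obtain w v where "h1 = psi c n w" "w \<in> forms {1..m}" "h2 = psi c n v" "v \<in> forms {1..m}"
        by (auto simp: Xi_def)
      then show ?case by (auto simp: Xi_def T_ops psi_mult[symmetric] intro!: imageI forms_closed)
    qed
  qed
qed

lemma psi_ring_hom: "psi c n \<in> ring_hom (Xi m) (T_loc c n m)"
proof (rule ring_hom_memI)
  fix x :: "'a mpoly extalg" assume "x \<in> carrier (Xi m)"
  then show "psi c n x \<in> carrier (T_loc c n m)" using psi_image carrier_TA_subset_T by blast
qed (simp_all add: T_ops psi_1 psi_add psi_mult, simp_all add: Xi_def psi_1 psi_add psi_mult)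

end

section \<open>Linear relations and the elements \<open>P\<^sub>L\<^sub>,\<^sub>S\<close>\<close>

text \<open>
  A formal expression \<open>\<Sum>\<^bsub>i \<in> |L|\<^esub> a\<^sub>i z\<^sub>i\<close> with non-zero coefficients is encoded by the function
  \<open>i \<mapsto> a\<^sub>i\<close>, extended by zero outside \<open>|L|\<close>.
\<close>

definition supp :: "(nat \<Rightarrow> 'a::zero) \<Rightarrow> nat set" where
  "supp L = {i. L i \<noteq> 0}"

definition is_relation :: "(nat \<Rightarrow> nat \<Rightarrow> 'a::field) \<Rightarrow> nat \<Rightarrow> nat \<Rightarrow> (nat \<Rightarrow> 'a) \<Rightarrow> bool" where
  "is_relation c n m L \<longleftrightarrow>
    supp L \<noteq> {} \<and> supp L \<subseteq> {1..m} \<and> (\<Sum>i\<in>supp L. mconst (L i) * zform c n i) = 0"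

definition P_poly :: "(nat \<Rightarrow> 'a::field) \<Rightarrow> 'a mpoly" where
  "P_poly L = (\<Sum>i\<in>supp L. mconst (L i) * (\<Prod>q\<in>supp L - {i}. mvar q))"

definition dz_sym :: "nat \<Rightarrow> 'a::field mpoly fract extalg" where
  "dz_sym i = scal (inverse (to_fract (mvar i))) * gen i"

definition dL_sym :: "(nat \<Rightarrow> 'a::field) \<Rightarrow> 'a mpoly fract extalg" where
  "dL_sym L = (\<Sum>i\<in>supp L. scal (to_fract (mconst (L i))) * dz_sym i)"

definition P_frac :: "(nat \<Rightarrow> 'a::field) \<Rightarrow> nat set \<Rightarrow> 'a mpoly fract extalg" where
  "P_frac L S = (let js = sorted_list_of_set S in
    scal (to_fract (P_poly L)) * prod_list (map dz_sym js) -
    (\<Sum>s<length js. scal (to_fract (\<Prod>q\<in>supp L - {js ! s}. mvar q)) *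
      prod_list ((map dz_sym js)[s := dL_sym L])))"

text \<open>
  \<^term>\<open>P_frac L S\<close> is computed in the localization of \<^term>\<open>Xi m\<close> at \<open>t\<^sub>1, \<dots>, t\<^sub>m\<close>, again inside
  the exterior algebra over the fraction field, and then regarded as an element of \<^term>\<open>Xi m\<close>.
\<close>

definition P_rel :: "(nat \<Rightarrow> 'a::field) \<Rightarrow> nat set \<Rightarrow> 'a mpoly extalg" where
  "P_rel L S = the_inv emb (P_frac L S)"

lemma dz_sym_one_form:
  "dz_sym i = (\<Sum>j\<in>{i}. scal (inverse (to_fract (mvar i))) * gen j)"
  by (simp add: dz_sym_def)

lemma dz_sym_anticommute: "dz_sym i * dz_sym j = - (dz_sym j * dz_sym i)"
  unfolding dz_sym_one_form by (rule one_form_anticommute)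

lemma dz_sym_square: "dz_sym i * dz_sym i = 0"
  unfolding dz_sym_one_form by (rule one_form_square)

lemma dz_sym_mem_eq_0:
  "i \<in> set xs \<Longrightarrow> dz_sym i * prod_list (map dz_sym xs) = (0 :: 'a::field mpoly fract extalg)"
proof (induction xs)
  case (Cons x xs)
  show ?case
  proof (cases "i = x")
    case True
    then show ?thesis by (simp add: mult.assoc[symmetric] dz_sym_square)
  next
    case False
    have "dz_sym i * prod_list (map dz_sym (x # xs)) =
        - (dz_sym x * (dz_sym i * prod_list (map dz_sym xs :: 'a mpoly fract extalg list)))"
      unfolding list.map prod_list.Cons mult.assoc[symmetric] dz_sym_anticommute[of i x] by simp
    then show ?thesis using False Cons by simp
  qed
qed simp

lemma dz_sym_not_distinct:
  "\<not> distinct xs \<Longrightarrow> prod_list (map dz_sym xs) = (0 :: 'a::field mpoly fract extalg)"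
  by (induction xs) (auto simp: dz_sym_mem_eq_0)

lemma emb_forms_closed:
  "x \<in> emb ` forms V \<Longrightarrow> y \<in> emb ` forms V \<Longrightarrow> x + y \<in> emb ` forms V"
  "x \<in> emb ` forms V \<Longrightarrow> y \<in> emb ` forms V \<Longrightarrow> x - y \<in> emb ` forms V"
  "x \<in> emb ` forms V \<Longrightarrow> y \<in> emb ` forms V \<Longrightarrow> x * y \<in> emb ` forms V"
  "p \<in> mpolys V \<Longrightarrow> scal (to_fract p) \<in> emb ` forms V"
  "i \<in> V \<Longrightarrow> gen i \<in> emb ` forms V"
proof -
  assume "x \<in> emb ` forms V" "y \<in> emb ` forms V"
  then obtain w v where wv: "x = emb w" "y = emb v" "w \<in> forms V" "v \<in> forms V" by blast
  then have "w + v \<in> forms V" "w + - v \<in> forms V" "w * v \<in> forms V"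
    using forms_closed(3,4)[of w V v] forms_closed(3)[of w V "- v"] forms_closed(5)[of v V] by blast+
  then have "emb (w + v) \<in> emb ` forms V" "emb (w + - v) \<in> emb ` forms V" "emb (w * v) \<in> emb ` forms V"
    by (blast intro: imageI)+
  then show "x + y \<in> emb ` forms V" "x - y \<in> emb ` forms V" "x * y \<in> emb ` forms V"
    by (simp_all add: wv)
next
  assume "p \<in> mpolys V"
  then have "emb (scal p) \<in> emb ` forms V" by (intro imageI) simp
  then show "scal (to_fract p) \<in> emb ` forms V" by simp
next
  assume "i \<in> V"
  then have "emb (gen i) \<in> emb ` forms V" by (intro imageI forms_gen)
  then show "gen i \<in> emb ` forms V" by simp
qed

lemma emb_forms_sum:
  "(\<And>i. i \<in> I \<Longrightarrow> f i \<in> emb ` forms V) \<Longrightarrow> sum f I \<in> emb ` forms V"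
proof (induction I rule: infinite_finite_induct)
  case (insert i I)
  then show ?case by (simp add: emb_forms_closed(1))
qed (use emb_forms_closed(4)[OF mpolys_closed(1)] in auto)

lemma prod_dz_sym_in_forms:
  assumes "finite I" "I \<subseteq> V" "distinct xs" "set xs \<subseteq> I"
  shows "scal (to_fract (\<Prod>q\<in>I. mvar q)) * prod_list (map dz_sym xs) \<in>
    emb ` (forms V :: 'a::field mpoly extalg set)"
  using assms
proof (induction xs arbitrary: I)
  case Nil
  have "(\<Prod>q\<in>I. mvar q) \<in> mpolys V" using Nil by (intro mpolys_prod mpolys_closed) auto
  then show ?case using emb_forms_closed(4) by fastforce
next
  case (Cons x xs)
  have x: "x \<in> I" "x \<notin> set xs" using Cons by auto
  have *: "to_fract (mvar x) * (r * inverse (to_fract (mvar x))) = r" for r :: "'a mpoly fract"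
    by (simp add: field_simps)
  have "scal (to_fract (\<Prod>q\<in>I. mvar q)) * prod_list (map dz_sym (x # xs)) =
      gen x * (scal (to_fract (\<Prod>q\<in>I - {x}. mvar q)) * prod_list (map dz_sym xs :: 'a mpoly fract extalg list))"
    unfolding scal_left_commute[of "gen x"] prod.remove[OF Cons.prems(1) x(1), of mvar]
    by (simp add: dz_sym_def mult.assoc scal_mult_assoc *)
  moreover have "scal (to_fract (\<Prod>q\<in>I - {x}. mvar q)) * prod_list (map dz_sym xs) \<in>
      emb ` (forms V :: 'a mpoly extalg set)"
    using Cons.prems x by (intro Cons.IH) auto
  moreover have "gen x \<in> emb ` (forms V :: 'a mpoly extalg set)"
    using Cons.prems(2) x(1) by (intro emb_forms_closed) auto
  ultimately show ?case by (simp only: emb_forms_closed(3))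
qed

lemma prod_list_update_sum:
  fixes xs :: "'b::ring_1 list"
  assumes "s < length xs"
  shows "prod_list (xs[s := (\<Sum>i\<in>I. f i)]) = (\<Sum>i\<in>I. prod_list (xs[s := f i]))"
  using assms
proof (induction xs arbitrary: s)
  case (Cons x xs)
  then show ?case by (cases s) (simp_all add: sum_distrib_left sum_distrib_right)
qed simp

lemma prod_list_update_scal:
  assumes "s < length xs"
  shows "prod_list (xs[s := scal r * y]) = scal r * prod_list (xs[s := y])"
  using assms
proof (induction xs arbitrary: s)
  case (Cons x xs)
  then show ?case by (cases s) (simp_all add: mult.assoc scal_left_commute[of x])
qed simp

lemma P_frac_in_forms:
  fixes L :: "nat \<Rightarrow> 'a::field"
  assumes L: "finite (supp L)" "supp L \<subseteq> V" and S: "S \<subseteq> supp L"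
  shows "P_frac L S \<in> emb ` forms V"
proof -
  define js where "js = sorted_list_of_set S"
  have finS: "finite S" using L(1) S finite_subset by blast
  have js: "distinct js" "set js = S" using finS by (simp_all add: js_def)
  define Q :: "nat \<Rightarrow> 'a mpoly fract" where "Q i = to_fract (\<Prod>q\<in>supp L - {i}. mvar q)" for i
  define a where "a i = to_fract (mconst (L i))" for i
  define D :: "nat list \<Rightarrow> 'a mpoly fract extalg" where "D xs = prod_list (map dz_sym xs)" for xs
  have upd: "prod_list ((map dz_sym js)[s := dL_sym L]) = (\<Sum>i\<in>supp L. scal (a i) * D (js[s := i]))"
    if "s < length js" for s
    using that by (simp add: dL_sym_def prod_list_update_sum prod_list_update_scal a_def D_def map_update)
  have "P_frac L S = (\<Sum>i\<in>supp L. scal (a i) * (scal (Q i) * D js)) -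
      (\<Sum>s<length js. scal (Q (js ! s)) * (\<Sum>i\<in>supp L. scal (a i) * D (js[s := i])))"
    unfolding P_frac_def Let_def js_def[symmetric]
    using upd by (simp add: P_poly_def scal_sum sum_distrib_right a_def Q_def D_def scal_mult mult.assoc)
  also have "(\<Sum>s<length js. scal (Q (js ! s)) * (\<Sum>i\<in>supp L. scal (a i) * D (js[s := i]))) =
      (\<Sum>i\<in>supp L. scal (a i) * (\<Sum>s<length js. scal (Q (js ! s)) * D (js[s := i])))"
    unfolding sum_distrib_left by (subst sum.swap) (simp add: scal_mult_assoc mult.commute)
  finally have eq: "P_frac L S = (\<Sum>i\<in>supp L. scal (a i) *
      (scal (Q i) * D js - (\<Sum>s<length js. scal (Q (js ! s)) * D (js[s := i]))))"
    by (simp add: sum_subtractf right_diff_distrib)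
  have QD: "scal (Q i) * D xs \<in> emb ` forms V" if "distinct xs" "set xs \<subseteq> supp L - {i}" for i xs
    unfolding Q_def D_def using that L by (intro prod_dz_sym_in_forms) auto
  have "scal (Q i) * D js - (\<Sum>s<length js. scal (Q (js ! s)) * D (js[s := i])) \<in> emb ` forms V"
    if i: "i \<in> supp L" for i
  proof (cases "i \<in> S")
    case True
    then obtain k where k: "k < length js" "js ! k = i" using js by (metis in_set_conv_nth)
    have "D (js[s := i]) = 0" if "s < length js" "s \<noteq> k" for s
    proof -
      have "(js[s := i]) ! s = (js[s := i]) ! k" using k that by simp
      then have "\<not> distinct (js[s := i])"
        using k that by (metis length_list_update nth_eq_iff_index_eq)
      then show ?thesis unfolding D_def by (rule dz_sym_not_distinct)
    qed
    then have "(\<Sum>s<length js. scal (Q (js ! s)) * D (js[s := i])) =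
        (\<Sum>s<length js. if s = k then scal (Q i) * D js else 0)"
      using k by (intro sum.cong) auto
    also have "\<dots> = scal (Q i) * D js" using k by simp
    finally show ?thesis using emb_forms_closed(4)[OF mpolys_closed(1)] by fastforce
  next
    case False
    show ?thesis
    proof (intro emb_forms_closed(2) emb_forms_sum QD)
      fix s assume s: "s \<in> {..<length js}"
      show "distinct (js[s := i])" using js False by (simp add: distinct_list_update)
      have "x \<noteq> js ! s" if x: "x \<in> set (js[s := i])" for x
      proof -
        obtain l where l: "l < length js" "x = (js[s := i]) ! l"
          using x by (metis in_set_conv_nth length_list_update)
        show ?thesis
        proof (cases "l = s")
          case True
          then show ?thesis using l s js False by auto
        next
          case False
          then show ?thesis using l s js(1) by (simp add: nth_eq_iff_index_eq)
        qed
      qed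
      moreover have "set (js[s := i]) \<subseteq> supp L"
        using set_update_subset_insert[of js s i] js S i by blast
      ultimately show "set (js[s := i]) \<subseteq> supp L - {js ! s}" by blast
    qed (use js S False in auto)
  qed
  then show ?thesis
    unfolding eq using L
    by (intro emb_forms_sum emb_forms_closed(3)) (auto simp: a_def intro!: emb_forms_closed(4) mpolys_closed)
qed

lemma P_in_Xi:
  assumes "supp L \<subseteq> {1..m}" "S \<subseteq> supp L"
  shows "P_rel L S \<in> carrier (Xi m)" and "emb (P_rel L S) = P_frac L S"
proof -
  have "finite (supp L)" using assms(1) finite_subset by blast
  then obtain w where "w \<in> forms {1..m}" "P_frac L S = emb w"
    using P_frac_in_forms[OF _ assms] by blast
  then show "P_rel L S \<in> carrier (Xi m)" "emb (P_rel L S) = P_frac L S"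
    by (simp_all add: P_rel_def Xi_def the_inv_f_f[OF inj_emb])
qed

lemma P_empty: "P_rel L {} = scal (P_poly L)"
proof -
  have "P_frac L {} = emb (scal (P_poly L))" by (simp add: P_frac_def)
  then show ?thesis unfolding P_rel_def by (simp only: the_inv_f_f[OF inj_emb])
qed

end

theory Submission
  imports Defs
begin

text \<open>
  Induction on \<open>m\<close>. Expanding along \<open>t\<^sub>m\<close> and \<open>u\<^sub>m\<close>, an element of \<open>\<Xi>\<close> has the form
  \<open>t\<^sub>m\<^bsup>K+1\<^esup> g + t\<^sub>m\<^bsup>K\<^esup> h u\<^sub>m + \<dots>\<close>, with \<open>g\<close> and \<open>h\<close> in the first \<open>m - 1\<close> generators and the omitted terms
  of lower pole order along \<open>z\<^sub>m = 0\<close>. If it is in the kernel, multiplying by \<open>z\<^sub>m\<^bsup>K+1\<^esup>\<close> and setting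
  \<open>z\<^sub>m = 0\<close> shows that \<open>g\<close> is in the kernel for the arrangement restricted to that hyperplane, and so
  is \<open>h\<close> once \<open>g = 0\<close>. By induction \<open>g\<close> and \<open>h\<close> are combinations of the relations of the restriction. Any
  relation \<open>L''\<close> of the restriction lifts to \<open>L = L'' + b z\<^sub>m\<close>; if \<open>b \<noteq> 0\<close>, then \<open>P\<^bsub>L,S\<^esub>\<close> and
  \<open>P\<^bsub>L,S\<union>{m}\<^esub>\<close> are \<open>t\<^sub>m P\<^bsub>L'',S\<^esub>\<close> and \<open>P\<^bsub>L'',S\<^esub> u\<^sub>m\<close> up to terms of lower order, and if \<open>b = 0\<close>, then
  \<open>P\<^bsub>L'',S\<^esub>\<close> is itself one of the relations. So the pole order can be lowered modulo the ideal until
  \<open>t\<^sub>m\<close> and \<open>u\<^sub>m\<close> disappear. If some \<open>z\<^sub>i\<close> vanishes on the hyperplane, it is proportional to \<open>z\<^sub>m\<close>, and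
  \<open>t\<^sub>m\<close>, \<open>u\<^sub>m\<close> can be eliminated at once.
\<close>

section \<open>Two-sided ideals\<close>

text \<open>Rule induction over this set is what transports statements from the relations to the
  whole ideal. Negatives arise by multiplying with -1, provided that it lies in
  \<open>A\<close>.\<close>

inductive_set ideal_span :: "'b::ring_1 set \<Rightarrow> 'b set \<Rightarrow> 'b set" for A G where
  zero: "0 \<in> ideal_span A G"
| incl: "g \<in> G \<Longrightarrow> g \<in> ideal_span A G"
| add: "x \<in> ideal_span A G \<Longrightarrow> y \<in> ideal_span A G \<Longrightarrow> x + y \<in> ideal_span A G"
| mult_left: "a \<in> A \<Longrightarrow> x \<in> ideal_span A G \<Longrightarrow> a * x \<in> ideal_span A G"
| mult_right: "a \<in> A \<Longrightarrow> x \<in> ideal_span A G \<Longrightarrow> x * a \<in> ideal_span A G"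

lemma genideal_ring_on:
  assumes "ring (ring_on A)" "G \<subseteq> A" "\<And>x. x \<in> A \<Longrightarrow> - x \<in> A"
  shows "Idl\<^bsub>ring_on A\<^esub> G = ideal_span A G"
proof -
  interpret ring "ring_on A" by (rule assms(1))
  have A: "0 \<in> A" "1 \<in> A" "\<And>x y. x \<in> A \<Longrightarrow> y \<in> A \<Longrightarrow> x + y \<in> A"
    "\<And>x y. x \<in> A \<Longrightarrow> y \<in> A \<Longrightarrow> x * y \<in> A"
    using zero_closed one_closed add.m_closed m_closed by simp_all
  have sub: "ideal_span A G \<subseteq> A"
  proof
    fix x assume "x \<in> ideal_span A G"
    then show "x \<in> A" by induction (use assms(2) A in auto)
  qed
  have "ideal (ideal_span A G) (ring_on A)"
  proof (rule idealI[OF assms(1)])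
    show "subgroup (ideal_span A G) (add_monoid (ring_on A))"
    proof (rule add.subgroupI)
      fix a assume a: "a \<in> ideal_span A G"
      then have "- 1 * a \<in> ideal_span A G"
        using A assms(3) by (intro ideal_span.mult_left) auto
      moreover have "\<ominus>\<^bsub>ring_on A\<^esub> a = - a"
        using a sub assms by (intro ring_on_a_inv) auto
      ultimately show "\<ominus>\<^bsub>ring_on A\<^esub> a \<in> ideal_span A G" by simp
    qed (use sub in \<open>auto intro: ideal_span.intros\<close>)
  qed (auto intro: ideal_span.intros)
  then have "Idl\<^bsub>ring_on A\<^esub> G \<subseteq> ideal_span A G"
    by (rule genideal_minimal) (auto intro: ideal_span.incl)
  moreover have "ideal_span A G \<subseteq> Idl\<^bsub>ring_on A\<^esub> G"
  proof
    interpret I: ideal "Idl\<^bsub>ring_on A\<^esub> G" "ring_on A"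
      using assms(2) by (intro genideal_ideal) simp
    fix x assume "x \<in> ideal_span A G"
    then show "x \<in> Idl\<^bsub>ring_on A\<^esub> G"
    proof induction
      case (incl g)
      then show ?case using genideal_self[of G] assms(2) by auto
    next
      case zero
      then show ?case using I.zero_closed by simp
    next
      case (add x y)
      then show ?case using I.a_closed[of x y] by simp
    next
      case (mult_left a x)
      then show ?case using I.I_l_closed[of x a] by simp
    next
      case (mult_right a x)
      then show ?case using I.I_r_closed[of x a] by simp
    qed
  qed
  ultimately show ?thesis by blast
qed

lemma ideal_span_mono:
  assumes "A \<subseteq> B" "G \<subseteq> H"
  shows "ideal_span A G \<subseteq> ideal_span B H"
proof
  fix x assume "x \<in> ideal_span A G"
  then show "x \<in> ideal_span B H" by induction (use assms in \<open>auto intro: ideal_span.intros\<close>)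
qed

section \<open>The grade involution\<close>

text \<open>Moving a generator past a form that need not be homogeneous costs exactly this sign
  change, so forms never have to be split by degree.\<close>

lift_definition grade_inv :: "'r::comm_ring_1 extalg \<Rightarrow> 'r extalg"
  is "\<lambda>f A. (- 1) ^ card A * f A"
proof (intro conjI allI impI)
  fix f :: "nat set \<Rightarrow> 'r"
  assume f: "finite {A. f A \<noteq> 0} \<and> (\<forall>A. f A \<noteq> 0 \<longrightarrow> finite A)"
  show "finite {A. (- 1) ^ card A * f A \<noteq> 0}"
    by (rule finite_subset[of _ "{A. f A \<noteq> 0}"]) (use f in auto)
  fix A assume "(- 1) ^ card A * f A \<noteq> 0"
  then show "finite A" using f by auto
qed

lemma grade_inv_grade_inv [simp]: "grade_inv (grade_inv w) = w"
proof (rule extalg_eqI)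
  fix A :: "nat set"
  have "(- 1) ^ card A * (- 1) ^ card A = (1::'a)" by (simp flip: power_add mult_2)
  then show "coef (grade_inv (grade_inv w)) A = coef w A"
    by (simp add: grade_inv.rep_eq mult.assoc[symmetric])
qed

lemma coef_mult_gen:
  "coef (w * gen i) C =
    (if finite C \<and> i \<in> C then shuffle_sign (C - {i}) {i} * coef w (C - {i}) else 0)"
proof (cases "finite C")
  case True
  have eq: "C - A = {i} \<longleftrightarrow> i \<in> C \<and> A = C - {i}" if "A \<subseteq> C" for A using that by auto
  have eq': "C - (C - {i}) = {i}" if "i \<in> C" using that by auto
  have "coef (w * gen i) C = (\<Sum>A\<in>Pow C. if A = C - {i} then
      if i \<in> C then shuffle_sign (C - {i}) {i} * coef w (C - {i}) else 0 else 0)"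
    unfolding coef_mult[OF True] by (rule sum.cong) (auto simp: gen.rep_eq eq eq')
  then show ?thesis using True by auto
qed (simp add: coef_infinite)

text \<open>One side counts the elements of \<open>B\<close> below \<open>i\<close>, the other those
  above \<open>i\<close>. Together these exhaust \<open>B\<close>, so the signs differ by the parity
  of \<open>card B\<close>.\<close>

lemma shuffle_sign_swap:
  assumes "finite B" "i \<notin> B"
  shows "shuffle_sign {i} B = (- 1) ^ card B * (shuffle_sign B {i} :: 'r::comm_ring_1)"
proof -
  have 1: "{(a, b). a \<in> {i} \<and> b \<in> B \<and> b < a} = Pair i ` {b\<in>B. b < i}"
    "{(a, b). a \<in> B \<and> b \<in> {i} \<and> b < a} = (\<lambda>b. (b, i)) ` {b\<in>B. i < b}" by auto
  have B: "B = {b\<in>B. b < i} \<union> {b\<in>B. i < b}" 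
  proof (intro equalityI subsetI)
    fix b assume "b \<in> B"
    with assms(2) have "b \<noteq> i" by blast
    with \<open>b \<in> B\<close> show "b \<in> {b\<in>B. b < i} \<union> {b\<in>B. i < b}" by auto
  qed auto
  have "card B = card {b\<in>B. b < i} + card {b\<in>B. i < b}"
    by (subst B, rule card_Un_disjoint) (use assms(1) in auto)
  moreover have "(- 1) ^ k * (- 1) ^ k = (1::'r)" for k by (simp flip: power_add mult_2)
  ultimately show ?thesis
    unfolding shuffle_sign_def 1
    by (simp add: card_image inj_on_def power_add mult.assoc)
qed

lemma gen_mult_eq: "gen i * w = grade_inv w * gen i"
proof (rule extalg_eqI)
  fix C
  show "coef (gen i * w) C = coef (grade_inv w * gen i) C"
    using shuffle_sign_swap[of "C - {i}" i, where 'r = 'a]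
    by (simp add: coef_gen_mult coef_mult_gen grade_inv.rep_eq mult_ac)
qed

lemma mult_gen_eq: "w * gen i = gen i * grade_inv w"
  by (simp add: gen_mult_eq)

lemma mult_one_form_eq:
  "w * (\<Sum>j\<in>J. scal (r j) * gen j) = (\<Sum>j\<in>J. scal (r j) * gen j) * grade_inv w"
proof -
  have "w * (scal s * gen i) = scal s * gen i * grade_inv w" for s i
    unfolding scal_left_commute[of w] mult_gen_eq[of w] by (simp only: mult.assoc)
  then show ?thesis by (simp only: sum_distrib_left sum_distrib_right)
qed

lemma grade_inv_forms:
  assumes "w \<in> forms V"
  shows "grade_inv w \<in> forms V"
proof -
  have "(- 1) ^ k * p \<in> mpolys V" if "p \<in> mpolys V" for k and p :: "'a mpoly"
    using that by (cases "even k") (auto intro: mpolys_closed)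
  then show ?thesis using assms by (simp add: forms_def grade_inv.rep_eq) (metis mult_zero_right)
qed

section \<open>Induction over polynomial forms\<close>

lemma single_eq_mon_eval: "Poly_Mapping.single k a = mconst a * mon_eval mvar k"
proof -
  have sum: "Poly_Mapping.single (sum f I) (1::'a) = (\<Prod>i\<in>I. Poly_Mapping.single (f i) 1)"
    for f :: "nat \<Rightarrow> nat \<Rightarrow>\<^sub>0 nat" and I
  proof (induction I rule: infinite_finite_induct)
    case (insert i I)
    then show ?case by (simp flip: insert.IH add: mult_single)
  qed simp_all
  have power: "Poly_Mapping.single (Poly_Mapping.single i e) (1::'a) = mvar i ^ e" for i e
  proof (induction e)
    case (Suc e)
    have "Poly_Mapping.single i (Suc e) = Poly_Mapping.single i 1 + Poly_Mapping.single i e"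
      by (simp flip: single_add)
    then have "Poly_Mapping.single (Poly_Mapping.single i (Suc e)) (1::'a) =
        mvar i * Poly_Mapping.single (Poly_Mapping.single i e) 1"
      by (simp add: mvar_def mult_single)
    then show ?case by (simp add: Suc)
  qed simp
  have "Poly_Mapping.single k (1::'a) = mon_eval mvar k"
    by (subst mpoly_expand[of k]) (simp only: sum power mon_eval_def)
  then show ?thesis by (metis add_0 mconst_def mult.right_neutral mult_single)
qed

lemma mpolys_induct [consumes 1, case_names const var add mult]:
  assumes p: "p \<in> mpolys V"
    and const: "\<And>a. P (mconst a)" and var: "\<And>i. i \<in> V \<Longrightarrow> P (mvar i)"
    and add: "\<And>p q. P p \<Longrightarrow> P q \<Longrightarrow> P (p + q)" and mult: "\<And>p q. P p \<Longrightarrow> P q \<Longrightarrow> P (p * q)"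
  shows "P p"
proof -
  have P01: "P 0" "P 1" using const[of 0] const[of 1] by simp_all
  have sum: "P (sum f I)" if "\<And>i. i \<in> I \<Longrightarrow> P (f i)" for f and I :: "(nat \<Rightarrow>\<^sub>0 nat) set"
    using that by (induction I rule: infinite_finite_induct) (auto intro: add P01)
  have prod: "P (prod f I)" if "\<And>i. i \<in> I \<Longrightarrow> P (f i)" for f and I :: "nat set"
    using that by (induction I rule: infinite_finite_induct) (auto intro: mult P01)
  have pow: "P (q ^ k)" if "P q" for q k
    by (induction k) (auto intro: mult P01 that)
  have "P (\<Sum>k\<in>Poly_Mapping.keys p. Poly_Mapping.single k (Poly_Mapping.lookup p k))"
    unfolding single_eq_mon_eval mon_eval_def
    using p by (intro sum mult const prod pow var) (auto simp: mpolys_def)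
  then show ?thesis using mpoly_expand[of p] by simp
qed

text \<open>Expansion in the basis of ordered products writes a form as a sum of products of
  generators; \<open>mpolys_induct\<close> does the same for its coefficients.\<close>

lemma forms_induct [consumes 1, case_names const t u add mult]:
  assumes w: "w \<in> forms V"
    and const: "\<And>a. P (scal (mconst a))" and t: "\<And>i. i \<in> V \<Longrightarrow> P (scal (mvar i))"
    and u: "\<And>i. i \<in> V \<Longrightarrow> P (gen i)"
    and add: "\<And>w v. P w \<Longrightarrow> P v \<Longrightarrow> P (w + v)" and mult: "\<And>w v. P w \<Longrightarrow> P v \<Longrightarrow> P (w * v)"
  shows "P w"
proof -
  have P01: "P 0" "P 1" using const[of 0] const[of 1] by simp_all
  have sum: "P (sum f I)" if "\<And>i. i \<in> I \<Longrightarrow> P (f i)" for f and I :: "nat set set"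
    using that by (induction I rule: infinite_finite_induct) (auto intro: add P01)
  have scal: "P (scal p)" if "p \<in> mpolys V" for p
    using that by (induction rule: mpolys_induct)
      (auto simp: scal_add scal_mult intro: const t add mult)
  have list: "P (prod_list (map gen xs))" if "set xs \<subseteq> V" for xs
    using that by (induction xs) (auto intro: P01 mult u)
  have fin: "finite A" if "coef w A \<noteq> 0" for A using that coef_infinite by blast
  have "P (\<Sum>A | coef w A \<noteq> 0. scal (coef w A) * oprod gen A)"
    unfolding oprod_def using w fin by (intro sum mult scal list) (auto simp: forms_def)
  then show ?thesis using extalg_expand[of "{A. coef w A \<noteq> 0}" w] by simp
qed

section \<open>An explicit form of the relations\<close>

text \<open>A repeated factor moves next to its twin at the price of a sign, and the square there is
  zero.\<close>

lemma odd_prod_list_not_distinct: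
  fixes D :: "nat \<Rightarrow> 'r::comm_ring_1 extalg"
  assumes anti: "\<And>i j. D i * D j = - (D j * D i)" and sq: "\<And>i. D i * D i = 0"
    and "\<not> distinct xs"
  shows "prod_list (map D xs) = 0"
proof -
  have mem: "D i * prod_list (map D ys) = 0" if "i \<in> set ys" for i ys
    using that
  proof (induction ys)
    case (Cons y ys)
    have eq: "D i * prod_list (map D (y # ys)) = D i * D y * prod_list (map D ys)"
      by (simp add: mult.assoc)
    show ?case
    proof (cases "i = y")
      case True
      then show ?thesis unfolding eq by (simp add: sq)
    next
      case False
      then show ?thesis
        unfolding eq anti[of i y] using Cons by (simp add: mult.assoc)
    qed
  qed simp
  show ?thesis using \<open>\<not> distinct xs\<close> by (induction xs) (auto simp: mem)
qed

lemma prod_list_map_scal: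
  "prod_list (map (\<lambda>i. scal (r i) * D i) xs) = scal (prod_list (map r xs)) * prod_list (map D xs)"
  by (induction xs) (simp_all add: scal_mult_scal)

text \<open>
  If \<open>\<partial>\<close> is the antiderivation with \<open>\<partial> u\<^sub>i = 1\<close>, then \<open>u\<^sub>S\<close> minus the sum below is \<open>\<partial>(u\<^sub>i u\<^sub>S)\<close>.
\<close>

definition replace_sum :: "(nat \<Rightarrow> 'b::ring_1) \<Rightarrow> nat \<Rightarrow> nat list \<Rightarrow> 'b" where
  "replace_sum U i xs = (\<Sum>s<length xs. prod_list (map U (xs[s := i])))"

lemma list_update_disjoint:
  assumes "distinct xs" "i \<notin> set xs" "s < length xs"
  shows "distinct (xs[s := i])" "set (xs[s := i]) = insert i (set xs - {xs ! s})"
  using assms by (simp_all add: distinct_list_update set_update_distinct)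

text \<open>The left side is the defining formula of P_{L,S}; the right side uses only the products
  \<open>U i\<close> of \<open>r i\<close> and \<open>D i\<close>. It is stated for arbitrary odd
  \<open>D\<close> because it serves twice: in the symbols t_i and dz_i, to clear denominators, and
  after \<psi>, with the inverses of the z_i and the actual differentials.\<close>

lemma relation_expansion:
  fixes D :: "nat \<Rightarrow> 'r::comm_ring_1 extalg" and r a :: "nat \<Rightarrow> 'r"
  defines "U \<equiv> \<lambda>i. scal (r i) * D i"
  assumes anti: "\<And>i j. D i * D j = - (D j * D i)" and sq: "\<And>i. D i * D i = 0"
    and I: "finite I" and js: "distinct js" "set js \<subseteq> I"
  shows "scal (\<Sum>i\<in>I. a i * (\<Prod>q\<in>I - {i}. r q)) * prod_list (map D js) -
      (\<Sum>s<length js. scal (\<Prod>q\<in>I - {js ! s}. r q) *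
        prod_list ((map D js)[s := \<Sum>i\<in>I. scal (a i) * D i])) =
    (\<Sum>i\<in>I - set js. scal (a i * (\<Prod>q\<in>I - set js - {i}. r q)) *
      (prod_list (map U js) - replace_sum U i js))"
proof -
  define Q where "Q i = (\<Prod>q\<in>I - {i}. r q)" for i
  define p where "p xs = prod_list (map D xs)" for xs
  define summand where "summand i = scal (Q i) * p js - (\<Sum>s<length js. scal (Q (js ! s)) * p (js[s := i]))" for i
  have upd: "prod_list ((map D js)[s := \<Sum>i\<in>I. scal (a i) * D i]) = (\<Sum>i\<in>I. scal (a i) * p (js[s := i]))"
    if "s < length js" for s
    using that by (simp add: prod_list_update_sum prod_list_update_scal p_def map_update)
  have swap: "(\<Sum>s<length js. scal (Q (js ! s)) * (\<Sum>i\<in>I. scal (a i) * p (js[s := i]))) =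
      (\<Sum>i\<in>I. scal (a i) * (\<Sum>s<length js. scal (Q (js ! s)) * p (js[s := i])))"
    unfolding sum_distrib_left by (subst sum.swap) (simp add: scal_mult_assoc mult.commute)
  have "scal (\<Sum>i\<in>I. a i * Q i) * p js - (\<Sum>s<length js. scal (Q (js ! s)) *
      prod_list ((map D js)[s := \<Sum>i\<in>I. scal (a i) * D i])) = (\<Sum>i\<in>I. scal (a i) * summand i)"
    using upd swap
    by (simp add: summand_def scal_sum sum_distrib_right scal_mult mult.assoc sum_subtractf right_diff_distrib)
  also have "\<dots> = (\<Sum>i\<in>I - set js. scal (a i) * summand i)"
  proof (rule sum.mono_neutral_right)
    \<comment> \<open>For \<open>i\<close> in \<open>set js\<close>, inserting \<open>i\<close> at a
      foreign position repeats a factor and gives 0, while at its own position it changes nothing.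
      The surviving term cancels the first one.\<close>
    show "\<forall>i\<in>I - (I - set js). scal (a i) * summand i = 0"
    proof
      fix i assume "i \<in> I - (I - set js)"
      then obtain k where k: "k < length js" "js ! k = i" by (auto simp: in_set_conv_nth)
      have "p (js[s := i]) = 0" if "s < length js" "s \<noteq> k" for s
      proof -
        have "(js[s := i]) ! s = (js[s := i]) ! k" using k that by simp
        then have "\<not> distinct (js[s := i])"
          using k that by (metis length_list_update nth_eq_iff_index_eq)
        then show ?thesis unfolding p_def by (rule odd_prod_list_not_distinct[OF anti sq])
      qed
      then have "(\<Sum>s<length js. scal (Q (js ! s)) * p (js[s := i])) =
          (\<Sum>s<length js. if s = k then scal (Q i) * p js else 0)"
        using k by (intro sum.cong) auto
      then show "scal (a i) * summand i = 0" using k by (simp add: summand_def)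
    qed
  qed (use I in auto)
  also have "\<dots> = (\<Sum>i\<in>I - set js. scal (a i * (\<Prod>q\<in>I - set js - {i}. r q)) *
      (prod_list (map U js) - replace_sum U i js))"
  proof (rule sum.cong[OF refl])
    fix i assume i: "i \<in> I - set js"
    define R where "R = (\<Prod>q\<in>I - set js - {i}. r q)"
    \<comment> \<open>The factors \<open>r q\<close> belonging to the indices of the product are
      absorbed to turn each \<open>D\<close> into \<open>U\<close>; the remaining ones form
      \<open>R\<close>.\<close>
    have U: "prod_list (map U xs) = scal (\<Prod>q\<in>set xs. r q) * p xs" if "distinct xs" for xs
      unfolding U_def prod_list_map_scal p_def using that by (simp add: prod.distinct_set_conv_list)
    have split: "R * (\<Prod>q\<in>B. r q) = (\<Prod>q\<in>C. r q)"
      if "C = (I - set js - {i}) \<union> B" "(I - set js - {i}) \<inter> B = {}" "finite B" for B C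
      unfolding R_def that(1) using that I by (intro prod.union_disjoint[symmetric]) auto
    have "scal (Q i) * p js = scal R * prod_list (map U js)"
      using js i unfolding U[OF js(1)] scal_mult_assoc Q_def
      by (subst split[where C = "I - {i}"]) auto
    moreover have "scal (Q (js ! s)) * p (js[s := i]) = scal R * prod_list (map U (js[s := i]))"
      if s: "s < length js" for s
    proof -
      have "i \<notin> set js" using i by simp
      note upd = list_update_disjoint[OF js(1) this s]
      have "js ! s \<in> set js" using s by simp
      then show ?thesis
        using js i upd unfolding U[OF upd(1)] scal_mult_assoc Q_def
        by (subst split[where C = "I - {js ! s}"]) auto
    qed
    ultimately have "summand i = scal R * (prod_list (map U js) - replace_sum U i js)"
      by (simp add: summand_def replace_sum_def right_diff_distrib sum_distrib_left)
    then show "scal (a i) * summand i = scal (a i * (\<Prod>q\<in>I - set js - {i}. r q)) *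
        (prod_list (map U js) - replace_sum U i js)"
      by (simp add: R_def scal_mult_assoc)
  qed
  finally show ?thesis by (simp only: Q_def p_def)
qed

text \<open>P_{L,S} with denominators cleared: the terms with \<open>i\<close> in \<open>S\<close>
  have cancelled, and only polynomials and the u_i are left, so \<psi> can be applied
  directly.\<close>

definition P_expl :: "(nat \<Rightarrow> 'a::field) \<Rightarrow> nat set \<Rightarrow> 'a mpoly extalg" where
  "P_expl L S = (\<Sum>i\<in>supp L - S. scal (mconst (L i) * (\<Prod>q\<in>supp L - S - {i}. mvar q)) *
    (oprod gen S - replace_sum gen i (sorted_list_of_set S)))"

lemma emb_prod_list: "emb (prod_list xs) = prod_list (map emb xs)"
  by (induction xs) simp_all

lemma emb_oprod_gen: "emb (oprod gen A) = oprod gen A"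
  by (simp add: oprod_def emb_prod_list comp_def)

lemma emb_replace_sum_gen: "emb (replace_sum gen i xs) = replace_sum gen i xs"
  by (simp add: replace_sum_def emb_prod_list comp_def map_update)

lemma P_rel_eq_P_expl:
  fixes L :: "nat \<Rightarrow> 'a::field"
  assumes "finite (supp L)" "S \<subseteq> supp L"
  shows "P_rel L S = P_expl L S"
proof -
  define js where "js = sorted_list_of_set S"
  have "finite S" using assms finite_subset by blast
  then have js: "distinct js" "set js = S" by (simp_all add: js_def)
  \<comment> \<open>Since u_i = t_i dz_i, the expansion with r_i = t_i has the generators themselves
    as its \<open>U\<close>.\<close>
  have gen: "gen = (\<lambda>i. scal (to_fract (mvar i :: 'a mpoly)) * dz_sym i)"
    by (simp add: dz_sym_def scal_mult_assoc)
  have "P_frac L S = scal (\<Sum>i\<in>supp L. to_fract (mconst (L i)) * (\<Prod>q\<in>supp L - {i}. to_fract (mvar q))) *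
      prod_list (map dz_sym js) -
      (\<Sum>s<length js. scal (\<Prod>q\<in>supp L - {js ! s}. to_fract (mvar q)) *
        prod_list ((map dz_sym js)[s := \<Sum>i\<in>supp L. scal (to_fract (mconst (L i))) * dz_sym i]))"
    by (simp add: P_frac_def Let_def P_poly_def dL_sym_def flip: js_def)
  also have "\<dots> = (\<Sum>i\<in>supp L - set js. scal (to_fract (mconst (L i)) *
      (\<Prod>q\<in>supp L - set js - {i}. to_fract (mvar q))) * (prod_list (map gen js) - replace_sum gen i js))"
    unfolding gen using assms js
    by (intro relation_expansion) (simp_all add: dz_sym_anticommute[symmetric] dz_sym_square)
  also have "\<dots> = emb (P_expl L S)"
    by (simp add: P_expl_def js(2) emb_oprod_gen emb_replace_sum_gen flip: js_def)
      (simp add: oprod_def js_def)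
  finally show ?thesis
    unfolding P_rel_def by (simp only: the_inv_f_f[OF inj_emb])
qed

section \<open>The relations lie in the kernel of \<psi>\<close>

lemma psi_sum: "psi c n (sum f I) = (\<Sum>i\<in>I. psi c n (f i))"
  by (induction I rule: infinite_finite_induct) (auto simp: psi_0 psi_add)

lemma psi_diff: "psi c n (w - v) = psi c n w - psi c n v"
  using psi_add[of c n w "- v"] by (simp add: psi_uminus)

lemma psi_prod_list: "psi c n (prod_list xs) = prod_list (map (psi c n) xs)"
  by (induction xs) (simp_all add: psi_1 psi_mult)

lemma psi_replace_sum_gen: "psi c n (replace_sum gen i xs) = replace_sum (dlog c n) i xs"
  by (simp add: replace_sum_def psi_sum psi_prod_list comp_def map_update psi_u)

lemma psi_scal_prod_mvar:
  "psi c n (scal (\<Prod>q\<in>A. mvar q)) = scal (\<Prod>q\<in>A. inverse (to_fract (zform c n q)))"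
proof (induction A rule: infinite_finite_induct)
  case (insert q A)
  then show ?case by (simp add: scal_mult psi_mult psi_t zinv_def)
qed (simp_all add: psi_1)

lemma mconst_sum: "mconst (sum f I) = (\<Sum>i\<in>I. mconst (f i))"
  by (induction I rule: infinite_finite_induct) simp_all

text \<open>All rows of the new coefficient matrix agree, so the index \<open>k\<close> is
  arbitrary. This makes \<open>dzform_eq_0\<close> applicable to a linear combination of
  forms.\<close>

lemma zform_lincomb:
  "(\<Sum>i\<in>A. mconst (a i) * zform c n i) = zform (\<lambda>_ j. \<Sum>i\<in>A. a i * c i j) n k"
  unfolding zform_def sum_distrib_left mconst_sum sum_distrib_right
  by (subst sum.swap) (simp add: mult.assoc)

lemma dzform_lincomb:
  "(\<Sum>i\<in>A. scal (mconst (a i)) * dzform c n i) = dzform (\<lambda>_ j. \<Sum>i\<in>A. a i * c i j) n k"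
  unfolding dzform_def sum_distrib_left mconst_sum scal_sum sum_distrib_right
  by (subst sum.swap) (simp add: scal_mult_assoc)

lemma lookup_zform:
  assumes "j \<in> {1..n}"
  shows "Poly_Mapping.lookup (zform c n i) (Poly_Mapping.single j 1) = c i j"
proof -
  have eq: "Poly_Mapping.single k (1::nat) = Poly_Mapping.single j 1 \<longleftrightarrow> k = j" for k
    by (metis keys_single singleton_inject zero_neq_one)
  have "Poly_Mapping.lookup (zform c n i) (Poly_Mapping.single j 1) =
      (\<Sum>k=1..n. if k = j then c i j else 0)"
    unfolding zform_def lookup_sum
    by (rule sum.cong) (use eq in \<open>auto simp: mconst_def mvar_def mult_single lookup_single when_def\<close>)
  then show ?thesis using assms by simp
qed

lemma dzform_eq_0:
  assumes "zform c n i = 0"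
  shows "dzform c n i = 0"
proof -
  have "c i j = 0" if "j \<in> {1..n}" for j
    using lookup_zform[OF that, of c i] by (simp add: assms)
  then show ?thesis by (simp add: dzform_def)
qed

text \<open>\<open>relation_expansion\<close>, read backwards, turns the image into the defining
  formula with the actual z_i and dz_i. The first term then contains the relation among the z_i, and
  every other term contains the same relation among the dz_i, so all of them vanish.\<close>

lemma psi_P_rel:
  assumes z: "\<And>i. i \<in> supp L \<Longrightarrow> zform c n i \<noteq> 0"
    and L: "is_relation c n m L" and S: "S \<subseteq> supp L"
  shows "psi c n (P_rel L S) = 0"
proof -
  let ?z = "\<lambda>i. to_fract (zform c n i)" and ?a = "\<lambda>i. to_fract (mconst (L i))"
  let ?D = "\<lambda>i. emb (dzform c n i)"
  define js where "js = sorted_list_of_set S"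
  have fin: "finite (supp L)" using L finite_subset by (auto simp: is_relation_def)
  then have "finite S" using S finite_subset by blast
  then have js: "distinct js" "set js = S" by (simp_all add: js_def)
  have D: "?D i = (\<Sum>j=1..n. scal (to_fract (mconst (c i j))) * gen j)" for i
    by (simp add: dzform_def)
  have rel: "(\<Sum>i\<in>supp L. ?a i * ?z i) = 0"
    using L by (simp add: is_relation_def flip: to_fract_simps(6) to_fract_sum)
  \<comment> \<open>Factoring out the product of all inverses leaves the linear relation.\<close>
  have "(\<Sum>i\<in>supp L. ?a i * (\<Prod>q\<in>supp L - {i}. inverse (?z q))) =
      (\<Sum>i\<in>supp L. ?a i * ?z i * (\<Prod>q\<in>supp L. inverse (?z q)))"
    by (intro sum.cong refl) (use z fin in \<open>simp add: prod.remove[OF fin]\<close>)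
  also have "\<dots> = 0" using rel by (simp flip: sum_distrib_right)
  finally have 1: "(\<Sum>i\<in>supp L. ?a i * (\<Prod>q\<in>supp L - {i}. inverse (?z q))) = 0" .
  have "(\<Sum>i\<in>supp L. scal (mconst (L i)) * dzform c n i) = 0"
    using L unfolding dzform_lincomb[where k = 0] is_relation_def zform_lincomb[where k = 0]
    by (blast intro: dzform_eq_0)
  then have "emb (\<Sum>i\<in>supp L. scal (mconst (L i)) * dzform c n i) = 0" by (simp only: emb_simps)
  then have 2: "(\<Sum>i\<in>supp L. scal (?a i) * ?D i) = 0" by simp
  have upd0: "prod_list (xs[s := 0]) = 0" if "s < length xs" for s and xs :: "'a mpoly fract extalg list"
    using prod_list_update_scal[OF that, of 0 0] by simp
  have "psi c n (P_rel L S) = (\<Sum>i\<in>supp L - set js. scal (?a i * (\<Prod>q\<in>supp L - set js - {i}. inverse (?z q))) *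
      (prod_list (map (dlog c n) js) - replace_sum (dlog c n) i js))"
    unfolding P_rel_eq_P_expl[OF fin S] P_expl_def js_def[symmetric] oprod_def
    by (simp add: psi_sum psi_mult psi_diff scal_mult psi_scal_mconst psi_scal_prod_mvar js(2)
      psi_replace_sum_gen psi_prod_list comp_def psi_u)
  also have "\<dots> = 0"
  proof -
    have anti: "?D i * ?D j = - (?D j * ?D i)" for i j unfolding D by (rule one_form_anticommute)
    have sq: "?D i * ?D i = 0" for i unfolding D by (rule one_form_square)
    have dlog: "dlog c n = (\<lambda>i. scal (inverse (?z i)) * ?D i)"
      by (simp add: fun_eq_iff dlog_def zinv_def)
    show ?thesis
      unfolding dlog relation_expansion[OF anti sq fin js(1) S[folded js(2)], symmetric] 1 2
      using upd0 by simp
  qed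
  finally show ?thesis .
qed

section \<open>Specialization of fractions\<close>

text \<open>
  A substitution \<open>\<sigma>\<close> extends only to those fractions whose denominator it does not kill, so the
  extension is a relation; it is single-valued (\<open>spec_0_left\<close>).
\<close>

definition spec :: "('r::idom \<Rightarrow> 's::idom) \<Rightarrow> 'r fract \<Rightarrow> 's fract \<Rightarrow> bool" where
  "spec \<sigma> f f' \<longleftrightarrow> (\<exists>p q. \<sigma> q \<noteq> 0 \<and> f * to_fract q = to_fract p \<and> f' * to_fract (\<sigma> q) = to_fract (\<sigma> p))"

definition spec_ext :: "('r::idom \<Rightarrow> 's::idom) \<Rightarrow> 'r fract extalg \<Rightarrow> 's fract extalg \<Rightarrow> bool" where
  "spec_ext \<sigma> w w' \<longleftrightarrow> (\<forall>A. spec \<sigma> (coef w A) (coef w' A))"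

context
  fixes \<sigma> :: "'r::idom \<Rightarrow> 's::idom"
  assumes \<sigma>: "\<sigma> 0 = 0" "\<sigma> 1 = 1" "\<And>p q. \<sigma> (p + q) = \<sigma> p + \<sigma> q" "\<And>p q. \<sigma> (p * q) = \<sigma> p * \<sigma> q"
begin

lemma spec_to_fract: "spec \<sigma> (to_fract p) (to_fract (\<sigma> p))"
  unfolding spec_def by (intro exI[of _ p] exI[of _ 1]) (simp add: \<sigma>)

lemma spec_0: "spec \<sigma> 0 0"
  using spec_to_fract[of 0] by (simp add: \<sigma>)

lemma spec_1: "spec \<sigma> 1 1"
  using spec_to_fract[of 1] by (simp add: \<sigma>)

lemma spec_inverse:
  assumes "\<sigma> q \<noteq> 0"
  shows "spec \<sigma> (inverse (to_fract q)) (inverse (to_fract (\<sigma> q)))"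
proof -
  have "q \<noteq> 0" using assms \<sigma>(1) by auto
  then show ?thesis
    unfolding spec_def using assms by (intro exI[of _ 1] exI[of _ q]) (simp add: \<sigma>)
qed

lemma spec_add:
  assumes "spec \<sigma> f f'" "spec \<sigma> g g'"
  shows "spec \<sigma> (f + g) (f' + g')"
proof -
  from assms obtain p q r s where *:
    "\<sigma> q \<noteq> 0" "to_fract p = f * to_fract q" "to_fract (\<sigma> p) = f' * to_fract (\<sigma> q)"
    "\<sigma> s \<noteq> 0" "to_fract r = g * to_fract s" "to_fract (\<sigma> r) = g' * to_fract (\<sigma> s)"
    unfolding spec_def by metis
  have "\<sigma> (q * s) \<noteq> 0" using * by (simp add: \<sigma>)
  moreover have "(f + g) * to_fract (q * s) = to_fract (p * s + r * q)"
    by (simp add: * algebra_simps)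
  moreover have "(f' + g') * to_fract (\<sigma> (q * s)) = to_fract (\<sigma> (p * s + r * q))"
    by (simp add: * \<sigma> algebra_simps)
  ultimately show ?thesis unfolding spec_def by blast
qed

lemma spec_mult:
  assumes "spec \<sigma> f f'" "spec \<sigma> g g'"
  shows "spec \<sigma> (f * g) (f' * g')"
proof -
  from assms obtain p q r s where *:
    "\<sigma> q \<noteq> 0" "to_fract p = f * to_fract q" "to_fract (\<sigma> p) = f' * to_fract (\<sigma> q)"
    "\<sigma> s \<noteq> 0" "to_fract r = g * to_fract s" "to_fract (\<sigma> r) = g' * to_fract (\<sigma> s)"
    unfolding spec_def by metis
  have "\<sigma> (q * s) \<noteq> 0" using * by (simp add: \<sigma>)
  moreover have "f * g * to_fract (q * s) = to_fract (p * r)"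
    by (simp add: * ac_simps)
  moreover have "f' * g' * to_fract (\<sigma> (q * s)) = to_fract (\<sigma> (p * r))"
    by (simp add: * \<sigma> ac_simps)
  ultimately show ?thesis unfolding spec_def by blast
qed

lemma spec_0_left:
  assumes "spec \<sigma> 0 f"
  shows "f = 0"
proof -
  from assms obtain p q where "\<sigma> q \<noteq> 0" "to_fract p = 0" "f * to_fract (\<sigma> q) = to_fract (\<sigma> p)"
    unfolding spec_def by auto
  then show ?thesis by (simp add: \<sigma>)
qed

lemma spec_sum:
  "(\<And>i. i \<in> I \<Longrightarrow> spec \<sigma> (f i) (g i)) \<Longrightarrow> spec \<sigma> (sum f I) (sum g I)"
  by (induction I rule: infinite_finite_induct) (auto intro: spec_add spec_0)

lemma spec_shuffle_sign: "spec \<sigma> (shuffle_sign A B) (shuffle_sign A B)"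
proof -
  have "\<sigma> (- 1) = - 1" using \<sigma>(3)[of "- 1" 1] by (simp add: \<sigma> eq_neg_iff_add_eq_0)
  then have minus_1: "spec \<sigma> (- 1) (- 1)" using spec_to_fract[of "- 1"] by simp
  have "spec \<sigma> ((- 1) ^ k) ((- 1) ^ k)" for k
  proof (induction k)
    case (Suc k)
    show ?case unfolding power_Suc by (rule spec_mult[OF minus_1 Suc])
  qed (simp add: spec_1)
  then show ?thesis unfolding shuffle_sign_def .
qed

lemma spec_ext_0_left: "spec_ext \<sigma> 0 w \<Longrightarrow> w = 0"
  by (rule extalg_eqI) (auto simp: spec_ext_def dest: spec_0_left)

lemma spec_ext_add: "spec_ext \<sigma> w w' \<Longrightarrow> spec_ext \<sigma> v v' \<Longrightarrow> spec_ext \<sigma> (w + v) (w' + v')"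
  by (simp add: spec_ext_def spec_add)

lemma spec_ext_mult:
  assumes "spec_ext \<sigma> w w'" "spec_ext \<sigma> v v'"
  shows "spec_ext \<sigma> (w * v) (w' * v')"
  unfolding spec_ext_def
proof
  fix C
  show "spec \<sigma> (coef (w * v) C) (coef (w' * v') C)"
    using assms by (cases "finite C")
      (auto simp: coef_mult coef_infinite spec_ext_def intro!: spec_sum spec_mult spec_shuffle_sign spec_0)
qed

lemma spec_ext_scal: "spec \<sigma> r r' \<Longrightarrow> spec_ext \<sigma> (scal r) (scal r')"
  by (simp add: spec_ext_def scal.rep_eq spec_0)

lemma spec_ext_gen: "spec_ext \<sigma> (gen i) (gen i)"
  by (simp add: spec_ext_def gen.rep_eq spec_0 spec_1)

lemma spec_ext_sum:
  "(\<And>i. i \<in> I \<Longrightarrow> spec_ext \<sigma> (f i) (g i)) \<Longrightarrow> spec_ext \<sigma> (sum f I) (sum g I)"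
  unfolding spec_ext_def coef_sum by (auto intro: spec_sum)

end

section \<open>Restriction to a hyperplane\<close>

text \<open>
  The hyperplane \<open>z\<^sub>m = 0\<close> is parametrized by eliminating \<open>x\<^sub>j\<close>, where \<open>c\<^sub>m\<^sub>j \<noteq> 0\<close>; the number of variables
  stays \<open>n\<close>, and the restricted forms do not involve \<open>x\<^sub>j\<close>.
\<close>

definition restrict_coeffs :: "(nat \<Rightarrow> nat \<Rightarrow> 'a::field) \<Rightarrow> nat \<Rightarrow> nat \<Rightarrow> nat \<Rightarrow> nat \<Rightarrow> 'a" where
  "restrict_coeffs c m j i l = c i l - c i j / c m j * c m l"

definition restrict_poly :: "(nat \<Rightarrow> nat \<Rightarrow> 'a::field) \<Rightarrow> nat \<Rightarrow> nat \<Rightarrow> nat \<Rightarrow> 'a mpoly \<Rightarrow> 'a mpoly" where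
  "restrict_poly c n m j = mpoly_eval mconst
    (\<lambda>l. mvar l - (if l = j then mconst (inverse (c m j)) * zform c n m else 0))"

lemma mconst_uminus: "mconst (- a) = - mconst a"
  by (simp add: mconst_def single_uminus)

lemma mconst_diff: "mconst (a - b) = mconst a - mconst b"
  by (simp add: mconst_def single_diff)

lemma restrict_poly_hom:
  "restrict_poly c n m j 0 = 0" "restrict_poly c n m j 1 = 1"
  "restrict_poly c n m j (p + q) = restrict_poly c n m j p + restrict_poly c n m j q"
  "restrict_poly c n m j (p * q) = restrict_poly c n m j p * restrict_poly c n m j q"
  by (simp_all add: restrict_poly_def mpoly_eval_0 mpoly_eval_1 mpoly_eval_add mpoly_eval_mult)

lemma restrict_poly_mconst: "restrict_poly c n m j (mconst a) = mconst a"
  by (simp add: restrict_poly_def mpoly_eval_mconst)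

lemma zform_restrict_coeffs:
  "zform (restrict_coeffs c m j) n i = zform c n i - mconst (c i j / c m j) * zform c n m"
  unfolding zform_def restrict_coeffs_def mconst_diff
  by (simp add: left_diff_distrib sum_subtractf sum_distrib_left times_divide_eq_left[symmetric]
    mult.assoc[symmetric] del: times_divide_eq_left)

lemma dzform_restrict_coeffs:
  "dzform (restrict_coeffs c m j) n i = dzform c n i - scal (mconst (c i j / c m j)) * dzform c n m"
  unfolding dzform_def restrict_coeffs_def mconst_diff scal_diff
  by (simp add: left_diff_distrib sum_subtractf sum_distrib_left scal_mult_assoc
    times_divide_eq_left[symmetric] del: times_divide_eq_left)

text \<open>Only the term \<open>l = j\<close> is affected by the substitution, and it loses exactly
  the multiple of z_m subtracted in \<open>restrict_coeffs\<close>. In particular z_m itself goes to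
  0.\<close>

lemma restrict_poly_zform:
  assumes "j \<in> {1..n}"
  shows "restrict_poly c n m j (zform c n i) = zform (restrict_coeffs c m j) n i"
proof -
  have "restrict_poly c n m j (zform c n i) = (\<Sum>l=1..n. mconst (c i l) * mvar l -
      (if l = j then mconst (c i j / c m j) * zform c n m else 0))"
    unfolding restrict_poly_def zform_def[of c n i]
    by (subst mpoly_eval_sum)
      (auto simp: mpoly_eval_mult mpoly_eval_mconst mpoly_eval_mvar algebra_simps
        divide_inverse intro!: sum.cong)
  also have "\<dots> = zform (restrict_coeffs c m j) n i"
    using assms by (simp add: sum_subtractf zform_restrict_coeffs zform_def[of c n i])
  finally show ?thesis .
qed

lemma emb_dzform: "emb (dzform c n i) = (\<Sum>j=1..n. scal (to_fract (mconst (c i j))) * gen j)"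
  by (simp add: dzform_def)

lemma emb_dzform_square: "emb (dzform c n i) * emb (dzform c n i) = 0"
  unfolding emb_dzform by (rule one_form_square)

lemma spec_ext_emb_dzform:
  "spec_ext (restrict_poly c n m j) (emb (dzform c n i)) (emb (dzform c n i))"
proof -
  note hom = restrict_poly_hom[of c n m j]
  have "spec (restrict_poly c n m j) (to_fract (mconst a)) (to_fract (mconst a))" for a
    using spec_to_fract[OF hom, of "mconst a"] by (simp add: restrict_poly_mconst)
  then show ?thesis
    unfolding emb_dzform by (intro spec_ext_sum spec_ext_mult spec_ext_scal spec_ext_gen hom)
qed

text \<open>
  Specialization leaves \<open>dz\<^sub>m\<close> alone, so it agrees with the map \<open>\<psi>\<close> of the restricted arrangement only
  modulo \<open>dz\<^sub>m\<close>.
\<close>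

lemma spec_ext_psi:
  fixes c :: "nat \<Rightarrow> nat \<Rightarrow> 'a::field"
  assumes j: "j \<in> {1..n}" and z: "\<And>i. i \<in> V \<Longrightarrow> zform (restrict_coeffs c m j) n i \<noteq> 0"
    and w: "w \<in> forms V"
  shows "\<exists>v. spec_ext (restrict_poly c n m j) (psi c n w) v \<and>
    v * emb (dzform c n m) = psi (restrict_coeffs c m j) n w * emb (dzform c n m)"
  using w
proof (induction rule: forms_induct)
  case (const a)
  have "spec_ext (restrict_poly c n m j) (scal (to_fract (mconst a))) (scal (to_fract (mconst a)))"
    using spec_to_fract[of "restrict_poly c n m j" "mconst a"]
    by (intro spec_ext_scal) (simp_all add: restrict_poly_hom restrict_poly_mconst)
  then show ?case by (auto simp: psi_scal_mconst)
next
  case (t i)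
  have "spec_ext (restrict_poly c n m j) (zinv c n i) (zinv (restrict_coeffs c m j) n i)"
    unfolding zinv_def restrict_poly_zform[OF j, symmetric] using z[OF t]
    by (intro spec_ext_scal spec_inverse) (simp_all add: restrict_poly_hom restrict_poly_zform[OF j])
  then show ?case by (auto simp: psi_t)
next
  case (u i)
  let ?c = "restrict_coeffs c m j"
  have 1: "spec_ext (restrict_poly c n m j) (zinv c n i) (zinv ?c n i)"
    unfolding zinv_def restrict_poly_zform[OF j, symmetric] using z[OF u]
    by (intro spec_ext_scal spec_inverse) (simp_all add: restrict_poly_hom restrict_poly_zform[OF j])
  have "spec_ext (restrict_poly c n m j) (dlog c n i) (zinv ?c n i * emb (dzform c n i))"
    unfolding dlog_def by (intro spec_ext_mult 1 spec_ext_emb_dzform) (simp_all add: restrict_poly_hom)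
  \<comment> \<open>The two differentials differ by a multiple of dz_m, which the factor dz_m on the
    right kills.\<close>
  moreover have "zinv ?c n i * emb (dzform c n i) * emb (dzform c n m) =
      dlog ?c n i * emb (dzform c n m)"
    unfolding dlog_def dzform_restrict_coeffs emb_simps emb_mult mult.assoc
    by (simp add: left_diff_distrib right_diff_distrib mult.assoc emb_dzform_square)
  ultimately show ?case by (auto simp: psi_u)
next
  case (add w1 w2)
  then obtain v1 v2 where
    "spec_ext (restrict_poly c n m j) (psi c n w1) v1"
    "v1 * emb (dzform c n m) = psi (restrict_coeffs c m j) n w1 * emb (dzform c n m)"
    "spec_ext (restrict_poly c n m j) (psi c n w2) v2"
    "v2 * emb (dzform c n m) = psi (restrict_coeffs c m j) n w2 * emb (dzform c n m)" by blast
  then show ?case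
    by (intro exI[of _ "v1 + v2"] conjI)
      (auto simp: psi_add distrib_right restrict_poly_hom intro: spec_ext_add)
next
  case (mult w1 w2)
  let ?c = "restrict_coeffs c m j" and ?y = "emb (dzform c n m)"
  from mult obtain v1 v2 where v:
    "spec_ext (restrict_poly c n m j) (psi c n w1) v1" "v1 * ?y = psi ?c n w1 * ?y"
    "spec_ext (restrict_poly c n m j) (psi c n w2) v2" "v2 * ?y = psi ?c n w2 * ?y" by blast
  have comm: "x * ?y = ?y * grade_inv x" for x
    unfolding emb_dzform by (rule mult_one_form_eq)
  \<comment> \<open>The hypothesis on \<open>v1\<close> needs dz_m directly to its right, so dz_m is
    moved across the second factor and, once \<open>v1\<close> is replaced, back again.\<close>
  have "v1 * v2 * ?y = v1 * ?y * grade_inv (psi ?c n w2)"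
    by (simp add: mult.assoc v(4) comm[of "psi ?c n w2"])
  also have "\<dots> = psi ?c n (w1 * w2) * ?y"
    unfolding v(2) psi_mult mult.assoc comm[of "psi ?c n w2"] ..
  finally show ?case
    using v by (intro exI[of _ "v1 * v2"] conjI)
      (auto simp: psi_mult restrict_poly_hom intro: spec_ext_mult)
qed

text \<open>The restricted forms have coefficient 0 at x_j, so dx_j never appears in their
  differentials.\<close>

lemma coef_psi_restrict_eq_0:
  fixes c :: "nat \<Rightarrow> nat \<Rightarrow> 'a::field"
  assumes cj: "c m j \<noteq> 0" and w: "w \<in> forms V" and "j \<in> A"
  shows "coef (psi (restrict_coeffs c m j) n w) A = 0"
  using w \<open>j \<in> A\<close>
proof (induction arbitrary: A rule: forms_induct)
  case (u i)
  have *: "to_fract (mconst (restrict_coeffs c m j i l)) * coef (gen l :: 'a mpoly fract extalg) A = 0" for l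
    using cj u by (cases "l = j") (auto simp: restrict_coeffs_def gen.rep_eq)
  show ?case
    by (simp add: psi_u dlog_def zinv_def emb_dzform coef_sum *)
next
  case (mult w v)
  show ?case
  proof (cases "finite A")
    case True
    have "coef (psi (restrict_coeffs c m j) n w) B = 0 \<or> coef (psi (restrict_coeffs c m j) n v) (A - B) = 0" for B
      using mult by (cases "j \<in> B") auto
    then show ?thesis unfolding psi_mult coef_mult[OF True] by (intro sum.neutral) auto
  qed (simp add: coef_infinite)
qed (auto simp: psi_add psi_scal_mconst psi_t zinv_def scal.rep_eq)

text \<open>Multiplication by dz_m is injective on forms free of dx_j, because dx_j has a non-zero
  coefficient in dz_m. This removes the ambiguity modulo dz_m left by
  \<open>spec_ext_psi\<close>.\<close>

lemma eq_0_if_mult_dzform_eq_0: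
  fixes v :: "'a::field mpoly fract extalg"
  assumes j: "j \<in> {1..n}" "c m j \<noteq> 0" and v: "\<And>A. j \<in> A \<Longrightarrow> coef v A = 0"
    and eq: "v * emb (dzform c n m) = 0"
  shows "v = 0"
proof (rule extalg_eqI)
  fix A
  show "coef v A = coef 0 A"
  proof (cases "finite A \<and> j \<notin> A")
    case True
    let ?B = "insert j A"
    have "0 = coef (v * emb (dzform c n m)) ?B" by (simp add: eq)
    also have "\<dots> = (\<Sum>l=1..n. to_fract (mconst (c m l)) * coef (v * gen l) ?B)"
      by (simp add: emb_dzform sum_distrib_left scal_left_commute[of v] coef_sum)
    \<comment> \<open>For \<open>l\<close> other than \<open>j\<close>, the coefficient of
      \<open>v\<close> is taken at a set still containing \<open>j\<close>, hence is 0.\<close>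
    also have "\<dots> = (\<Sum>l=1..n. if l = j then to_fract (mconst (c m j)) * (shuffle_sign A {j} * coef v A) else 0)"
      using True v by (intro sum.cong) (auto simp: coef_mult_gen)
    also have "\<dots> = to_fract (mconst (c m j)) * (shuffle_sign A {j} * coef v A)" using j by simp
    finally have "to_fract (mconst (c m j)) * (shuffle_sign A {j} * coef v A) = 0" ..
    moreover have "mconst (c m j) \<noteq> 0"
      using j(2) by (metis lookup_single_eq lookup_zero mconst_def)
    moreover have "shuffle_sign A {j} \<noteq> (0 :: 'a mpoly fract)"
      using shuffle_sign_cases[of A "{j}"] by (metis neg_equal_0_iff_equal zero_neq_one)
    ultimately show ?thesis by simp
  qed (use v in \<open>auto simp: coef_infinite\<close>)
qed

section \<open>Lifting relations from a hyperplane\<close>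

definition rel_ideal :: "(nat \<Rightarrow> nat \<Rightarrow> 'a::field) \<Rightarrow> nat \<Rightarrow> nat \<Rightarrow> 'a mpoly extalg set" where
  "rel_ideal c n m = ideal_span (forms {1..m}) {P_rel L S | L S. is_relation c n m L \<and> S \<subseteq> supp L}"

lemma forms_mono: "V \<subseteq> W \<Longrightarrow> forms V \<subseteq> forms W"
  unfolding forms_def mpolys_def by blast

lemma rel_ideal_mono: "m \<le> m' \<Longrightarrow> rel_ideal c n m \<subseteq> rel_ideal c n m'"
  unfolding rel_ideal_def
proof (intro ideal_span_mono forms_mono)
  assume "m \<le> m'"
  then have "is_relation c n m' L" if "is_relation c n m L" for L
    using that by (auto simp: is_relation_def)
  then show "{P_rel L S | L S. is_relation c n m L \<and> S \<subseteq> supp L} \<subseteq>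
      {P_rel L S | L S. is_relation c n m' L \<and> S \<subseteq> supp L}" by blast
qed auto

lemma rel_ideal_P:
  "is_relation c n m L \<Longrightarrow> S \<subseteq> supp L \<Longrightarrow> P_expl L S \<in> rel_ideal c n m"
proof -
  assume L: "is_relation c n m L" "S \<subseteq> supp L"
  then have fin: "finite (supp L)" unfolding is_relation_def using finite_subset by blast
  then show ?thesis
    unfolding P_rel_eq_P_expl[OF fin L(2), symmetric] rel_ideal_def using L by (intro ideal_span.incl) blast
qed

lemma rel_ideal_closed:
  "0 \<in> rel_ideal c n m"
  "x \<in> rel_ideal c n m \<Longrightarrow> y \<in> rel_ideal c n m \<Longrightarrow> x + y \<in> rel_ideal c n m"
  "a \<in> forms {1..m} \<Longrightarrow> x \<in> rel_ideal c n m \<Longrightarrow> a * x \<in> rel_ideal c n m"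
  "a \<in> forms {1..m} \<Longrightarrow> x \<in> rel_ideal c n m \<Longrightarrow> x * a \<in> rel_ideal c n m"
  by (auto simp: rel_ideal_def intro: ideal_span.intros)

lemma psi_rel_ideal:
  assumes z: "\<And>i. i \<in> {1..m} \<Longrightarrow> zform c n i \<noteq> 0" and "x \<in> rel_ideal c n m"
  shows "psi c n x = 0"
  using assms(2) unfolding rel_ideal_def
proof induction
  case (incl g)
  then show ?case using z by (auto simp: is_relation_def intro!: psi_P_rel)
qed (auto simp: psi_0 psi_add psi_mult)

lemma sorted_list_of_set_insert_max:
  fixes k :: nat
  assumes "finite S" "\<And>i. i \<in> S \<Longrightarrow> i < k"
  shows "sorted_list_of_set (insert k S) = sorted_list_of_set S @ [k]"
  using assms
  by (intro sorted_distinct_set_unique) (auto simp: sorted_append less_imp_le simp del: sorted_list_of_set_insert_remove)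

lemma replace_sum_snoc:
  "replace_sum U i (xs @ [k]) = replace_sum U i xs * U k + prod_list (map U xs) * U i"
  by (simp add: replace_sum_def sum_distrib_right list_update_append)

lemma prod_list_gen_forms: "set xs \<subseteq> V \<Longrightarrow> prod_list (map gen xs) \<in> forms V"
  by (induction xs) (auto intro: forms_closed forms_gen)

text \<open>Each summand contains u_k in the replaced position; moving it to the right end past the
  tail costs a grade involution. This isolates the u_k-part of a lifted relation.\<close>

lemma replace_sum_gen_forms:
  fixes V :: "nat set"
  assumes "set xs \<subseteq> V"
  shows "\<exists>r\<in>forms V. replace_sum gen k xs = (r * gen k :: 'a::comm_ring_1 mpoly extalg)"
proof -
  have "\<exists>r\<in>forms V. prod_list (map gen (xs[s := k])) = (r * gen k :: 'a mpoly extalg)" if "s < length xs" for s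
  proof -
    let ?l = "prod_list (map gen (take s xs))" and ?r = "prod_list (map gen (drop (Suc s) xs))"
    have "prod_list (map gen (xs[s := k])) = ?l * (gen k * ?r)"
      using that by (simp add: upd_conv_take_nth_drop)
    also have "\<dots> = ?l * grade_inv ?r * gen k" by (simp add: gen_mult_eq mult.assoc)
    finally show ?thesis
      using assms set_take_subset[of s xs] set_drop_subset[of "Suc s" xs]
      by (intro bexI[of _ "?l * grade_inv ?r"] forms_closed grade_inv_forms prod_list_gen_forms) auto
  qed
  then have "\<forall>s\<in>{..<length xs}. \<exists>r. r \<in> forms V \<and> prod_list (map gen (xs[s := k])) =
      (r * gen k :: 'a mpoly extalg)" by blast
  from bchoice[OF this] obtain r where r: "\<And>s. s < length xs \<Longrightarrow> r s \<in> forms V"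
    and r': "\<And>s. s < length xs \<Longrightarrow> prod_list (map gen (xs[s := k])) = (r s * gen k :: 'a mpoly extalg)" by auto
  show ?thesis
    unfolding replace_sum_def using r r'
    by (intro bexI[where x = "\<Sum>s<length xs. r s"] forms_sum) (auto simp: sum_distrib_right)
qed

lemma oprod_gen_forms: "finite A \<Longrightarrow> A \<subseteq> V \<Longrightarrow> oprod gen A \<in> forms V"
  unfolding oprod_def by (rule prod_list_gen_forms) simp

text \<open>If \<open>k\<close> stays outside \<open>S\<close>, every old summand gains the factor
  t_k and one new summand \<open>i = k\<close> appears. If \<open>k\<close> joins \<open>S\<close>,
  the range of summation is unchanged, u_k is appended, and replacing it by u_i gives terms free of
  u_k. As \<open>k\<close> exceeds all of \<open>supp L\<close>, it comes last in the sorted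
  list.\<close>

lemma P_expl_upd:
  fixes L :: "nat \<Rightarrow> 'a::field"
  assumes "supp L \<subseteq> {..<k}" "b \<noteq> 0" "S \<subseteq> supp L"
  shows "P_expl (L(k := b)) S = scal (mvar k) * P_expl L S + scal (mconst b * (\<Prod>q\<in>supp L - S. mvar q)) *
      (oprod gen S - replace_sum gen k (sorted_list_of_set S))"
    and "P_expl (L(k := b)) (insert k S) = P_expl L S * gen k -
      (\<Sum>i\<in>supp L - S. scal (mconst (L i) * (\<Prod>q\<in>supp L - S - {i}. mvar q)) * (oprod gen S * gen i))"
proof -
  have fin: "finite (supp L)" using assms(1) finite_subset by blast
  then have finS: "finite S" using assms(3) finite_subset by blast
  have k: "k \<notin> supp L" "k \<notin> S" using assms by auto
  have supp: "supp (L(k := b)) = insert k (supp L)" using assms(2) by (auto simp: supp_def)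
  have supp1: "insert k (supp L) - S = insert k (supp L - S)" using k by auto
  have 1: "insert k (supp L - S) - {k} = supp L - S" using k by auto
  have 2: "(\<Prod>q\<in>insert k (supp L - S) - {i}. mvar q) = mvar k * (\<Prod>q\<in>supp L - S - {i}. (mvar q :: 'a mpoly))"
    if "i \<in> supp L - S" for i
  proof -
    have "insert k (supp L - S) - {i} = insert k (supp L - S - {i})" using that k by auto
    then show ?thesis using fin k by simp
  qed
  have Lk: "(L(k := b)) i = L i" if "i \<in> supp L - S" for i using that k by auto
  show "P_expl (L(k := b)) S = scal (mvar k) * P_expl L S + scal (mconst b * (\<Prod>q\<in>supp L - S. mvar q)) *
      (oprod gen S - replace_sum gen k (sorted_list_of_set S))"
    unfolding P_expl_def supp supp1 using fin k
    by (subst sum.insert)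
      (auto simp: 1 2 Lk sum_distrib_left scal_mult_assoc add.commute mult.left_commute intro!: sum.cong)
  have supp2: "insert k (supp L) - insert k S = supp L - S" using k by auto
  have sl: "sorted_list_of_set (insert k S) = sorted_list_of_set S @ [k]"
    using assms finS by (intro sorted_list_of_set_insert_max) auto
  show "P_expl (L(k := b)) (insert k S) = P_expl L S * gen k -
      (\<Sum>i\<in>supp L - S. scal (mconst (L i) * (\<Prod>q\<in>supp L - S - {i}. mvar q)) * (oprod gen S * gen i))"
    unfolding P_expl_def supp supp2 sl replace_sum_snoc oprod_def sum_distrib_right sum_subtractf[symmetric]
  proof (rule sum.cong[OF refl])
    fix i assume "i \<in> supp L - S"
    note Lk = Lk[OF this]
    show "scal (mconst ((L(k := b)) i) * (\<Prod>q\<in>supp L - S - {i}. mvar q)) *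
        (prod_list (map gen (sorted_list_of_set S @ [k])) -
          (replace_sum gen i (sorted_list_of_set S) * gen k + prod_list (map gen (sorted_list_of_set S)) * gen i)) =
      scal (mconst (L i) * (\<Prod>q\<in>supp L - S - {i}. mvar q)) *
        (prod_list (map gen (sorted_list_of_set S)) - replace_sum gen i (sorted_list_of_set S)) * gen k -
      scal (mconst (L i) * (\<Prod>q\<in>supp L - S - {i}. mvar q)) *
        (prod_list (map gen (sorted_list_of_set S)) * gen i)"
      unfolding Lk by (simp add: algebra_simps)
  qed
qed

text \<open>The restricted forms differ from the z_i by multiples of the last form, so the relation
  says that the corresponding combination of the z_i is a multiple of that form; \<open>b\<close> is
  minus this multiple.\<close>

lemma is_relation_lift:
  assumes L: "is_relation (restrict_coeffs c (Suc m) j) n m L"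
  defines "b \<equiv> - (\<Sum>i\<in>supp L. L i * (c i j / c (Suc m) j))"
  shows "is_relation c n (Suc m) (L(Suc m := b))"
proof -
  have sub: "supp L \<subseteq> {1..m}" and ne: "supp L \<noteq> {}" using L by (auto simp: is_relation_def)
  have fin: "finite (supp L)" using sub finite_subset by blast
  have M: "Suc m \<notin> supp L" using sub by auto
  have "0 = (\<Sum>i\<in>supp L. mconst (L i) * zform c n i) + mconst b * zform c n (Suc m)"
    using L unfolding is_relation_def zform_restrict_coeffs b_def mconst_uminus mconst_sum
    by (simp add: right_diff_distrib sum_subtractf sum_distrib_right mult.assoc del: times_divide_eq_right)
  also have "\<dots> = (\<Sum>i\<in>insert (Suc m) (supp L). mconst ((L(Suc m := b)) i) * zform c n i)"
    using fin M by (subst sum.insert) (auto simp: add.commute intro!: sum.cong)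
  \<comment> \<open>\<open>b\<close> may be 0; then \<open>Suc m\<close> leaves the support, but its
    term was 0 as well.\<close>
  also have "\<dots> = (\<Sum>i\<in>supp (L(Suc m := b)). mconst ((L(Suc m := b)) i) * zform c n i)"
    using fin by (intro sum.mono_neutral_right) (auto simp: supp_def)
  finally have eq: "(\<Sum>i\<in>supp (L(Suc m := b)). mconst ((L(Suc m := b)) i) * zform c n i) = 0" ..
  obtain i where "i \<in> supp L" using ne by blast
  then have "i \<in> supp (L(Suc m := b))" using M by (auto simp: supp_def)
  moreover have "supp (L(Suc m := b)) \<subseteq> {1..Suc m}"
    using sub by (auto simp: supp_def split: if_splits)
  ultimately show ?thesis unfolding is_relation_def using eq by blast
qed

lemma P_expl_lift_cases:
  assumes L: "is_relation (restrict_coeffs c (Suc m) j) n m L" and S: "S \<subseteq> supp L"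
  obtains "P_expl L S \<in> rel_ideal c n (Suc m)"
  | b where "b \<noteq> 0" "P_expl (L(Suc m := b)) S \<in> rel_ideal c n (Suc m)"
    "P_expl (L(Suc m := b)) (insert (Suc m) S) \<in> rel_ideal c n (Suc m)"
proof -
  define b where "b = - (\<Sum>i\<in>supp L. L i * (c i j / c (Suc m) j))"
  have rel: "is_relation c n (Suc m) (L(Suc m := b))"
    unfolding b_def by (rule is_relation_lift[OF L])
  have "supp L \<subseteq> {1..m}" using L by (simp add: is_relation_def)
  then have M: "Suc m \<notin> supp L" by auto
  show thesis
  proof (cases "b = 0")
    case True
    then have "L(Suc m := b) = L" using M by (auto simp: supp_def)
    then show thesis using rel_ideal_P[of c n "Suc m" L S] rel S that(1) by simp
  next
    case False
    have "S \<subseteq> supp (L(Suc m := b))" "insert (Suc m) S \<subseteq> supp (L(Suc m := b))"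
      using S M False by (auto simp: supp_def)
    then show thesis using rel_ideal_P[OF rel] False by (intro that(2)) auto
  qed
qed

lemma forms_Suc: "w \<in> forms {1..m} \<Longrightarrow> w \<in> forms {1..Suc m}"
  using forms_mono[of "{1..m}" "{1..Suc m}"] by auto

lemma prod_mvar_forms: "A \<subseteq> V \<Longrightarrow> scal (mconst a * (\<Prod>q\<in>A. mvar q)) \<in> forms V"
  by (auto intro!: mpolys_closed(3,5,7) mpolys_prod)

text \<open>On generators this is the first part of \<open>P_expl_upd\<close>, or membership in the
  ideal if the lift has \<open>b = 0\<close>. Multiplication by forms in the first \<open>m\<close>
  generators preserves the shape, since the last t is central and the last u passes them up to
  \<open>grade_inv\<close>.\<close>

lemma reduce_t:
  assumes "g \<in> rel_ideal (restrict_coeffs c (Suc m) j) n m"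
  shows "\<exists>g'\<in>forms {1..m}. \<exists>h'\<in>forms {1..m}.
    scal (mvar (Suc m)) * g - g' - h' * gen (Suc m) \<in> rel_ideal c n (Suc m)"
  using assms unfolding rel_ideal_def[of "restrict_coeffs c (Suc m) j"]
proof induction
  case zero
  show ?case by (intro bexI[of _ 0]) (simp_all add: rel_ideal_closed forms_closed)
next
  case (incl g)
  then obtain L S where g: "g = P_rel L S"
    and L: "is_relation (restrict_coeffs c (Suc m) j) n m L" and S: "S \<subseteq> supp L" by blast
  have sub: "supp L \<subseteq> {1..m}" using L by (simp add: is_relation_def)
  have fin: "finite (supp L)" "finite S"
    using finite_subset[OF sub] finite_subset[OF S] by simp_all
  from L S show ?case
  proof (cases rule: P_expl_lift_cases)
    case 1
    then have "scal (mvar (Suc m)) * P_expl L S \<in> rel_ideal c n (Suc m)"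
      by (intro rel_ideal_closed) (auto intro: mpolys_closed)
    then show ?thesis
      by (intro bexI[of _ 0]) (simp_all add: g P_rel_eq_P_expl fin S forms_closed)
  next
    case (2 b)
    obtain r where r: "r \<in> forms {1..m}"
      "replace_sum gen (Suc m) (sorted_list_of_set S) = r * (gen (Suc m) :: 'a mpoly extalg)"
      using replace_sum_gen_forms[of "sorted_list_of_set S" "{1..m}" "Suc m"] fin S sub
      by auto
    let ?s = "scal (mconst b * (\<Prod>q\<in>supp L - S. mvar q))"
    have s: "?s \<in> forms {1..m}" using sub by (intro prod_mvar_forms) auto
    have "supp L \<subseteq> {..<Suc m}" using sub by auto
    \<comment> \<open>The new summand \<open>i = Suc m\<close> supplies both corrections: its u_S
      part gives \<open>g'\<close>, its replacement sum gives \<open>h'\<close>.\<close>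
    then have "P_expl (L(Suc m := b)) S = scal (mvar (Suc m)) * g -
        - (?s * oprod gen S) - ?s * r * gen (Suc m)"
      using P_expl_upd(1)[OF _ 2(1) S] by (simp add: g P_rel_eq_P_expl fin S r right_diff_distrib mult.assoc)
    moreover have "oprod gen S \<in> forms {1..m}" using S sub fin by (intro oprod_gen_forms) auto
    ultimately show ?thesis using 2(2) s r(1)
      by (intro bexI[of _ "- (?s * oprod gen S)"] bexI[of _ "?s * r"] forms_closed) simp_all
  qed
next
  case (add x y)
  then obtain g1 h1 g2 h2 where *: "g1 \<in> forms {1..m}" "h1 \<in> forms {1..m}" "g2 \<in> forms {1..m}" "h2 \<in> forms {1..m}"
    "scal (mvar (Suc m)) * x - g1 - h1 * gen (Suc m) \<in> rel_ideal c n (Suc m)"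
    "scal (mvar (Suc m)) * y - g2 - h2 * gen (Suc m) \<in> rel_ideal c n (Suc m)" by blast
  have mem: "scal (mvar (Suc m)) * (x + y) - (g1 + g2) - (h1 + h2) * gen (Suc m) \<in> rel_ideal c n (Suc m)"
    using rel_ideal_closed(2)[OF *(5,6)] by (simp add: algebra_simps)
  show ?case
    by (rule bexI[of _ "g1 + g2"], rule bexI[of _ "h1 + h2"]) (use mem * in \<open>simp_all add: forms_closed\<close>)
next
  case (mult_left a x)
  then obtain g1 h1 where *: "g1 \<in> forms {1..m}" "h1 \<in> forms {1..m}"
    "scal (mvar (Suc m)) * x - g1 - h1 * gen (Suc m) \<in> rel_ideal c n (Suc m)" by blast
  have mem: "scal (mvar (Suc m)) * (a * x) - a * g1 - a * h1 * gen (Suc m) \<in> rel_ideal c n (Suc m)"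
    using rel_ideal_closed(3)[OF forms_Suc[OF mult_left(1)] *(3)]
    by (simp add: right_diff_distrib mult.assoc scal_left_commute[of a])
  show ?case
    by (rule bexI[of _ "a * g1"], rule bexI[of _ "a * h1"])
      (use mem * mult_left(1) in \<open>simp_all add: forms_closed\<close>)
next
  case (mult_right a x)
  then obtain g1 h1 where *: "g1 \<in> forms {1..m}" "h1 \<in> forms {1..m}"
    "scal (mvar (Suc m)) * x - g1 - h1 * gen (Suc m) \<in> rel_ideal c n (Suc m)" by blast
  have mem: "scal (mvar (Suc m)) * (x * a) - g1 * a - h1 * grade_inv a * gen (Suc m) \<in> rel_ideal c n (Suc m)"
    using rel_ideal_closed(4)[OF forms_Suc[OF mult_right(1)] *(3)]
    by (simp add: left_diff_distrib mult.assoc gen_mult_eq)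
  show ?case
    by (rule bexI[of _ "g1 * a"], rule bexI[of _ "h1 * grade_inv a"])
      (use mem * mult_right(1) in \<open>simp_all add: forms_closed grade_inv_forms\<close>)
qed

text \<open>Here the lift with \<open>Suc m\<close> added to \<open>S\<close> is used; its error
  terms involve neither the last t nor the last u.\<close>

lemma reduce_u:
  assumes "h \<in> rel_ideal (restrict_coeffs c (Suc m) j) n m"
  shows "\<exists>g'\<in>forms {1..m}. h * gen (Suc m) - g' \<in> rel_ideal c n (Suc m)"
  using assms unfolding rel_ideal_def[of "restrict_coeffs c (Suc m) j"]
proof induction
  case zero
  show ?case by (intro bexI[of _ 0]) (simp_all add: rel_ideal_closed forms_closed)
next
  case (incl g)
  then obtain L S where g: "g = P_rel L S"
    and L: "is_relation (restrict_coeffs c (Suc m) j) n m L" and S: "S \<subseteq> supp L" by blast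
  have sub: "supp L \<subseteq> {1..m}" using L by (simp add: is_relation_def)
  have fin: "finite (supp L)" "finite S"
    using finite_subset[OF sub] finite_subset[OF S] by simp_all
  from L S show ?case
  proof (cases rule: P_expl_lift_cases)
    case 1
    then have "P_expl L S * gen (Suc m) \<in> rel_ideal c n (Suc m)"
      by (intro rel_ideal_closed) (auto intro: forms_gen)
    then show ?thesis
      by (intro bexI[of _ 0]) (simp_all add: g P_rel_eq_P_expl fin S forms_closed)
  next
    case (2 b)
    let ?r = "\<Sum>i\<in>supp L - S. scal (mconst (L i) * (\<Prod>q\<in>supp L - S - {i}. mvar q)) * (oprod gen S * gen i)"
    have "?r \<in> forms {1..m}"
      using S sub fin by (intro forms_sum forms_closed oprod_gen_forms prod_mvar_forms forms_gen) auto
    moreover have "supp L \<subseteq> {..<Suc m}" using sub by auto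
    then have "P_expl (L(Suc m := b)) (insert (Suc m) S) = g * gen (Suc m) - ?r"
      using P_expl_upd(2)[OF _ 2(1) S] by (simp add: g P_rel_eq_P_expl fin S)
    ultimately show ?thesis using 2(3) by (metis (no_types, lifting))
  qed
next
  case (add x y)
  then obtain g1 g2 where *: "g1 \<in> forms {1..m}" "g2 \<in> forms {1..m}"
    "x * gen (Suc m) - g1 \<in> rel_ideal c n (Suc m)"
    "y * gen (Suc m) - g2 \<in> rel_ideal c n (Suc m)" by blast
  have mem: "(x + y) * gen (Suc m) - (g1 + g2) \<in> rel_ideal c n (Suc m)"
    using rel_ideal_closed(2)[OF *(3,4)] by (simp add: algebra_simps)
  show ?case
    by (rule bexI[of _ "g1 + g2"]) (use mem * in \<open>simp_all add: forms_closed\<close>)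
next
  case (mult_left a x)
  then obtain g1 where *: "g1 \<in> forms {1..m}" "x * gen (Suc m) - g1 \<in> rel_ideal c n (Suc m)" by blast
  have mem: "a * x * gen (Suc m) - a * g1 \<in> rel_ideal c n (Suc m)"
    using rel_ideal_closed(3)[OF forms_Suc[OF mult_left(1)] *(2)]
    by (simp add: right_diff_distrib mult.assoc)
  show ?case
    by (rule bexI[of _ "a * g1"]) (use mem * mult_left(1) in \<open>simp_all add: forms_closed\<close>)
next
  case (mult_right a x)
  then obtain g1 where *: "g1 \<in> forms {1..m}" "x * gen (Suc m) - g1 \<in> rel_ideal c n (Suc m)" by blast
  have mem: "x * a * gen (Suc m) - g1 * grade_inv a \<in> rel_ideal c n (Suc m)"
    using rel_ideal_closed(4)[OF forms_Suc[OF grade_inv_forms[OF mult_right(1)]] *(2)]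
    by (simp add: left_diff_distrib mult.assoc gen_mult_eq)
  show ?case
    by (rule bexI[of _ "g1 * grade_inv a"])
      (use mem * mult_right(1) in \<open>simp_all add: forms_closed grade_inv_forms\<close>)
qed

section \<open>Forms proportional to another one\<close>

text \<open>For the relation with coefficients 1 at \<open>i\<close> and \<open>- l\<close> at
  \<open>Suc m\<close>, the choices of \<open>S\<close> empty and \<open>S = {i}\<close> give the
  last t as \<open>l\<close> times t_i and the last u as u_i modulo the ideal.\<close>

lemma reduce_parallel:
  fixes c :: "nat \<Rightarrow> nat \<Rightarrow> 'a::field"
  assumes i: "i \<in> {1..m}" and l: "l \<noteq> 0" and z: "zform c n i = mconst l * zform c n (Suc m)"
    and w: "w \<in> forms {1..Suc m}"
  shows "\<exists>w'\<in>forms {1..m}. w - w' \<in> rel_ideal c n (Suc m)"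
proof -
  define L where "L = (\<lambda>k. if k = i then 1 else if k = Suc m then - l else 0)"
  have im: "i \<noteq> Suc m" using i by auto
  have supp: "supp L = {i, Suc m}" using l by (auto simp: supp_def L_def)
  have rel: "is_relation c n (Suc m) L"
    using i im z by (simp add: is_relation_def supp) (simp add: L_def mconst_uminus)
  have mi: "{i, Suc m} - {Suc m} = {i}" using im by auto
  have "P_expl L {} = scal (mvar (Suc m)) - scal (mconst l * mvar i)"
    using im mi by (simp add: P_expl_def supp replace_sum_def)
      (simp add: L_def mconst_uminus scal_uminus)
  then have t_rel: "scal (mvar (Suc m)) - scal (mconst l * mvar i) \<in> rel_ideal c n (Suc m)"
    using rel_ideal_P[OF rel, of "{}"] by simp
  have P: "P_expl L {i} = scal (mconst l) * (gen (Suc m) - gen i)"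
    using im mi by (simp add: P_expl_def supp replace_sum_def)
      (simp add: L_def mconst_uminus scal_uminus right_diff_distrib)
  have "P_expl L {i} \<in> rel_ideal c n (Suc m)"
    using supp by (intro rel_ideal_P[OF rel]) simp
  then have "scal (mconst (inverse l)) * P_expl L {i} \<in> rel_ideal c n (Suc m)"
    by (intro rel_ideal_closed) (simp_all add: mpolys_closed)
  moreover have "scal (mconst (inverse l)) * P_expl L {i} = gen (Suc m) - gen i"
    unfolding P scal_mult_assoc mconst_simps(4)[symmetric] using l by simp
  ultimately have u_rel: "gen (Suc m) - gen i \<in> rel_ideal c n (Suc m)" by simp
  \<comment> \<open>Membership of \<open>w\<close> is carried along because the product case
    multiplies an element of the ideal by \<open>v\<close>.\<close>
  have "w \<in> forms {1..Suc m} \<and> (\<exists>w'\<in>forms {1..m}. w - w' \<in> rel_ideal c n (Suc m))"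
    using w
  proof (induction rule: forms_induct)
    case (const a)
    then show ?case
      by (auto simp: mpolys_closed rel_ideal_closed intro!: bexI[of _ "scal (mconst a)"])
  next
    case (t k)
    show ?case
    proof (cases "k = Suc m")
      case True
      then show ?thesis using t_rel t i
        by (auto intro!: bexI[of _ "scal (mconst l * mvar i)"] mpolys_closed)
    next
      case False
      then show ?thesis using t
        by (auto simp: rel_ideal_closed intro!: bexI[of _ "scal (mvar k)"] mpolys_closed)
    qed
  next
    case (u k)
    show ?case
    proof (cases "k = Suc m")
      case True
      then show ?thesis using u_rel u i
        by (auto intro!: bexI[of _ "gen i"] forms_gen)
    next
      case False
      then show ?thesis using u
        by (auto simp: rel_ideal_closed intro!: bexI[of _ "gen k"] forms_gen)
    qed
  next
    case (add w v)
    then obtain w' v' where *: "w' \<in> forms {1..m}" "w - w' \<in> rel_ideal c n (Suc m)"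
      "v' \<in> forms {1..m}" "v - v' \<in> rel_ideal c n (Suc m)" by blast
    have mem: "w + v - (w' + v') \<in> rel_ideal c n (Suc m)"
      using rel_ideal_closed(2)[OF *(2,4)] by (simp add: algebra_simps)
    show ?case
      using add by (intro conjI bexI[of _ "w' + v'"]) (use mem * in \<open>simp_all add: forms_closed\<close>)
  next
    case (mult w v)
    then obtain w' v' where *: "w' \<in> forms {1..m}" "w - w' \<in> rel_ideal c n (Suc m)"
      "v' \<in> forms {1..m}" "v - v' \<in> rel_ideal c n (Suc m)" by blast
    have "(w - w') * v \<in> rel_ideal c n (Suc m)" "w' * (v - v') \<in> rel_ideal c n (Suc m)"
      using * mult by (simp_all add: rel_ideal_closed(3)[OF forms_Suc] rel_ideal_closed(4))
    then have mem: "w * v - w' * v' \<in> rel_ideal c n (Suc m)"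
      using rel_ideal_closed(2)[of "(w - w') * v" c n "Suc m" "w' * (v - v')"] by (simp add: algebra_simps)
    show ?case
      using mult by (intro conjI bexI[of _ "w' * v'"]) (use mem * in \<open>simp_all add: forms_closed\<close>)
  qed
  then show ?thesis by blast
qed

section \<open>The pole filtration\<close>

text \<open>The last u counts as a pole of order one, like the last t, since \<psi> sends it to a
  logarithmic differential. Hence t^K u sits in the same layer as t^(K+1).\<close>

primrec pole_filtration :: "nat \<Rightarrow> nat \<Rightarrow> 'a::comm_ring_1 mpoly extalg set" where
  "pole_filtration m 0 = forms {1..m}"
| "pole_filtration m (Suc K) =
    {scal (mvar (Suc m) ^ Suc K) * g + scal (mvar (Suc m) ^ K) * h * gen (Suc m) + w | g h w.
      g \<in> forms {1..m} \<and> h \<in> forms {1..m} \<and> w \<in> pole_filtration m K}"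

lemma pole_filtration_SucI:
  assumes "g \<in> forms {1..m}" "h \<in> forms {1..m}" "w \<in> pole_filtration m K"
  shows "scal (mvar (Suc m) ^ Suc K) * g + scal (mvar (Suc m) ^ K) * h * gen (Suc m) + w \<in>
    pole_filtration m (Suc K)"
  unfolding pole_filtration.simps using assms by blast

lemma pole_filtration_SucE:
  assumes "w \<in> pole_filtration m (Suc K)"
  obtains g h v where "g \<in> forms {1..m}" "h \<in> forms {1..m}" "v \<in> pole_filtration m K"
    "w = scal (mvar (Suc m) ^ Suc K) * g + scal (mvar (Suc m) ^ K) * h * gen (Suc m) + v"
  using assms unfolding pole_filtration.simps by blast

lemma pole_filtration_Suc: "w \<in> pole_filtration m K \<Longrightarrow> w \<in> pole_filtration m (Suc K)"
  using pole_filtration_SucI[OF forms_closed(1) forms_closed(1)] by fastforce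

lemma pole_filtration_mono: "K \<le> K' \<Longrightarrow> w \<in> pole_filtration m K \<Longrightarrow> w \<in> pole_filtration m K'"
  by (induction K' rule: dec_induct) (auto intro: pole_filtration_Suc simp del: pole_filtration.simps)

lemma pole_filtration_add:
  "w \<in> pole_filtration m K \<Longrightarrow> v \<in> pole_filtration m K \<Longrightarrow> w + v \<in> pole_filtration m K"
proof (induction K arbitrary: w v)
  case (Suc K)
  obtain g1 h1 w' where 1: "g1 \<in> forms {1..m}" "h1 \<in> forms {1..m}" "w' \<in> pole_filtration m K"
    "w = scal (mvar (Suc m) ^ Suc K) * g1 + scal (mvar (Suc m) ^ K) * h1 * gen (Suc m) + w'"
    using Suc.prems(1) by (rule pole_filtration_SucE)
  obtain g2 h2 v' where 2: "g2 \<in> forms {1..m}" "h2 \<in> forms {1..m}" "v' \<in> pole_filtration m K"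
    "v = scal (mvar (Suc m) ^ Suc K) * g2 + scal (mvar (Suc m) ^ K) * h2 * gen (Suc m) + v'"
    using Suc.prems(2) by (rule pole_filtration_SucE)
  have "w + v = scal (mvar (Suc m) ^ Suc K) * (g1 + g2) +
      scal (mvar (Suc m) ^ K) * (h1 + h2) * gen (Suc m) + (w' + v')"
    unfolding 1(4) 2(4) distrib_left distrib_right by (simp only: ac_simps)
  then show ?case
    using pole_filtration_SucI[OF forms_closed(3) forms_closed(3) Suc.IH] 1 2 by metis
qed (simp add: forms_closed)

lemma pole_filtration_mult_left:
  assumes a: "a \<in> forms {1..m}"
  shows "w \<in> pole_filtration m K \<Longrightarrow> a * w \<in> pole_filtration m K"
proof (induction K arbitrary: w)
  case (Suc K)
  obtain g h v where 1: "g \<in> forms {1..m}" "h \<in> forms {1..m}" "v \<in> pole_filtration m K"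
    "w = scal (mvar (Suc m) ^ Suc K) * g + scal (mvar (Suc m) ^ K) * h * gen (Suc m) + v"
    using Suc.prems(1) by (rule pole_filtration_SucE)
  have "a * w = scal (mvar (Suc m) ^ Suc K) * (a * g) +
      scal (mvar (Suc m) ^ K) * (a * h) * gen (Suc m) + a * v"
    unfolding 1(4) distrib_left by (simp only: mult.assoc scal_left_commute[of a])
  then show ?case
    using pole_filtration_SucI[OF forms_closed(4) forms_closed(4) Suc.IH] 1 a by metis
qed (use a in \<open>simp add: forms_closed\<close>)

lemma pole_filtration_t:
  "w \<in> pole_filtration m K \<Longrightarrow> scal (mvar (Suc m)) * w \<in> pole_filtration m (Suc K)"
proof (induction K arbitrary: w)
  case 0
  then show ?case
    using pole_filtration_SucI[of w m 0 0 0] by (simp add: forms_closed del: pole_filtration.simps(2))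
next
  case (Suc K)
  obtain g h v where 1: "g \<in> forms {1..m}" "h \<in> forms {1..m}" "v \<in> pole_filtration m K"
    "w = scal (mvar (Suc m) ^ Suc K) * g + scal (mvar (Suc m) ^ K) * h * gen (Suc m) + v"
    using Suc.prems(1) by (rule pole_filtration_SucE)
  have "scal (mvar (Suc m)) * w = scal (mvar (Suc m) ^ Suc (Suc K)) * g +
      scal (mvar (Suc m) ^ Suc K) * h * gen (Suc m) + scal (mvar (Suc m)) * v"
    unfolding 1(4) distrib_left by (simp add: mult.assoc scal_mult_assoc)
  then show ?case
    using pole_filtration_SucI[OF 1(1,2) Suc.IH[OF 1(3)]] by metis
qed

text \<open>The u-part of each layer is killed by u^2 = 0, and the other part becomes the u-part of
  the next layer.\<close>

lemma pole_filtration_u: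
  "w \<in> pole_filtration m K \<Longrightarrow> gen (Suc m) * w \<in> pole_filtration m (Suc K)"
proof (induction K arbitrary: w)
  case 0
  then show ?case
    using pole_filtration_SucI[of 0 m "grade_inv w" 0 0]
    by (simp add: forms_closed grade_inv_forms gen_mult_eq del: pole_filtration.simps(2))
next
  case (Suc K)
  obtain g h v where 1: "g \<in> forms {1..m}" "h \<in> forms {1..m}" "v \<in> pole_filtration m K"
    "w = scal (mvar (Suc m) ^ Suc K) * g + scal (mvar (Suc m) ^ K) * h * gen (Suc m) + v"
    using Suc.prems(1) by (rule pole_filtration_SucE)
  have "gen (Suc m) * (h * gen (Suc m)) = grade_inv h * (gen (Suc m) * gen (Suc m))"
    by (simp add: gen_mult_eq[of _ h] mult.assoc[symmetric])
  then have "gen (Suc m) * w = scal (mvar (Suc m) ^ Suc (Suc K)) * 0 +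
      scal (mvar (Suc m) ^ Suc K) * grade_inv g * gen (Suc m) + gen (Suc m) * v"
    unfolding 1(4) distrib_left mult.assoc scal_left_commute[of "gen _"]
    by (simp add: gen_square gen_mult_eq[of _ g] mult.assoc)
  then show ?case
    using pole_filtration_SucI[OF forms_closed(1) grade_inv_forms[OF 1(1)] Suc.IH[OF 1(3)]] by metis
qed

lemma pole_filtration_exhaust:
  assumes "w \<in> forms {1..Suc m}"
  shows "\<exists>K. w \<in> pole_filtration m K"
proof -
  \<comment> \<open>Stated for left multiplication on any layer, so that a product acts by composing
    two such multiplications.\<close>
  have "\<exists>K'. w * v \<in> pole_filtration m K'" if "v \<in> pole_filtration m K" for v K
    using assms that
  proof (induction arbitrary: v K rule: forms_induct)
    case (const a)
    have "scal (mconst a) \<in> forms {1..m}" by (simp add: mpolys_closed)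
    then show ?case using pole_filtration_mult_left const by blast
  next
    case (t i)
    show ?case
    proof (cases "i = Suc m")
      case True
      then show ?thesis using pole_filtration_t t by blast
    next
      case False
      then have "scal (mvar i) \<in> forms {1..m}" using t by (simp add: mpolys_closed)
      then show ?thesis using pole_filtration_mult_left t by blast
    qed
  next
    case (u i)
    show ?case
    proof (cases "i = Suc m")
      case True
      then show ?thesis using pole_filtration_u u by blast
    next
      case False
      then have "gen i \<in> forms {1..m}" using u by (intro forms_gen) simp
      then show ?thesis using pole_filtration_mult_left u by blast
    qed
  next
    case (add w1 w2)
    then obtain K1 K2 where "w1 * v \<in> pole_filtration m K1" "w2 * v \<in> pole_filtration m K2" by blast
    then have "w1 * v \<in> pole_filtration m (max K1 K2)" "w2 * v \<in> pole_filtration m (max K1 K2)"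
      using pole_filtration_mono max.cobounded1 max.cobounded2 by blast+
    then show ?case unfolding distrib_right using pole_filtration_add by blast
  next
    case (mult w1 w2)
    then show ?case unfolding mult.assoc by blast
  qed
  moreover have "1 \<in> pole_filtration m 0" by (simp add: forms_closed)
  ultimately show ?thesis by (metis mult.right_neutral)
qed

section \<open>Leading coefficients along the hyperplane\<close>

lemma psi_scal_mvar_power:
  "psi c n (scal (mvar i ^ k)) = scal (inverse (to_fract (zform c n i)) ^ k)"
  by (induction k) (simp_all add: scal_mult psi_mult psi_t zinv_def psi_1)

text \<open>Clearing the pole leaves the top layer as \<psi>(g) + \<psi>(h) dz, while the lower
  layers keep a spare factor z that vanishes on the hyperplane.\<close>

lemma psi_pole_step:
  assumes "zform c n (Suc m) \<noteq> 0"
  shows "scal (to_fract (zform c n (Suc m)) ^ Suc K) *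
      psi c n (scal (mvar (Suc m) ^ Suc K) * g + scal (mvar (Suc m) ^ K) * h * gen (Suc m) + w) =
    psi c n g + psi c n h * emb (dzform c n (Suc m)) +
    scal (to_fract (zform c n (Suc m))) * (scal (to_fract (zform c n (Suc m)) ^ K) * psi c n w)"
proof -
  let ?y = "to_fract (zform c n (Suc m))"
  have y: "?y ^ k * inverse ?y ^ k = 1" for k
    using assms by (simp flip: power_mult_distrib)
  have "psi c n (scal (mvar (Suc m) ^ Suc K) * g + scal (mvar (Suc m) ^ K) * h * gen (Suc m) + w) =
      scal (inverse ?y ^ Suc K) * psi c n g +
      scal (inverse ?y ^ Suc K) * (psi c n h * emb (dzform c n (Suc m))) + psi c n w"
    unfolding psi_add psi_mult psi_scal_mvar_power psi_u dlog_def zinv_def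
      scal_left_commute[of "psi c n h"] mult.assoc
    by (simp add: scal_mult_assoc mult.commute)
  then show ?thesis
    by (simp only: distrib_left scal_mult_assoc y) (simp add: scal_mult_assoc)
qed

text \<open>Only existence of the value matters: in \<open>pole_leading_coeff\<close> it is
  multiplied by the value 0 of the last form.\<close>

lemma pole_specialization:
  fixes c :: "nat \<Rightarrow> nat \<Rightarrow> 'a::field"
  assumes j: "j \<in> {1..n}" "c (Suc m) j \<noteq> 0"
    and z: "\<And>i. i \<in> {1..m} \<Longrightarrow> zform (restrict_coeffs c (Suc m) j) n i \<noteq> 0"
    and w: "w \<in> pole_filtration m K"
  shows "\<exists>v. spec_ext (restrict_poly c n (Suc m) j)
    (scal (to_fract (zform c n (Suc m)) ^ K) * psi c n w) v"
  using w
proof (induction K arbitrary: w)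
  case 0
  then show ?case using spec_ext_psi[OF j(1) z, of "{1..m}" w] by auto
next
  case (Suc K)
  note hom = restrict_poly_hom[of c n "Suc m" j]
  have z0: "zform c n (Suc m) \<noteq> 0" using lookup_zform[OF j(1), of c "Suc m"] j(2) by auto
  obtain g h v where w: "g \<in> forms {1..m}" "h \<in> forms {1..m}" "v \<in> pole_filtration m K"
    "w = scal (mvar (Suc m) ^ Suc K) * g + scal (mvar (Suc m) ^ K) * h * gen (Suc m) + v"
    using Suc.prems(1) by (rule pole_filtration_SucE)
  obtain x where "spec_ext (restrict_poly c n (Suc m) j) (psi c n g) x"
    using spec_ext_psi[OF j(1) z w(1)] by blast
  moreover obtain y where "spec_ext (restrict_poly c n (Suc m) j) (psi c n h) y"
    using spec_ext_psi[OF j(1) z w(2)] by blast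
  moreover obtain v' where "spec_ext (restrict_poly c n (Suc m) j)
      (scal (to_fract (zform c n (Suc m)) ^ K) * psi c n v) v'"
    using Suc.IH[OF w(3)] by blast
  moreover have "spec_ext (restrict_poly c n (Suc m) j) (scal (to_fract (zform c n (Suc m))))
      (scal (to_fract (restrict_poly c n (Suc m) j (zform c n (Suc m)))))"
    by (intro spec_ext_scal spec_to_fract hom)
  ultimately have "spec_ext (restrict_poly c n (Suc m) j)
      (psi c n g + psi c n h * emb (dzform c n (Suc m)) + scal (to_fract (zform c n (Suc m))) *
        (scal (to_fract (zform c n (Suc m)) ^ K) * psi c n v))
      (x + y * emb (dzform c n (Suc m)) +
        scal (to_fract (restrict_poly c n (Suc m) j (zform c n (Suc m)))) * v')"
    by (intro spec_ext_add spec_ext_mult spec_ext_emb_dzform hom)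
  then show ?case unfolding w(4) psi_pole_step[OF z0] by blast
qed

lemma pole_leading_coeff:
  fixes c :: "nat \<Rightarrow> nat \<Rightarrow> 'a::field"
  assumes j: "j \<in> {1..n}" "c (Suc m) j \<noteq> 0"
    and z: "\<And>i. i \<in> {1..m} \<Longrightarrow> zform (restrict_coeffs c (Suc m) j) n i \<noteq> 0"
    and w: "g \<in> forms {1..m}" "h \<in> forms {1..m}" "w \<in> pole_filtration m K"
    and eq: "psi c n (scal (mvar (Suc m) ^ Suc K) * g +
      scal (mvar (Suc m) ^ K) * h * gen (Suc m) + w) = 0"
  shows "psi (restrict_coeffs c (Suc m) j) n g = 0"
    and "g = 0 \<Longrightarrow> psi (restrict_coeffs c (Suc m) j) n h = 0"
proof -
  let ?c = "restrict_coeffs c (Suc m) j" and ?s = "restrict_poly c n (Suc m) j"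
  let ?y = "to_fract (zform c n (Suc m))" and ?dy = "emb (dzform c n (Suc m))"
  note hom = restrict_poly_hom[of c n "Suc m" j]
  have z0: "zform c n (Suc m) \<noteq> 0" using lookup_zform[OF j(1), of c "Suc m"] j(2) by auto
  obtain x where x: "spec_ext ?s (psi c n g) x" "x * ?dy = psi ?c n g * ?dy"
    using spec_ext_psi[OF j(1) z w(1)] by blast
  obtain y where y: "spec_ext ?s (psi c n h) y" "y * ?dy = psi ?c n h * ?dy"
    using spec_ext_psi[OF j(1) z w(2)] by blast
  obtain v where v: "spec_ext ?s (scal (?y ^ K) * psi c n w) v"
    using pole_specialization[OF j z w(3)] by blast
  have "?s (zform c n (Suc m)) = 0"
    unfolding restrict_poly_zform[OF j(1)] zform_restrict_coeffs using j(2) by simp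
  then have y0: "spec_ext ?s (scal ?y) 0"
    using spec_ext_scal[OF hom spec_to_fract[OF hom], of "zform c n (Suc m)"] by simp
  have "spec_ext ?s (psi c n g + psi c n h * ?dy + scal ?y * (scal (?y ^ K) * psi c n w))
      (x + y * ?dy + 0 * v)"
    by (intro spec_ext_add spec_ext_mult spec_ext_emb_dzform hom x y y0 v)
  then have 0: "x + y * ?dy = 0"
    using psi_pole_step[OF z0, of K g h w] eq spec_ext_0_left[OF hom] by simp
  \<comment> \<open>A second factor dz removes the contribution of \<open>h\<close> and lets
    \<open>x\<close> be exchanged for the restricted \<psi>(g).\<close>
  have "(x + y * ?dy) * ?dy = psi ?c n g * ?dy"
    by (simp add: distrib_right x(2) mult.assoc emb_dzform_square)
  then show "psi ?c n g = 0"
    using 0 coef_psi_restrict_eq_0[where c = c and m = "Suc m", OF j(2) w(1)]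
      eq_0_if_mult_dzform_eq_0[where c = c and m = "Suc m", OF j] by simp
  assume "g = 0"
  then have "x = 0" using x(1) spec_ext_0_left[OF hom] by (simp add: psi_0)
  then have "psi ?c n h * ?dy = 0" using 0 y(2) by simp
  then show "psi ?c n h = 0"
    using coef_psi_restrict_eq_0[where c = c and m = "Suc m", OF j(2) w(2)]
      eq_0_if_mult_dzform_eq_0[where c = c and m = "Suc m", OF j] by simp
qed

lemma pole_filtration_power:
  assumes "g \<in> forms {1..m}"
  shows "scal (mvar (Suc m) ^ K) * g \<in> pole_filtration m K"
proof (induction K)
  case (Suc K)
  have "scal (mvar (Suc m) ^ Suc K) * g = scal (mvar (Suc m)) * (scal (mvar (Suc m) ^ K) * g)"
    by (simp add: scal_mult_assoc)
  then show ?case using pole_filtration_t[OF Suc] by simp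
qed (use assms in simp)

section \<open>The kernel of \<open>\<psi>\<close>\<close>

text \<open>Deletion and restriction: \<open>IH\<close> concerns the arrangement without its last
  form, \<open>IH'\<close> its restriction to the last hyperplane.\<close>

lemma kernel_pole_step:
  fixes c :: "nat \<Rightarrow> nat \<Rightarrow> 'a::field"
  assumes z: "\<And>i. i \<in> {1..Suc m} \<Longrightarrow> zform c n i \<noteq> 0"
    and j: "j \<in> {1..n}" "c (Suc m) j \<noteq> 0"
    and z': "\<And>i. i \<in> {1..m} \<Longrightarrow> zform (restrict_coeffs c (Suc m) j) n i \<noteq> 0"
    and IH: "\<And>w. w \<in> forms {1..m} \<Longrightarrow> psi c n w = 0 \<Longrightarrow> w \<in> rel_ideal c n m"
    and IH': "\<And>w. w \<in> forms {1..m} \<Longrightarrow> psi (restrict_coeffs c (Suc m) j) n w = 0 \<Longrightarrow>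
      w \<in> rel_ideal (restrict_coeffs c (Suc m) j) n m"
    and w: "w \<in> pole_filtration m K" "psi c n w = 0"
  shows "w \<in> rel_ideal c n (Suc m)"
  using w
proof (induction K arbitrary: w)
  case 0
  then show ?case using IH[of w] rel_ideal_mono[of m "Suc m" c n] by auto
next
  case (Suc K)
  let ?I = "rel_ideal c n (Suc m)" and ?t = "mvar (Suc m) :: 'a mpoly"
  let ?u = "gen (Suc m) :: 'a mpoly extalg"
  have I: "scal (?t ^ K) * x \<in> ?I" if "x \<in> ?I" for x
    using that by (intro rel_ideal_closed) (simp_all add: mpolys_power mpolys_closed)
  have psi_I: "psi c n x = 0" if "x \<in> ?I" for x by (rule psi_rel_ideal[OF z that])
  obtain g h v where w: "g \<in> forms {1..m}" "h \<in> forms {1..m}" "v \<in> pole_filtration m K"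
    "w = scal (?t ^ Suc K) * g + scal (?t ^ K) * h * ?u + v"
    using Suc.prems(1) by (rule pole_filtration_SucE)
  have "psi (restrict_coeffs c (Suc m) j) n g = 0"
    by (rule pole_leading_coeff(1)[OF j z' w(1-3) Suc.prems(2)[unfolded w(4)]])
  then obtain g1 h1 where 1: "g1 \<in> forms {1..m}" "h1 \<in> forms {1..m}"
    "scal ?t * g - g1 - h1 * ?u \<in> ?I"
    using reduce_t[OF IH'[OF w(1)]] by blast
  \<comment> \<open>Replacing t g by \<open>g1\<close> plus \<open>h1\<close> u lowers the first
    part to order \<open>K\<close> and changes the coefficient of t^K u to \<open>h + h1\<close>.
    Only then is the coefficient of t^(K+1) zero, as the statement about u requires.\<close>
  define v1 where "v1 = scal (?t ^ K) * g1 + v"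
  have v1: "v1 \<in> pole_filtration m K"
    unfolding v1_def by (intro pole_filtration_add pole_filtration_power 1 w)
  have h: "h + h1 \<in> forms {1..m}" using w 1 by (simp add: forms_closed)
  have w1: "w = scal (?t ^ K) * (scal ?t * g - g1 - h1 * ?u) +
      (scal (?t ^ Suc K) * 0 + scal (?t ^ K) * (h + h1) * ?u + v1)"
    unfolding w(4) v1_def
    by (simp add: right_diff_distrib distrib_left distrib_right mult.assoc scal_mult_assoc power_commutes)
  have "psi c n (scal (?t ^ Suc K) * 0 + scal (?t ^ K) * (h + h1) * ?u + v1) = 0"
    using Suc.prems(2) psi_I[OF I[OF 1(3)]] by (subst (asm) w1) (simp only: psi_add add_0)
  from pole_leading_coeff(2)[OF j z' forms_closed(1) h v1 this]
  have "psi (restrict_coeffs c (Suc m) j) n (h + h1) = 0" by simp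
  then obtain g2 where 2: "g2 \<in> forms {1..m}" "(h + h1) * ?u - g2 \<in> ?I"
    using reduce_u[OF IH'[OF h]] by blast
  define v2 where "v2 = scal (?t ^ K) * g2 + v1"
  have v2: "v2 \<in> pole_filtration m K"
    unfolding v2_def by (intro pole_filtration_add pole_filtration_power 2 v1)
  have w2: "w = scal (?t ^ K) * (scal ?t * g - g1 - h1 * ?u) +
      scal (?t ^ K) * ((h + h1) * ?u - g2) + v2"
    unfolding v2_def by (subst w1) (simp add: right_diff_distrib mult.assoc)
  have "psi c n v2 = 0"
    using Suc.prems(2) psi_I[OF I[OF 1(3)]] psi_I[OF I[OF 2(2)]]
    by (subst (asm) w2) (simp only: psi_add add_0)
  then have "v2 \<in> ?I" by (rule Suc.IH[OF v2])
  then show ?case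
    by (subst w2) (intro rel_ideal_closed(2) I 1 2)
qed

lemma kernel_subset_rel_ideal:
  fixes c :: "nat \<Rightarrow> nat \<Rightarrow> 'a::field"
  assumes "\<And>i. i \<in> {1..m} \<Longrightarrow> zform c n i \<noteq> 0" "w \<in> forms {1..m}" "psi c n w = 0"
  shows "w \<in> rel_ideal c n m"
  using assms
\<comment> \<open>\<open>c\<close> is generalized because the hypothesis is applied both to the
  given coefficients and to the restricted ones.\<close>
proof (induction m arbitrary: c w)
  case 0
  \<comment> \<open>Without forms only the constants remain, and \<psi> is injective on
    them.\<close>
  have "\<exists>a. w = scal (mconst a)"
    using 0(2)
  proof (induction rule: forms_induct)
    case (add w v)
    then show ?case by (metis mconst_simps(3) scal_add)
  next
    case (mult w v)
    then show ?case by (metis mconst_simps(4) scal_mult)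
  qed auto
  then obtain a where a: "w = scal (mconst a)" by blast
  then have "coef (scal (to_fract (mconst a))) {} = 0"
    using 0(3) by (simp add: psi_scal_mconst)
  then have "w = 0" using a by (simp add: scal.rep_eq)
  then show ?case by (simp add: rel_ideal_closed)
next
  case (Suc m)
  note z = Suc.prems(1)
  have IH: "v \<in> rel_ideal c n m" if "v \<in> forms {1..m}" "psi c n v = 0" for v
    using Suc.IH[of c v] that z by simp
  have "\<exists>j\<in>{1..n}. c (Suc m) j \<noteq> 0"
  proof (rule ccontr)
    assume "\<not> (\<exists>j\<in>{1..n}. c (Suc m) j \<noteq> 0)"
    then have "zform c n (Suc m) = 0" by (simp add: zform_def)
    then show False using z by simp
  qed
  then obtain j where j: "j \<in> {1..n}" "c (Suc m) j \<noteq> 0" by blast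
  show ?case
  \<comment> \<open>The hypothesis for the restriction needs non-zero forms; a form vanishing there
    is a multiple of the last one.\<close>
  proof (cases "\<exists>i\<in>{1..m}. zform (restrict_coeffs c (Suc m) j) n i = 0")
    case True
    then obtain i where i: "i \<in> {1..m}" "zform (restrict_coeffs c (Suc m) j) n i = 0" by blast
    define l where "l = c i j / c (Suc m) j"
    have zi: "zform c n i = mconst l * zform c n (Suc m)"
      using i(2) by (simp add: zform_restrict_coeffs l_def)
    have "zform c n i \<noteq> 0" using z[of i] i(1) by simp
    then have "l \<noteq> 0" using zi by auto
    then obtain w' where w': "w' \<in> forms {1..m}" "w - w' \<in> rel_ideal c n (Suc m)"
      using reduce_parallel[OF i(1) _ zi Suc.prems(2)] by blast
    have "psi c n w' = 0"
      using psi_rel_ideal[OF z w'(2)] Suc.prems(3) by (simp add: psi_diff)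
    then have "w' \<in> rel_ideal c n (Suc m)"
      using IH[OF w'(1)] rel_ideal_mono[of m "Suc m" c n] by auto
    then show ?thesis using rel_ideal_closed(2)[OF w'(2)] by fastforce
  next
    case False
    then have z': "zform (restrict_coeffs c (Suc m) j) n i \<noteq> 0" if "i \<in> {1..m}" for i
      using that by blast
    obtain K where "w \<in> pole_filtration m K" using pole_filtration_exhaust[OF Suc.prems(2)] by blast
    then show ?thesis
      using kernel_pole_step[OF z j z' IH Suc.IH[OF z']] Suc.prems(3) by blast
  qed
qed

theorem theorem3:
  fixes c :: "nat \<Rightarrow> nat \<Rightarrow> 'a::field" and n m :: nat
  assumes "\<And>i. i \<in> {1..m} \<Longrightarrow> zform c n i \<noteq> 0"
  shows "a_kernel (Xi m) (T_loc c n m) (psi c n) =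
      Idl\<^bsub>Xi m\<^esub> {P_rel L S | L S. is_relation c n m L \<and> S \<subseteq> supp L} \<and>
    (\<lambda>X. the_elem (psi c n ` X)) \<in>
      ring_iso (Xi m Quot Idl\<^bsub>Xi m\<^esub> {P_rel L S | L S. is_relation c n m L \<and> S \<subseteq> supp L}) (T_sub c n m)"
proof -
  let ?G = "{P_rel L S | L S. is_relation c n m L \<and> S \<subseteq> supp L}"
  interpret psi: ring_hom_ring "Xi m" "T_loc c n m" "psi c n"
    using ring_Xi ring_T[of m c n] psi_ring_hom[of m c n] assms by (intro ring_hom_ringI2) auto
  have G: "?G \<subseteq> forms {1..m}"
    using P_in_Xi(1)[of _ m] by (auto simp: is_relation_def Xi_def)
  have Idl: "Idl\<^bsub>Xi m\<^esub> ?G = rel_ideal c n m"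
    unfolding Xi_def rel_ideal_def
    using ring_Xi[of m] G by (intro genideal_ring_on) (auto simp: Xi_def forms_closed)
  have sub: "rel_ideal c n m \<subseteq> forms {1..m}"
    using psi.R.genideal_ideal[of ?G] G ideal.Icarr unfolding Idl by (fastforce simp: Xi_def)
  have zero: "\<zero>\<^bsub>T_loc c n m\<^esub> = 0"
    unfolding T_loc_def by (rule ring_on_simps(5))
  have ker: "a_kernel (Xi m) (T_loc c n m) (psi c n) = rel_ideal c n m"
    unfolding a_kernel_def' zero Xi_def ring_on_simps
    using kernel_subset_rel_ideal[OF assms] psi_rel_ideal[OF assms] sub by blast
  \<comment> \<open>The first isomorphism theorem ends in the localization with its carrier cut down
    to the image, which is the subring generated by the prescribed elements.\<close>
  have T: "T_loc c n m\<lparr>carrier := psi c n ` carrier (Xi m)\<rparr> = T_sub c n m"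
    using psi_image[OF assms] by (simp add: T_sub_def)
  show ?thesis
    using psi.FactRing_iso_set_aux unfolding T ker Idl by simp
qed

end
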